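(* Denote by $\beta_i^r$ the $i$th total Betti number of $I(C_r)$ (for $r\geq 3$) and by $\lambda_i^r$ the $i$th total Betti number of $L(C_r)$ (for $r\geq 4$). Then for each $n\geq 4$ we have \[ \beta_i^n=2\beta_i^{n-1}+\lambda_{i-1}^n\quad\text{for all } i\geq 0. \]
   Context: For $k\geq 3$, $C_k$ denotes the $k$-cycle with vertex set $[k]=\{1,\dots,k\}$ and edges $e_i=\{i,i+1\}$ for $i=1,\dots,k-1$ and $e_k=\{1,k\}$. For $A\subseteq[k]$ the cut monomial is $u_A=\alpha_1\cdots\alpha_k$, where $\alpha_i=s_i$ if exactly one of the two vertices of $e_i$ belongs to $A$, and $\alpha_i=t_i$ otherwise; the monomial cut ideal is $I(C_k)=\langle u_A: A\subseteq[k]\rangle$, an ideal in the polynomial ring over a field $K$ in the variables $s_1,\dots,s_k,t_1,\dots,t_k$ (it may be extended to a polynomial ring with more variables without changing Betti numbers). For $k\geq 4$, the ideal $I'(C_{k-1})$ is obtained from $I(C_{k-1})$ by exchanging $s_{k-1}$ and $t_{k-1}$ and keeping the other variables unchanged, and $L(C_k)=I(C_{k-1})\cap I'(C_{k-1})$. The $i$th total Betti number of a finitely generated graded module $M$ over a polynomial ring $S$ over $K$ is $\beta_i(M)=\dim_K\operatorname{Tor}_i^S(M,K)$, and it is $0$ for $i<0$ (so $\lambda_{-1}^n=0$). *)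

theory Defs
  imports
    "HOL-Library.Poly_Mapping"
    "HOL-Combinatorics.Transposition"
    "Jordan_Normal_Form.Matrix_Kernel"
    "Jordan_Normal_Form.DL_Rank"
begin

text \<open>A polynomial over \<open>'k\<close> in variables from \<open>'v\<close> is a finitely supported map
  from exponent vectors to coefficients. \<open>poly_ring V\<close> is the polynomial ring
  \<open>K[x. x \<in> V]\<close>, where \<open>K\<close> is the field \<open>'k\<close>.\<close>

type_synonym ('v, 'k) mpoly = "('v \<Rightarrow>\<^sub>0 nat) \<Rightarrow>\<^sub>0 'k"

definition poly_ring :: "'v set \<Rightarrow> ('v, 'k::comm_ring_1) mpoly set" where
  "poly_ring V = {p. \<forall>m \<in> Poly_Mapping.keys p. Poly_Mapping.keys m \<subseteq> V}"

definition mvar :: "'v \<Rightarrow> ('v, 'k::comm_ring_1) mpoly" where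
  "mvar x = Poly_Mapping.single (Poly_Mapping.single x 1) 1"

definition const_coeff :: "('v, 'k::comm_ring_1) mpoly \<Rightarrow> 'k" where
  "const_coeff p = Poly_Mapping.lookup p 0"

definition ideal_gen ::
    "'v set \<Rightarrow> ('v, 'k::comm_ring_1) mpoly set \<Rightarrow> ('v, 'k) mpoly set" where
  "ideal_gen V G =
     {\<Sum>g\<in>F. q g * g | F q. finite F \<and> F \<subseteq> G \<and> (\<forall>g\<in>F. q g \<in> poly_ring V)}"

definition rename_vars ::
    "('v \<Rightarrow> 'v) \<Rightarrow> ('v, 'k::comm_ring_1) mpoly \<Rightarrow> ('v, 'k) mpoly" where
  "rename_vars \<sigma> p = Poly_Mapping.map_key (Poly_Mapping.map_key \<sigma>) p"
  \<comment> \<open>For bijective \<open>\<sigma>\<close> this is the ring automorphism with \<open>x \<mapsto> \<sigma> x\<close>.\<close>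

lemma rename_vars_mvar:
  assumes "bij \<sigma>"
  shows "rename_vars \<sigma> (mvar x :: ('v, 'k::comm_ring_1) mpoly) = mvar (\<sigma> x)"
proof -
  have inj: "inj \<sigma>" and surj: "surj \<sigma>" using assms by (auto simp: bij_def)
  have key: "Poly_Mapping.map_key \<sigma> (Poly_Mapping.single (\<sigma> x) (1::nat)) = Poly_Mapping.single x 1"
    by (rule map_key_single[OF inj])
  have inj': "inj (Poly_Mapping.map_key \<sigma> :: ('v \<Rightarrow>\<^sub>0 nat) \<Rightarrow> _)"
  proof (rule injI)
    fix p q :: "'v \<Rightarrow>\<^sub>0 nat"
    assume eq: "Poly_Mapping.map_key \<sigma> p = Poly_Mapping.map_key \<sigma> q"
    show "p = q"
    proof (rule poly_mapping_eqI)
      fix y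
      obtain z where "y = \<sigma> z" using surj by blast
      then show "Poly_Mapping.lookup p y = Poly_Mapping.lookup q y"
        using arg_cong[OF eq, of "\<lambda>r. Poly_Mapping.lookup r z"] inj
        by (simp add: map_key.rep_eq)
    qed
  qed
  show ?thesis
    unfolding rename_vars_def mvar_def
    by (rule map_key_single[OF inj', of "Poly_Mapping.single (\<sigma> x) 1" "1::'k", unfolded key])
qed


subsection \<open>Total Betti numbers\<close>

text \<open>Write \<open>S = poly_ring V\<close>. The elements of the free module \<open>S^b\<close> are the vectors
  of dimension \<open>b\<close> with entries in \<open>S\<close>.\<close>

definition free_mod :: "'v set \<Rightarrow> nat \<Rightarrow> ('v, 'k::comm_ring_1) mpoly vec set" where
  "free_mod V b = {v \<in> carrier_vec b. \<forall>j<b. v $ j \<in> poly_ring V}"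

text \<open>A resolution \<open>\<dots> \<rightarrow> S^(b 1) \<rightarrow> S^(b 0) \<rightarrow> M \<rightarrow> 0\<close> of an ideal \<open>M\<close> of \<open>S\<close> by free
  modules of finite rank. The augmentation is \<open>v \<mapsto> g \<bullet> v\<close>, and \<open>d i\<close> is the matrix of the
  differential from \<open>S^(b (i + 1))\<close> to \<open>S^(b i)\<close>. Gradings are not recorded, as they play
  no role in \<open>Tor\<close> as a vector space.\<close>

definition free_resolution ::
    "'v set \<Rightarrow> ('v, 'k::comm_ring_1) mpoly set \<Rightarrow> (nat \<Rightarrow> nat) \<Rightarrow> ('v, 'k) mpoly vec
      \<Rightarrow> (nat \<Rightarrow> ('v, 'k) mpoly mat) \<Rightarrow> bool" where
  "free_resolution V M b g d \<longleftrightarrow>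
     g \<in> free_mod V (b 0) \<and>
     (\<forall>i. d i \<in> carrier_mat (b i) (b (Suc i)) \<and> elements_mat (d i) \<subseteq> poly_ring V) \<and>
     (\<lambda>v. g \<bullet> v) ` free_mod V (b 0) = M \<and>
     {v \<in> free_mod V (b 0). g \<bullet> v = 0} = (\<lambda>v. d 0 *\<^sub>v v) ` free_mod V (b 1) \<and>
     (\<forall>i. {v \<in> free_mod V (b (Suc i)). d i *\<^sub>v v = 0\<^sub>v (b i)} =
          (\<lambda>v. d (Suc i) *\<^sub>v v) ` free_mod V (b (Suc (Suc i))))"

text \<open>The complex obtained by tensoring the resolution (without \<open>M\<close>) with \<open>K\<close> over \<open>S\<close>.
  The \<open>S\<close>-module \<open>K\<close> is the quotient of \<open>S\<close> by the ideal of all variables, so an element of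
  \<open>S\<close> acts on it through its constant coefficient. Under \<open>S^b \<otimes> K = K^b\<close> the differentials
  therefore become the matrices of constant coefficients.
  \<open>tensor_diff b d i\<close> is the differential leaving homological degree \<open>i\<close>; in degree \<open>0\<close> it is
  the map from \<open>K^(b 0)\<close> to the zero space.\<close>

definition tensor_diff ::
    "(nat \<Rightarrow> nat) \<Rightarrow> (nat \<Rightarrow> ('v, 'k::comm_ring_1) mpoly mat) \<Rightarrow> nat \<Rightarrow> 'k mat" where
  "tensor_diff b d i =
     (case i of 0 \<Rightarrow> 0\<^sub>m 0 (b 0) | Suc j \<Rightarrow> map_mat const_coeff (d j))"

text \<open>The dimension of \<open>Tor_i(M, K)\<close>, which is the kernel of the differential leaving
  degree \<open>i\<close> modulo the image of the one entering it. The rank of a matrix is the dimension of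
  its image, and all spaces are finite-dimensional.\<close>

definition tor_dim ::
    "(nat \<Rightarrow> nat) \<Rightarrow> (nat \<Rightarrow> ('v, 'k::field) mpoly mat) \<Rightarrow> nat \<Rightarrow> nat" where
  "tor_dim b d i =
     kernel_dim (tensor_diff b d i) - vec_space.rank (b i) (tensor_diff b d (Suc i))"

text \<open>As usual, \<open>Tor\<close> is computed from a chosen resolution. If \<open>V\<close> is finite, one of the
  required form exists for every ideal of \<open>poly_ring V\<close>, since that ring is Noetherian.\<close>

definition betti :: "'v set \<Rightarrow> ('v, 'k::field) mpoly set \<Rightarrow> int \<Rightarrow> nat" where
  "betti V M i =
     (if i < 0 then 0
      else case (SOME (b, g, d). free_resolution V M b g d) of
             (b, g, d) \<Rightarrow> tor_dim b d (nat i))"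


subsection \<open>Monomial cut ideals of cycles\<close>

datatype cut_var = SVar nat | TVar nat

definition cut_vars :: "nat \<Rightarrow> cut_var set" where
  "cut_vars k = SVar ` {1..k} \<union> TVar ` {1..k}"

definition cycle_edge :: "nat \<Rightarrow> nat \<Rightarrow> nat set" where
  "cycle_edge k i = (if i < k then {i, i + 1} else {1, k})"

definition cut_monomial :: "nat \<Rightarrow> nat set \<Rightarrow> (cut_var, 'k::comm_ring_1) mpoly" where
  "cut_monomial k A =
     (\<Prod>i=1..k. if card (cycle_edge k i \<inter> A) = 1 then mvar (SVar i) else mvar (TVar i))"

definition cut_ideal :: "nat \<Rightarrow> (cut_var, 'k::comm_ring_1) mpoly set" where
  "cut_ideal k = ideal_gen (cut_vars k) {cut_monomial k A | A. A \<subseteq> {1..k}}"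

text \<open>\<open>I'(C_k)\<close>, with \<open>k\<close> in place of \<open>k - 1\<close>.\<close>

definition swapped_cut_ideal :: "nat \<Rightarrow> (cut_var, 'k::comm_ring_1) mpoly set" where
  "swapped_cut_ideal k = rename_vars (transpose (SVar k) (TVar k)) ` cut_ideal k"

definition cut_L :: "nat \<Rightarrow> (cut_var, 'k::comm_ring_1) mpoly set" where
  "cut_L k = cut_ideal (k - 1) \<inter> swapped_cut_ideal (k - 1)"

text \<open>The Betti numbers of \<open>I(C_r)\<close> and \<open>L(C_r)\<close>, each over the polynomial ring in exactly the
  variables of the cycle(s) defining it; for \<open>L(C_r)\<close> these are the variables of \<open>C_(r-1)\<close>.
  The first argument fixes the field.\<close>

definition beta :: "'k::field itself \<Rightarrow> nat \<Rightarrow> int \<Rightarrow> nat" where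
  "beta K r i = betti (cut_vars r) (cut_ideal r :: (cut_var, 'k) mpoly set) i"

definition lambda :: "'k::field itself \<Rightarrow> nat \<Rightarrow> int \<Rightarrow> nat" where
  "lambda K r i = betti (cut_vars (r - 1)) (cut_L r :: (cut_var, 'k) mpoly set) i"

end

theory Submission
  imports Defs
begin

text \<open>
  The generators of the cut ideal of a cycle are products with one factor \<open>s\<^sub>i\<close> or \<open>t\<^sub>i\<close> for each
  edge, and the edge sets that occur as cuts are exactly those of even cardinality. Let \<open>E\<^sub>k\<close> and
  \<open>O\<^sub>k\<close> be the monomial ideals generated by the products with an even, respectively odd, number of
  factors \<open>s\<^sub>i\<close>, over the edges \<open>1, \<dots>, k\<close>. Then \<open>I(C\<^sub>k) = E\<^sub>k\<close>, the exchange of \<open>s\<^sub>k\<close> and \<open>t\<^sub>k\<close>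
  turns \<open>E\<^sub>k\<close> into \<open>O\<^sub>k\<close>, and splitting off the factor of the last edge gives, with \<open>n = k + 1\<close>,
  \<open>E\<^sub>n = t\<^sub>n E\<^sub>k + s\<^sub>n O\<^sub>k\<close>. As \<open>s\<^sub>n\<close> and \<open>t\<^sub>n\<close> occur in no generator of \<open>E\<^sub>k\<close> or \<open>O\<^sub>k\<close>, the
  sequence
  \<open>0 \<rightarrow> E\<^sub>k \<inter> O\<^sub>k \<rightarrow> E\<^sub>k \<oplus> O\<^sub>k \<rightarrow> E\<^sub>n \<rightarrow> 0\<close>
  with the maps \<open>r \<mapsto> (s\<^sub>n r, - t\<^sub>n r)\<close> and \<open>(p, q) \<mapsto> t\<^sub>n p + s\<^sub>n q\<close> is exact. Its left map is a
  multiple of variables and so vanishes on \<open>Tor(-, K)\<close>. Hence the long exact sequence of \<open>Tor\<close>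
  falls apart into \<open>\<beta>\<^sub>i(E\<^sub>n) = \<beta>\<^sub>i(E\<^sub>k) + \<beta>\<^sub>i(O\<^sub>k) + \<beta>\<^sub>i\<^sub>-\<^sub>1(E\<^sub>k \<inter> O\<^sub>k)\<close>, and \<open>\<beta>\<^sub>i(O\<^sub>k) = \<beta>\<^sub>i(E\<^sub>k)\<close>
  because renaming variables does not change Betti numbers.

  The proof replaces the long exact sequence by an explicit mapping cone. Resolutions of \<open>E\<^sub>k\<close>, \<open>O\<^sub>k\<close>
  and their intersection, together with liftings \<open>\<alpha>\<close>, \<open>\<beta>\<close> of the two inclusions, give a resolution
  of \<open>E\<^sub>n\<close> (\<open>resolves_sum_cone\<close>). After tensoring with \<open>K\<close> the part of its differential that comes
  from \<open>(s\<^sub>n \<alpha>, - t\<^sub>n \<beta>)\<close> disappears, and what remains is block diagonal (\<open>tor_rank_sum_cone\<close>).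

  Two things are needed to read off Betti numbers. First, the Betti numbers must be computable from
  any resolution (\<open>betti_eqI\<close>): the comparison theorem makes two resolutions of the same ideal
  homotopy equivalent, and homotopy equivalent complexes over \<open>K\<close> have homology of the same
  dimension (\<open>tor_rank_independent\<close>). Second, resolutions must exist. The same mapping cone provides
  them (\<open>monomial_ideal_resolution\<close>): adding one more monomial \<open>g\<close> to an ideal with \<open>r\<close> monomial
  generators leads to an intersection with \<open>(g)\<close>, which has again at most \<open>r\<close> generators, namely
  least common multiples. The resolutions obtained in this way remain exact over every polynomial
  ring in more variables, so that \<open>E\<^sub>k\<close> and \<open>E\<^sub>n\<close> can be compared although their Betti numbers refer to
  different rings.
\<close>

abbreviation (input) "keys \<equiv> Poly_Mapping.keys"
abbreviation (input) "lookup \<equiv> Poly_Mapping.lookup"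
abbreviation (input) "single \<equiv> Poly_Mapping.single"

section \<open>Stacked matrices\<close>

lemma index_append_rows:
  assumes "A \<in> carrier_mat a m" "B \<in> carrier_mat b m" "i < a + b" "j < m"
  shows "(A @\<^sub>r B) $$ (i,j) = (if i < a then A $$ (i,j) else B $$ (i - a, j))"
  using assms unfolding append_rows_def by auto

lemma append_rows_eq_iff:
  assumes "A \<in> carrier_mat a m" "B \<in> carrier_mat b m" "C \<in> carrier_mat a m" "D \<in> carrier_mat b m"
  shows "A @\<^sub>r B = C @\<^sub>r D \<longleftrightarrow> A = C \<and> B = D"
proof (intro iffI conjI)
  assume eq: "A @\<^sub>r B = C @\<^sub>r D"
  show "A = C"
  proof (rule eq_matI)
    fix i j assume "i < dim_row C" "j < dim_col C"
    then show "A $$ (i,j) = C $$ (i,j)"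
      using arg_cong[OF eq, of "\<lambda>M. M $$ (i,j)"] assms by (simp add: index_append_rows)
  qed (use assms in auto)
  show "B = D"
  proof (rule eq_matI)
    fix i j assume "i < dim_row D" "j < dim_col D"
    then show "B $$ (i,j) = D $$ (i,j)"
      using arg_cong[OF eq, of "\<lambda>M. M $$ (a + i,j)"] assms by (simp add: index_append_rows)
  qed (use assms in auto)
qed auto

lemma append_rows_cases:
  assumes "Z \<in> carrier_mat (a + b) m"
  obtains X Y where "X \<in> carrier_mat a m" "Y \<in> carrier_mat b m" "Z = X @\<^sub>r Y"
proof
  let ?X = "mat a m (\<lambda>(i,j). Z $$ (i,j))" and ?Y = "mat b m (\<lambda>(i,j). Z $$ (a + i,j))"
  show X: "?X \<in> carrier_mat a m" and Y: "?Y \<in> carrier_mat b m" by auto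
  show "Z = ?X @\<^sub>r ?Y"
  proof (rule eq_matI)
    fix i j assume "i < dim_row (?X @\<^sub>r ?Y)" "j < dim_col (?X @\<^sub>r ?Y)"
    then have "i < a + b" "j < m" using carrier_matD[OF carrier_append_rows[OF X Y]] by simp_all
    then show "Z $$ (i,j) = (?X @\<^sub>r ?Y) $$ (i,j)"
      by (subst index_append_rows[OF X Y]) auto
  qed (use assms carrier_matD[OF carrier_append_rows[OF X Y]] in simp_all)
qed

lemma four_block_mult_append_rows:
  fixes A :: "'a::comm_ring_1 mat"
  assumes "A \<in> carrier_mat p a" "B \<in> carrier_mat p b" "C \<in> carrier_mat q a" "D \<in> carrier_mat q b"
    and "X \<in> carrier_mat a m" "Y \<in> carrier_mat b m"
  shows "four_block_mat A B C D * (X @\<^sub>r Y) = (A * X + B * Y) @\<^sub>r (C * X + D * Y)"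
proof -
  have "four_block_mat A B C D * (X @\<^sub>r Y) =
      four_block_mat (A * X + B * Y) (A * 0\<^sub>m a 0 + B * 0\<^sub>m b 0)
        (C * X + D * Y) (C * 0\<^sub>m a 0 + D * 0\<^sub>m b 0)"
    using assms unfolding append_rows_def
    by (subst mult_four_block_mat[OF assms(1-4)]) auto
  then show ?thesis using assms unfolding append_rows_def by auto
qed

lemma append_rows_mult:
  fixes X :: "'a::comm_ring_1 mat"
  assumes "X \<in> carrier_mat a m" "Y \<in> carrier_mat b m" "Z \<in> carrier_mat m k"
  shows "(X @\<^sub>r Y) * Z = (X * Z) @\<^sub>r (Y * Z)"
proof -
  have X0: "X @\<^sub>r Y = four_block_mat X (0\<^sub>m a 0) Y (0\<^sub>m b 0)"
    and XZ: "(X * Z) @\<^sub>r (Y * Z) = four_block_mat (X * Z) (0\<^sub>m a 0) (Y * Z) (0\<^sub>m b 0)"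
    using assms unfolding append_rows_def by auto
  have Z: "Z = four_block_mat Z (0\<^sub>m m 0) (0\<^sub>m 0 k) (0\<^sub>m 0 0)"
    using assms by (intro eq_matI) auto
  have "(X @\<^sub>r Y) * Z = four_block_mat X (0\<^sub>m a 0) Y (0\<^sub>m b 0) * four_block_mat Z (0\<^sub>m m 0) (0\<^sub>m 0 k) (0\<^sub>m 0 0)"
    using X0 Z by simp
  also have "\<dots> = four_block_mat (X * Z) (0\<^sub>m a 0) (Y * Z) (0\<^sub>m b 0)"
    using assms by (subst mult_four_block_mat) (auto intro!: cong_four_block_mat)
  finally show ?thesis using XZ by simp
qed

lemma zero_append_rows: "0\<^sub>m (a + b) m = 0\<^sub>m a m @\<^sub>r 0\<^sub>m b m"
  by (rule eq_matI) (auto simp: index_append_rows[where a=a and b=b and m=m] append_rows_def)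

lemma append_rows_add:
  fixes X :: "'a::comm_ring_1 mat"
  assumes "X \<in> carrier_mat a m" "Y \<in> carrier_mat b m" "X' \<in> carrier_mat a m" "Y' \<in> carrier_mat b m"
  shows "(X @\<^sub>r Y) + (X' @\<^sub>r Y') = (X + X') @\<^sub>r (Y + Y')"
  using assms unfolding append_rows_def
  by (subst add_four_block_mat) (auto intro!: cong_four_block_mat)

definition append_cols :: "'a::comm_ring_1 mat \<Rightarrow> 'a mat \<Rightarrow> 'a mat" where
  "append_cols A B = mat (dim_row A) (dim_col A + dim_col B)
     (\<lambda>(i,j). if j < dim_col A then A $$ (i,j) else B $$ (i, j - dim_col A))"

lemma append_cols_carrier:
  assumes "A \<in> carrier_mat p a" "B \<in> carrier_mat p b"
  shows "append_cols A B \<in> carrier_mat p (a + b)"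
  using assms unfolding append_cols_def by auto

lemma append_cols_mult:
  assumes A: "A \<in> carrier_mat p a" and B: "B \<in> carrier_mat p b"
    and X: "X \<in> carrier_mat a m" and Y: "Y \<in> carrier_mat b m"
  shows "append_cols A B * (X @\<^sub>r Y) = A * X + B * Y"
proof -
  have ac: "append_cols A B = four_block_mat A B (0\<^sub>m 0 a) (0\<^sub>m 0 b)"
    using A B by (intro eq_matI) (auto simp: append_cols_def)
  have c: "A * X + B * Y \<in> carrier_mat p m" using assms by auto
  have "append_cols A B * (X @\<^sub>r Y) = (A * X + B * Y) @\<^sub>r (0\<^sub>m 0 a * X + 0\<^sub>m 0 b * Y)"
    unfolding ac by (rule four_block_mult_append_rows) (use assms in auto)
  also have "\<dots> = (A * X + B * Y)"
    using assms by (intro eq_matI) (auto simp: append_rows_def)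
  finally show ?thesis .
qed

section \<open>Matrices over a polynomial ring\<close>

lemma keys_sum_subset: "keys (sum f I) \<subseteq> (\<Union>i\<in>I. keys (f i))"
  by (induction I rule: infinite_finite_induct) (auto dest: keys_add[THEN subsetD])

lemma keys_uminus: "keys (- p :: 'a \<Rightarrow>\<^sub>0 'b::ab_group_add) = keys p"
  by (auto simp: in_keys_iff)

lemma poly_ring_0: "0 \<in> poly_ring V"
  and poly_ring_1: "1 \<in> poly_ring V"
  by (auto simp: poly_ring_def)

lemma poly_ring_add: "p \<in> poly_ring V \<Longrightarrow> q \<in> poly_ring V \<Longrightarrow> p + q \<in> poly_ring V"
  using keys_add[of p q] by (auto simp: poly_ring_def)

lemma poly_ring_uminus: "p \<in> poly_ring V \<Longrightarrow> - p \<in> poly_ring V"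
  by (auto simp: poly_ring_def keys_uminus)

lemma poly_ring_mult:
  assumes "p \<in> poly_ring V" "q \<in> poly_ring V"
  shows "p * q \<in> poly_ring V"
  unfolding poly_ring_def
proof (clarify)
  fix m x assume "m \<in> keys (p * q)" "x \<in> keys m"
  then obtain a b where "a \<in> keys p" "b \<in> keys q" "x \<in> keys (a + b)"
    using keys_mult by blast
  then show "x \<in> V" using assms keys_add[of a b] unfolding poly_ring_def by blast
qed

lemma poly_ring_sum: "(\<And>i. i \<in> I \<Longrightarrow> f i \<in> poly_ring V) \<Longrightarrow> sum f I \<in> poly_ring V"
  by (induction I rule: infinite_finite_induct) (auto intro: poly_ring_0 poly_ring_add)

lemma poly_ring_mono: "V \<subseteq> W \<Longrightarrow> p \<in> poly_ring V \<Longrightarrow> p \<in> poly_ring W"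
  by (auto simp: poly_ring_def)

text \<open>Elements of a free module are treated as the columns of a matrix with entries in the polynomial
  ring. A family of cycles is then one matrix \<open>X\<close> with \<open>D * X = 0\<close>, and the choice of preimages for
  all of them is a factorisation of \<open>X\<close>.\<close>

definition mats :: "'v set \<Rightarrow> nat \<Rightarrow> nat \<Rightarrow> ('v, 'k::comm_ring_1) mpoly mat set" where
  "mats V n m = {A \<in> carrier_mat n m. \<forall>i<n. \<forall>j<m. A $$ (i,j) \<in> poly_ring V}"

lemma matsD: "A \<in> mats V n m \<Longrightarrow> A \<in> carrier_mat n m"
  by (simp add: mats_def)

lemma mats_mult:
  assumes "A \<in> mats V n m" "B \<in> mats V m k"
  shows "A * B \<in> mats V n k"
  using assms unfolding mats_def
  by (auto simp: scalar_prod_def intro!: poly_ring_sum poly_ring_mult)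

lemma mats_add: "A \<in> mats V n m \<Longrightarrow> B \<in> mats V n m \<Longrightarrow> A + B \<in> mats V n m"
  unfolding mats_def by (auto intro!: poly_ring_add)

lemma mats_uminus: "A \<in> mats V n m \<Longrightarrow> - A \<in> mats V n m"
  unfolding mats_def by (auto intro!: poly_ring_uminus)

lemma mats_diff: "A \<in> mats V n m \<Longrightarrow> B \<in> mats V n m \<Longrightarrow> A - B \<in> mats V n m"
  unfolding mats_def
  by (auto intro!: poly_ring_add poly_ring_uminus simp: diff_conv_add_uminus simp del: add_uminus_conv_diff)

lemma mats_smult: "c \<in> poly_ring V \<Longrightarrow> A \<in> mats V n m \<Longrightarrow> c \<cdot>\<^sub>m A \<in> mats V n m"
  unfolding mats_def by (auto intro!: poly_ring_mult)

lemma mats_0: "0\<^sub>m n m \<in> mats V n m"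
  and mats_1: "1\<^sub>m n \<in> mats V n n"
  unfolding mats_def by (auto simp: poly_ring_0 poly_ring_1)

lemma mats_mono: "V \<subseteq> W \<Longrightarrow> A \<in> mats V n m \<Longrightarrow> A \<in> mats W n m"
  using poly_ring_mono[of V W] by (auto simp: mats_def)

lemma mats_append_rows:
  assumes "A \<in> mats V a m" "B \<in> mats V b m"
  shows "A @\<^sub>r B \<in> mats V (a + b) m"
  using assms carrier_append_rows[of A a m B b] by (auto simp: mats_def index_append_rows)

lemma mats_append_rows_cases:
  assumes "Z \<in> mats V (a + b) m"
  obtains X Y where "X \<in> mats V a m" "Y \<in> mats V b m" "Z = X @\<^sub>r Y"
proof -
  from matsD[OF assms] obtain X Y
    where XY: "X \<in> carrier_mat a m" "Y \<in> carrier_mat b m" "Z = X @\<^sub>r Y" by (rule append_rows_cases)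
  have "X $$ (i,j) \<in> poly_ring V" if "i < a" "j < m" for i j
  proof -
    have "Z $$ (i,j) \<in> poly_ring V" using assms that by (simp add: mats_def)
    then show ?thesis using that index_append_rows[OF XY(1,2), of i j] XY(3) by simp
  qed
  moreover have "Y $$ (i,j) \<in> poly_ring V" if "i < b" "j < m" for i j
  proof -
    have "Z $$ (a + i,j) \<in> poly_ring V" using assms that by (simp add: mats_def)
    then show ?thesis using that index_append_rows[OF XY(1,2), of "a + i" j] XY(3) by simp
  qed
  ultimately have "X \<in> mats V a m" "Y \<in> mats V b m"
    using XY by (auto simp: mats_def)
  then show thesis using XY(3) that by blast
qed

lemma mats_four_block:
  assumes "A \<in> mats V p a" "B \<in> mats V p b" "C \<in> mats V q a" "D \<in> mats V q b"
  shows "four_block_mat A B C D \<in> mats V (p + q) (a + b)"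
  using assms unfolding mats_def by auto

lemma mats_append_cols:
  assumes "A \<in> mats V p a" "B \<in> mats V p b"
  shows "append_cols A B \<in> mats V p (a + b)"
  using assms unfolding mats_def append_cols_def by auto

section \<open>Complexes of free modules\<close>

lemma mat_add_eq_imp_diff:
  fixes X :: "'a::ab_group_add mat"
  assumes "U = X + Y" "X \<in> carrier_mat n m" "Y \<in> carrier_mat n m"
  shows "X = U - Y"
  using assms by auto

lemma mat_diff_eq_imp_add:
  fixes X :: "'a::ab_group_add mat"
  assumes "X - Y = U" "X \<in> carrier_mat n m" "Y \<in> carrier_mat n m"
  shows "X = U + Y"
  using assms by auto

lemma mat_diff_self:
  fixes X :: "'a::ab_group_add mat"
  shows "X \<in> carrier_mat n m \<Longrightarrow> X - X = 0\<^sub>m n m"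
  by auto

text \<open>The augmentation counts as the differential \<open>D 0\<close>, so indices are larger by one than homological
  degrees. The resolved module is the image of \<open>D 0\<close> in the free module of rank \<open>B 0\<close>; exactness
  starts at the free module of rank \<open>B 1\<close>.\<close>

definition exact_complex ::
    "'v set \<Rightarrow> (nat \<Rightarrow> nat) \<Rightarrow> (nat \<Rightarrow> ('v, 'k::comm_ring_1) mpoly mat) \<Rightarrow> bool" where
  "exact_complex V B D \<longleftrightarrow>
     (\<forall>i. D i \<in> mats V (B i) (B (Suc i))) \<and>
     (\<forall>i. D i * D (Suc i) = 0\<^sub>m (B i) (B (Suc (Suc i)))) \<and>
     (\<forall>i m. \<forall>X \<in> mats V (B (Suc i)) m. D i * X = 0\<^sub>m (B i) m \<longrightarrow>
        (\<exists>Y \<in> mats V (B (Suc (Suc i))) m. X = D (Suc i) * Y))"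

lemma exact_complexD:
  assumes "exact_complex V B D"
  shows exact_mats: "D i \<in> mats V (B i) (B (Suc i))"
    and exact_carrier: "D i \<in> carrier_mat (B i) (B (Suc i))"
    and exact_square: "D i * D (Suc i) = 0\<^sub>m (B i) (B (Suc (Suc i)))"
  using assms by (auto simp: exact_complex_def dest: matsD)

lemma exact_lift:
  assumes "exact_complex V B D" "X \<in> mats V (B (Suc i)) m" "D i * X = 0\<^sub>m (B i) m"
  obtains Y where "Y \<in> mats V (B (Suc (Suc i))) m" "X = D (Suc i) * Y"
  using assms unfolding exact_complex_def by blast

lemma exact_square_mult:
  assumes "exact_complex V B D" "Y \<in> carrier_mat (B (Suc (Suc i))) m"
  shows "D i * (D (Suc i) * Y) = 0\<^sub>m (B i) m"
proof -
  have "D i * (D (Suc i) * Y) = D i * D (Suc i) * Y"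
    using exact_carrier[OF assms(1)] assms(2) by (intro assoc_mult_mat[symmetric])
  then show ?thesis using exact_square[OF assms(1), of i] assms(2) by simp
qed

definition chain_map ::
    "'v set \<Rightarrow> (nat \<Rightarrow> nat) \<Rightarrow> (nat \<Rightarrow> ('v, 'k::comm_ring_1) mpoly mat) \<Rightarrow>
      (nat \<Rightarrow> nat) \<Rightarrow> (nat \<Rightarrow> ('v, 'k) mpoly mat) \<Rightarrow> (nat \<Rightarrow> ('v, 'k) mpoly mat) \<Rightarrow> bool" where
  "chain_map V B D B' D' \<phi> \<longleftrightarrow>
     (\<forall>i. \<phi> i \<in> mats V (B' i) (B i)) \<and> (\<forall>i. \<phi> i * D i = D' i * \<phi> (Suc i))"

lemma chain_mapD:
  assumes "chain_map V B D B' D' \<phi>"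
  shows "\<phi> i \<in> mats V (B' i) (B i)" "\<phi> i \<in> carrier_mat (B' i) (B i)"
    "\<phi> i * D i = D' i * \<phi> (Suc i)"
  using assms by (auto simp: chain_map_def dest: matsD)

text \<open>The existence half of the comparison theorem. If \<open>x\<close> is the component of degree \<open>n\<close> and \<open>y\<close> the
  next one, then \<open>y * D (Suc n)\<close> consists of cycles because \<open>D' n * y = x * D n\<close>, and so it lifts.
  The induction therefore carries along that the component of degree \<open>n\<close> has a successor.\<close>

lemma chain_map_exists:
  assumes D: "exact_complex V B D" and D': "exact_complex V B' D'"
    and \<phi>0: "\<phi>0 \<in> mats V (B' 0) (B 0)"
    and start: "\<phi>1 \<in> mats V (B' 1) (B 1)" "\<phi>0 * D 0 = D' 0 * \<phi>1"
  obtains \<phi> where "chain_map V B D B' D' \<phi>" "\<phi> 0 = \<phi>0"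
proof -
  let ?P = "\<lambda>n x. x \<in> mats V (B' n) (B n) \<and> (n = 0 \<longrightarrow> x = \<phi>0) \<and>
      (\<exists>y \<in> mats V (B' (Suc n)) (B (Suc n)). x * D n = D' n * y)"
  let ?Q = "\<lambda>n x y. x * D n = D' n * y"
  note c = exact_carrier[OF D] and c' = exact_carrier[OF D']
  have "\<exists>f. \<forall>n. ?P n (f n) \<and> ?Q n (f n) (f (Suc n))"
  proof (rule dependent_nat_choice)
    show "\<exists>x. ?P 0 x" using \<phi>0 start by auto
  next
    fix x n assume x: "?P n x"
    then obtain y where y: "y \<in> mats V (B' (Suc n)) (B (Suc n))" "x * D n = D' n * y" by blast
    note xc = matsD[OF conjunct1[OF x]] and yc = matsD[OF y(1)]
    have "D' n * (y * D (Suc n)) = x * D n * D (Suc n)"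
      unfolding y(2) by (rule assoc_mult_mat[symmetric, OF c' yc c])
    also have "\<dots> = x * (D n * D (Suc n))" by (rule assoc_mult_mat[OF xc c c])
    also have "\<dots> = 0\<^sub>m (B' n) (B (Suc (Suc n)))" using xc by (simp add: exact_square[OF D])
    finally have "D' n * (y * D (Suc n)) = 0\<^sub>m (B' n) (B (Suc (Suc n)))" .
    then obtain z where "z \<in> mats V (B' (Suc (Suc n))) (B (Suc (Suc n)))"
        "y * D (Suc n) = D' (Suc n) * z"
      using exact_lift[OF D'] mats_mult[OF y(1) exact_mats[OF D]] by blast
    then show "\<exists>y. ?P (Suc n) y \<and> ?Q n x y" using y by auto
  qed
  then obtain f where f: "\<And>n. ?P n (f n) \<and> ?Q n (f n) (f (Suc n))" by blast
  show thesis by (rule that[of f]) (use f in \<open>auto simp: chain_map_def\<close>)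
qed

text \<open>The uniqueness half of the comparison theorem: the part of \<open>\<phi>\<close> not yet accounted for by the
  homotopy always consists of cycles of the exact target.\<close>

lemma chain_map_homotopy:
  assumes D: "exact_complex V B D" and D': "exact_complex V B' D'"
    and \<phi>: "chain_map V B D B' D' \<phi>" and \<phi>0: "\<phi> 0 = 0\<^sub>m (B' 0) (B 0)"
  obtains h where "\<And>i. h i \<in> mats V (B' (Suc i)) (B i)" "h 0 = 0\<^sub>m (B' 1) (B 0)"
    "\<And>i. \<phi> (Suc i) = D' (Suc i) * h (Suc i) + h i * D i"
proof -
  let ?P = "\<lambda>n x. x \<in> mats V (B' (Suc n)) (B n) \<and> (n = 0 \<longrightarrow> x = 0\<^sub>m (B' 1) (B 0)) \<and>
      (\<exists>y \<in> mats V (B' (Suc (Suc n))) (B (Suc n)). \<phi> (Suc n) = D' (Suc n) * y + x * D n)"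
  let ?Q = "\<lambda>n x y. \<phi> (Suc n) = D' (Suc n) * y + x * D n"
  note c = exact_carrier[OF D] and c' = exact_carrier[OF D']
    and \<phi>c = chain_mapD(2)[OF \<phi>] and \<phi>m = chain_mapD(1)[OF \<phi>] and \<phi>D = chain_mapD(3)[OF \<phi>]
  have "\<exists>f. \<forall>n. ?P n (f n) \<and> ?Q n (f n) (f (Suc n))"
  proof (rule dependent_nat_choice)
    have "D' 0 * \<phi> (Suc 0) = 0\<^sub>m (B' 0) (B (Suc 0))"
      using \<phi>D[of 0] c[of 0] by (simp add: \<phi>0)
    then obtain y where y: "y \<in> mats V (B' (Suc (Suc 0))) (B (Suc 0))" "\<phi> (Suc 0) = D' (Suc 0) * y"
      using exact_lift[OF D' \<phi>m] by blast
    have "D' (Suc 0) * y + 0\<^sub>m (B' 1) (B 0) * D 0 = D' (Suc 0) * y"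
      using c[of 0] c'[of "Suc 0"] matsD[OF y(1)] by simp
    then show "\<exists>x. ?P 0 x"
      using y by (intro exI[of _ "0\<^sub>m (B' 1) (B 0)"] conjI bexI[of _ y]) (simp_all add: mats_0)
  next
    fix x n assume x: "?P n x"
    then obtain y where y: "y \<in> mats V (B' (Suc (Suc n))) (B (Suc n))"
        "\<phi> (Suc n) = D' (Suc n) * y + x * D n" by blast
    note xc = matsD[OF conjunct1[OF x]] and yc = matsD[OF y(1)]
    let ?z = "\<phi> (Suc (Suc n)) - y * D (Suc n)"
    have "D' (Suc n) * ?z = D' (Suc n) * \<phi> (Suc (Suc n)) - D' (Suc n) * (y * D (Suc n))"
      by (rule mult_minus_distrib_mat[OF c' \<phi>c mult_carrier_mat[OF yc c]])
    also have "D' (Suc n) * \<phi> (Suc (Suc n)) = (D' (Suc n) * y + x * D n) * D (Suc n)"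
      using \<phi>D[of "Suc n"] y(2) by simp
    also have "\<dots> = D' (Suc n) * y * D (Suc n) + x * D n * D (Suc n)"
      by (rule add_mult_distrib_mat[OF mult_carrier_mat[OF c' yc] mult_carrier_mat[OF xc c] c])
    also have "x * D n * D (Suc n) = x * (D n * D (Suc n))" by (rule assoc_mult_mat[OF xc c c])
    also have "\<dots> = 0\<^sub>m (B' (Suc n)) (B (Suc (Suc n)))" using xc by (simp add: exact_square[OF D])
    also have "D' (Suc n) * y * D (Suc n) = D' (Suc n) * (y * D (Suc n))"
      by (rule assoc_mult_mat[OF c' yc c])
    finally have "D' (Suc n) * ?z = 0\<^sub>m (B' (Suc n)) (B (Suc (Suc n)))"
      using mult_carrier_mat[OF c'[of "Suc n"] mult_carrier_mat[OF yc c]] by simp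
    moreover have "?z \<in> mats V (B' (Suc (Suc n))) (B (Suc (Suc n)))"
      by (intro mats_diff \<phi>m mats_mult[OF y(1) exact_mats[OF D]])
    ultimately obtain w where w: "w \<in> mats V (B' (Suc (Suc (Suc n)))) (B (Suc (Suc n)))"
        "?z = D' (Suc (Suc n)) * w"
      using exact_lift[OF D'] by blast
    from mat_diff_eq_imp_add[OF w(2) \<phi>c mult_carrier_mat[OF yc c]]
    show "\<exists>y. ?P (Suc n) y \<and> ?Q n x y" using w(1) y by auto
  qed
  then obtain f where f: "\<And>n. ?P n (f n) \<and> ?Q n (f n) (f (Suc n))" by blast
  show thesis by (rule that[of f]) (use f in auto)
qed

lemma chain_map_comp:
  assumes D: "exact_complex V B D" and D': "exact_complex V B' D'" and D'': "exact_complex V B'' D''"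
    and \<phi>: "chain_map V B D B' D' \<phi>" and \<psi>: "chain_map V B' D' B'' D'' \<psi>"
  shows "chain_map V B D B'' D'' (\<lambda>i. \<psi> i * \<phi> i)"
proof -
  note c = exact_carrier[OF D] and c' = exact_carrier[OF D']
    and c'' = exact_carrier[OF D'']
    and \<phi>c = chain_mapD(2)[OF \<phi>] and \<psi>c = chain_mapD(2)[OF \<psi>]
  have "\<psi> i * \<phi> i * D i = D'' i * (\<psi> (Suc i) * \<phi> (Suc i))" for i
    by (simp add: assoc_mult_mat[OF \<psi>c \<phi>c c] chain_mapD(3)[OF \<phi>]
      assoc_mult_mat[symmetric, OF \<psi>c c' \<phi>c] chain_mapD(3)[OF \<psi>] assoc_mult_mat[OF c'' \<psi>c \<phi>c])
  then show ?thesis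
    unfolding chain_map_def using mats_mult[OF chain_mapD(1)[OF \<psi>] chain_mapD(1)[OF \<phi>]] by blast
qed

lemma chain_map_minus_id:
  assumes D: "exact_complex V B D" and \<phi>: "chain_map V B D B D \<phi>"
  shows "chain_map V B D B D (\<lambda>i. \<phi> i - 1\<^sub>m (B i))"
proof -
  note c = exact_carrier[OF D] and \<phi>c = chain_mapD(2)[OF \<phi>]
  have "(\<phi> i - 1\<^sub>m (B i)) * D i = D i * (\<phi> (Suc i) - 1\<^sub>m (B (Suc i)))" for i
    unfolding minus_mult_distrib_mat[OF \<phi>c one_carrier_mat c]
      mult_minus_distrib_mat[OF c \<phi>c one_carrier_mat]
    using c[of i] chain_mapD(3)[OF \<phi>] by simp
  then show ?thesis
    unfolding chain_map_def using mats_diff[OF chain_mapD(1)[OF \<phi>] mats_1] by blast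
qed

section \<open>Bases of homology\<close>

text \<open>The columns of \<open>W\<close> are cycles whose classes form a basis of the kernel of \<open>A\<close> modulo the image of
  \<open>A'\<close>: they generate, and no nontrivial combination of them is a boundary. Unlike a difference of
  two dimensions, this description passes through chain maps and block matrices by mere matrix
  algebra.\<close>

definition homology_rank :: "'k::field mat \<Rightarrow> 'k mat \<Rightarrow> nat \<Rightarrow> bool" where
  "homology_rank A A' h \<longleftrightarrow>
     (\<exists>W \<in> carrier_mat (dim_col A) h. A * W = 0\<^sub>m (dim_row A) h \<and>
       (\<forall>m. \<forall>X \<in> carrier_mat (dim_col A) m. A * X = 0\<^sub>m (dim_row A) m \<longrightarrow>
         (\<exists>Y \<in> carrier_mat h m. \<exists>Z \<in> carrier_mat (dim_col A') m. X = W * Y + A' * Z)) \<and>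
       (\<forall>m. \<forall>Y \<in> carrier_mat h m. \<forall>Z \<in> carrier_mat (dim_col A') m.
         W * Y + A' * Z = 0\<^sub>m (dim_col A) m \<longrightarrow> Y = 0\<^sub>m h m))"

lemma homology_rankI:
  assumes "A \<in> carrier_mat p n" "A' \<in> carrier_mat n q" "W \<in> carrier_mat n h" "A * W = 0\<^sub>m p h"
    and "\<And>m X. X \<in> carrier_mat n m \<Longrightarrow> A * X = 0\<^sub>m p m \<Longrightarrow>
      \<exists>Y \<in> carrier_mat h m. \<exists>Z \<in> carrier_mat q m. X = W * Y + A' * Z"
    and "\<And>m Y Z. Y \<in> carrier_mat h m \<Longrightarrow> Z \<in> carrier_mat q m \<Longrightarrow>
      W * Y + A' * Z = 0\<^sub>m n m \<Longrightarrow> Y = 0\<^sub>m h m"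
  shows "homology_rank A A' h"
proof -
  have d: "dim_row A = p" "dim_col A = n" "dim_col A' = q" using assms by auto
  show ?thesis unfolding homology_rank_def d
    using assms(3-) by blast
qed

lemma homology_rankE:
  assumes "homology_rank A A' h" "A \<in> carrier_mat p n" "A' \<in> carrier_mat n q"
  obtains W where "W \<in> carrier_mat n h" "A * W = 0\<^sub>m p h"
    and "\<And>m X. X \<in> carrier_mat n m \<Longrightarrow> A * X = 0\<^sub>m p m \<Longrightarrow>
      \<exists>Y \<in> carrier_mat h m. \<exists>Z \<in> carrier_mat q m. X = W * Y + A' * Z"
    and "\<And>m Y Z. Y \<in> carrier_mat h m \<Longrightarrow> Z \<in> carrier_mat q m \<Longrightarrow>
      W * Y + A' * Z = 0\<^sub>m n m \<Longrightarrow> Y = 0\<^sub>m h m"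
proof -
  have d: "dim_row A = p" "dim_col A = n" "dim_col A' = q" using assms by auto
  from assms(1)[unfolded homology_rank_def d] obtain W where
    "W \<in> carrier_mat n h" "A * W = 0\<^sub>m p h"
    "\<forall>m. \<forall>X \<in> carrier_mat n m. A * X = 0\<^sub>m p m \<longrightarrow>
         (\<exists>Y \<in> carrier_mat h m. \<exists>Z \<in> carrier_mat q m. X = W * Y + A' * Z)"
    "\<forall>m. \<forall>Y \<in> carrier_mat h m. \<forall>Z \<in> carrier_mat q m.
         W * Y + A' * Z = 0\<^sub>m n m \<longrightarrow> Y = 0\<^sub>m h m" by blast
  then show thesis by (intro that[of W]; blast)
qed

text \<open>If \<open>l < h\<close>, padding by zeros makes both matrices square of size \<open>h\<close>, still with product one,
  although the padded left factor is singular.\<close>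

lemma right_inverse_imp_le:
  fixes X :: "'k::field mat"
  assumes X: "X \<in> carrier_mat h l" and Y: "Y \<in> carrier_mat l h" and inv: "X * Y = 1\<^sub>m h"
  shows "h \<le> l"
proof (rule ccontr)
  assume "\<not> h \<le> l"
  then obtain d where h: "h = l + d" "d > 0" using less_imp_add_positive[of l h] by auto
  let ?X = "append_cols X (0\<^sub>m h d)" and ?Y = "Y @\<^sub>r 0\<^sub>m d h"
  have Xc: "?X \<in> carrier_mat h h" using append_cols_carrier[OF X zero_carrier_mat, of d] h by simp
  have Yc: "?Y \<in> carrier_mat h h" using carrier_append_rows[OF Y zero_carrier_mat, of d] h by simp
  have "?X * ?Y = 1\<^sub>m h"
    by (subst append_cols_mult[OF X zero_carrier_mat Y zero_carrier_mat]) (simp add: inv)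
  then have "det ?X * det ?Y = 1" using det_mult[OF Xc Yc] by simp
  moreover have "?X *\<^sub>v unit_vec h l = 0\<^sub>v h"
  proof (rule eq_vecI)
    fix i assume "i < dim_vec (0\<^sub>v h)"
    then show "(?X *\<^sub>v unit_vec h l) $ i = 0\<^sub>v h $ i"
      using h X Xc by (simp add: scalar_prod_right_unit append_cols_def)
  qed (use Xc in auto)
  then have "det ?X = 0"
    using h by (subst det_0_iff_vec_prod_zero_field[OF Xc]) (auto intro!: exI[of _ "unit_vec h l"])
  ultimately show False by simp
qed

text \<open>Two bases of the homology express each other up to boundaries. Independence turns this into
  matrices that are inverse to each other.\<close>

lemma homology_rank_unique:
  assumes A: "A \<in> carrier_mat p n" and A': "A' \<in> carrier_mat n q"
    and "homology_rank A A' h" "homology_rank A A' l"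
  shows "h = l"
proof -
  have le: "h \<le> l" if h: "homology_rank A A' h" and l: "homology_rank A A' l" for h l
  proof -
    from h A A' obtain W where W: "W \<in> carrier_mat n h" "A * W = 0\<^sub>m p h"
      "\<And>m X. X \<in> carrier_mat n m \<Longrightarrow> A * X = 0\<^sub>m p m \<Longrightarrow>
        \<exists>Y \<in> carrier_mat h m. \<exists>Z \<in> carrier_mat q m. X = W * Y + A' * Z"
      "\<And>m Y Z. Y \<in> carrier_mat h m \<Longrightarrow> Z \<in> carrier_mat q m \<Longrightarrow>
        W * Y + A' * Z = 0\<^sub>m n m \<Longrightarrow> Y = 0\<^sub>m h m" by (rule homology_rankE) blast
    from l A A' obtain U where U: "U \<in> carrier_mat n l" "A * U = 0\<^sub>m p l"
      "\<And>m X. X \<in> carrier_mat n m \<Longrightarrow> A * X = 0\<^sub>m p m \<Longrightarrow>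
        \<exists>Y \<in> carrier_mat l m. \<exists>Z \<in> carrier_mat q m. X = U * Y + A' * Z" by (rule homology_rankE) blast
    from W(3)[OF U(1,2)] obtain X Z where X: "X \<in> carrier_mat h l" "Z \<in> carrier_mat q l" "U = W * X + A' * Z"
      by blast
    from U(3)[OF W(1,2)] obtain Y Z' where Y: "Y \<in> carrier_mat l h" "Z' \<in> carrier_mat q h" "W = U * Y + A' * Z'"
      by blast
    have "W = (W * X + A' * Z) * Y + A' * Z'" by (subst X(3)[symmetric]) (rule Y(3))
    also have "(W * X + A' * Z) * Y = W * (X * Y) + A' * (Z * Y)"
      using W(1) A' X(1,2) Y(1,2) by (subst add_mult_distrib_mat[of _ n l]) auto
    finally have eq: "W = W * (X * Y) + A' * (Z * Y) + A' * Z'" .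
    have "W * (X * Y - 1\<^sub>m h) + A' * (Z * Y + Z') = W * (X * Y) - W + (A' * (Z * Y) + A' * Z')"
      by (simp only: mult_minus_distrib_mat[OF W(1) mult_carrier_mat[OF X(1) Y(1)] one_carrier_mat]
          mult_add_distrib_mat[OF A' mult_carrier_mat[OF X(2) Y(1)] Y(2)] right_mult_one_mat[OF W(1)])
    also have "\<dots> = 0\<^sub>m n h"
    proof (rule eq_matI)
      fix i j assume ij: "i < dim_row (0\<^sub>m n h)" "j < dim_col (0\<^sub>m n h)"
      have c: "W * (X * Y) \<in> carrier_mat n h" "A' * (Z * Y) \<in> carrier_mat n h" "A' * Z' \<in> carrier_mat n h"
        using W(1) A' X(1,2) Y(1,2) by auto
      have "W $$ (i,j) = (W * (X * Y)) $$ (i,j) + (A' * (Z * Y)) $$ (i,j) + (A' * Z') $$ (i,j)"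
        using arg_cong[OF eq, of "\<lambda>M. M $$ (i,j)"] ij c by (simp del: index_mult_mat)
      then show "(W * (X * Y) - W + (A' * (Z * Y) + A' * Z')) $$ (i,j) = 0\<^sub>m n h $$ (i,j)"
        using ij c W(1) by (simp del: index_mult_mat)
    qed (use W(1) A' X(1,2) Y(1,2) in auto)
    finally have "X * Y - 1\<^sub>m h = 0\<^sub>m h h"
      using W(4)[of "X * Y - 1\<^sub>m h" h "Z * Y + Z'"] X(1,2) Y(1,2)
      minus_carrier_mat[OF one_carrier_mat, of "X * Y" h] by auto
    then have "X * Y = 0\<^sub>m h h + 1\<^sub>m h" using mat_diff_eq_imp_add[OF _ mult_carrier_mat[OF X(1) Y(1)] one_carrier_mat] by blast
    then have "X * Y = 1\<^sub>m h" by simp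
    then show "h \<le> l" by (rule right_inverse_imp_le[OF X(1) Y(1)])
  qed
  from le[OF assms(3,4)] le[OF assms(4,3)] show ?thesis by simp
qed

lemma mat_add_diff_assoc:
  fixes X :: "'a::ab_group_add mat"
  assumes "X \<in> carrier_mat n m" "Y \<in> carrier_mat n m" "Z \<in> carrier_mat n m"
  shows "X + Y - Z = X + (Y - Z)"
  using assms by auto

text \<open>A homotopy equivalence carries a basis of homology to a basis of homology. The matrices \<open>P\<close> and
  \<open>Q\<close> are the middle components of the two chain maps, \<open>P0\<close>, \<open>P1\<close>, \<open>Q0\<close>, \<open>Q1\<close> their neighbours,
  and \<open>S\<close>, \<open>T\<close>, \<open>S'\<close>, \<open>T'\<close> belong to the homotopies.\<close>

lemma homology_rank_transfer:
  fixes A :: "'k::field mat"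
  assumes A: "A \<in> carrier_mat p n" and A': "A' \<in> carrier_mat n q"
    and C: "C \<in> carrier_mat p' n'" and C': "C' \<in> carrier_mat n' q'"
    and P: "P \<in> carrier_mat n' n" and Q: "Q \<in> carrier_mat n n'"
    and P0: "P0 \<in> carrier_mat p' p" "C * P = P0 * A"
    and Q0: "Q0 \<in> carrier_mat p p'" "A * Q = Q0 * C"
    and P1: "P1 \<in> carrier_mat q' q" "P * A' = C' * P1"
    and Q1: "Q1 \<in> carrier_mat q q'" "Q * C' = A' * Q1"
    and S: "S \<in> carrier_mat q n" "T \<in> carrier_mat n p" "Q * P - 1\<^sub>m n = A' * S + T * A"
    and S': "S' \<in> carrier_mat q' n'" "T' \<in> carrier_mat n' p'" "P * Q - 1\<^sub>m n' = C' * S' + T' * C"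
    and h: "homology_rank A A' h"
  shows "homology_rank C C' h"
proof -
  from h A A' obtain W where W: "W \<in> carrier_mat n h" "A * W = 0\<^sub>m p h"
    and gen: "\<And>m X. X \<in> carrier_mat n m \<Longrightarrow> A * X = 0\<^sub>m p m \<Longrightarrow>
      \<exists>Y \<in> carrier_mat h m. \<exists>Z \<in> carrier_mat q m. X = W * Y + A' * Z"
    and ind: "\<And>m Y Z. Y \<in> carrier_mat h m \<Longrightarrow> Z \<in> carrier_mat q m \<Longrightarrow>
      W * Y + A' * Z = 0\<^sub>m n m \<Longrightarrow> Y = 0\<^sub>m h m" by (rule homology_rankE) blast
  \<comment> \<open>On cycles, both composites are the identity up to boundaries.\<close>
  have cycle: "F * (G * X) = X + E * (U * X)"
    if "F \<in> carrier_mat a b" "G \<in> carrier_mat b a" "E \<in> carrier_mat a e" "U \<in> carrier_mat e a"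
      "R \<in> carrier_mat a d" "M \<in> carrier_mat d a" "X \<in> carrier_mat a m"
      "F * G - 1\<^sub>m a = E * U + R * M" "M * X = 0\<^sub>m d m" for F G E U R M X :: "'k mat" and a b d e m
  proof -
    have "F * G = E * U + R * M + 1\<^sub>m a"
      by (rule mat_diff_eq_imp_add[OF that(8) mult_carrier_mat[OF that(1,2)] one_carrier_mat])
    then have "F * G * X = E * U * X + R * M * X + X"
      using that(1-7) by (simp add: add_mult_distrib_mat[of _ a a _ _ m])
    moreover have "R * M * X = 0\<^sub>m a m"
      using that(5-7,9) by (simp add: assoc_mult_mat[of R a d M a X m])
    moreover have "F * G * X = F * (G * X)" "E * U * X = E * (U * X)"
      using that by (auto intro!: assoc_mult_mat)
    moreover have "E * (U * X) \<in> carrier_mat a m" using that by auto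
    ultimately show ?thesis using that(7) by (simp add: comm_add_mat[of _ a m])
  qed
  have PW: "P * W \<in> carrier_mat n' h" using P W by auto
  show ?thesis
  proof (rule homology_rankI[OF C C' PW])
    have "C * (P * W) = P0 * (A * W)"
      using assoc_mult_mat[OF C P W(1)] assoc_mult_mat[OF P0(1) A W(1)] P0(2) by simp
    then show "C * (P * W) = 0\<^sub>m p' h" using W(2) P0(1) by simp
  next
    fix m X assume X: "X \<in> carrier_mat n' m" "C * X = 0\<^sub>m p' m"
    have QX: "Q * X \<in> carrier_mat n m" using Q X by auto
    have "A * (Q * X) = Q0 * (C * X)"
      using assoc_mult_mat[OF A Q X(1)] assoc_mult_mat[OF Q0(1) C X(1)] Q0(2) by simp
    then have "A * (Q * X) = 0\<^sub>m p m" using X(2) Q0(1) by simp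
    from gen[OF QX this] obtain Y Z where Y: "Y \<in> carrier_mat h m" and Z: "Z \<in> carrier_mat q m"
      and YZ: "Q * X = W * Y + A' * Z" by blast
    have "X + C' * (S' * X) = P * (Q * X)"
      by (rule cycle[OF P Q C' S'(1,2) C X(1) S'(3) X(2), symmetric])
    also have "\<dots> = P * (W * Y) + P * (A' * Z)"
      unfolding YZ by (rule mult_add_distrib_mat[OF P mult_carrier_mat[OF W(1) Y] mult_carrier_mat[OF A' Z]])
    also have "P * (W * Y) = P * W * Y" by (rule assoc_mult_mat[symmetric, OF P W(1) Y])
    also have "P * (A' * Z) = C' * (P1 * Z)"
      using assoc_mult_mat[OF P A' Z] assoc_mult_mat[OF C' P1(1) Z] P1(2) by simp
    finally have eq: "X + C' * (S' * X) = P * W * Y + C' * (P1 * Z)" .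
    have c: "C' * (S' * X) \<in> carrier_mat n' m" using C' S' X by auto
    have c2: "P * W * Y \<in> carrier_mat n' m" using P W Y by auto
    have c3: "C' * (P1 * Z) \<in> carrier_mat n' m" using C' P1 Z by auto
    have "X = P * W * Y + C' * (P1 * Z) - C' * (S' * X)"
      by (rule mat_add_eq_imp_diff[OF eq[symmetric] X(1) c])
    also have "\<dots> = P * W * Y + (C' * (P1 * Z) - C' * (S' * X))"
      by (rule mat_add_diff_assoc[OF c2 c3 c])
    also have "C' * (P1 * Z) - C' * (S' * X) = C' * (P1 * Z - S' * X)"
      by (rule mult_minus_distrib_mat[symmetric, OF C' mult_carrier_mat[OF P1(1) Z] mult_carrier_mat[OF S'(1) X(1)]])
    finally have "X = P * W * Y + C' * (P1 * Z - S' * X)" .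
    moreover have "P1 * Z - S' * X \<in> carrier_mat q' m"
      by (rule minus_carrier_mat[OF mult_carrier_mat[OF S'(1) X(1)]])
    ultimately show "\<exists>Y \<in> carrier_mat h m. \<exists>Z \<in> carrier_mat q' m. X = P * W * Y + C' * Z"
      using Y by blast
  next
    fix m Y Z assume Y: "Y \<in> carrier_mat h m" and Z: "Z \<in> carrier_mat q' m"
      and eq: "P * W * Y + C' * Z = 0\<^sub>m n' m"
    have WY: "W * Y \<in> carrier_mat n m" using W Y by auto
    have AWY: "A * (W * Y) = 0\<^sub>m p m"
      using assoc_mult_mat[OF A W(1) Y] W(2) Y by simp
    have "Q * (P * (W * Y)) = W * Y + A' * (S * (W * Y))"
      by (rule cycle[OF Q P A' S(1,2) A WY S(3) AWY])
    moreover have "Q * (P * W * Y + C' * Z) = Q * (P * (W * Y)) + A' * (Q1 * Z)"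
    proof -
      have "Q * (P * W * Y + C' * Z) = Q * (P * W * Y) + Q * (C' * Z)"
        by (rule mult_add_distrib_mat[OF Q mult_carrier_mat[OF PW Y] mult_carrier_mat[OF C' Z]])
      moreover have "Q * (C' * Z) = A' * (Q1 * Z)"
        using assoc_mult_mat[OF Q C' Z] assoc_mult_mat[OF A' Q1(1) Z] Q1(2) by simp
      ultimately show ?thesis using assoc_mult_mat[OF P W(1) Y] by simp
    qed
    ultimately have "W * Y + A' * (S * (W * Y)) + A' * (Q1 * Z) = 0\<^sub>m n m"
      using eq Q by simp
    moreover have "W * Y + A' * (S * (W * Y)) + A' * (Q1 * Z) = W * Y + (A' * (S * (W * Y)) + A' * (Q1 * Z))"
      using WY A' S Q1 Z by (intro assoc_add_mat[of _ n m]) auto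
    moreover have "A' * (S * (W * Y)) + A' * (Q1 * Z) = A' * (S * (W * Y) + Q1 * Z)"
      by (rule mult_add_distrib_mat[symmetric, OF A' mult_carrier_mat[OF S(1) WY] mult_carrier_mat[OF Q1(1) Z]])
    ultimately have "W * Y + A' * (S * (W * Y) + Q1 * Z) = 0\<^sub>m n m" by simp
    then show "Y = 0\<^sub>m h m"
      by (rule ind[OF Y add_carrier_mat[OF mult_carrier_mat[OF Q1(1) Z]]])
  qed
qed

definition block_diag :: "'a::comm_ring_1 mat \<Rightarrow> 'a mat \<Rightarrow> 'a mat" where
  "block_diag A B = four_block_mat A (0\<^sub>m (dim_row A) (dim_col B)) (0\<^sub>m (dim_row B) (dim_col A)) B"

lemma block_diag_carrier:
  "A \<in> carrier_mat p n \<Longrightarrow> B \<in> carrier_mat q m \<Longrightarrow> block_diag A B \<in> carrier_mat (p + q) (n + m)"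
  unfolding block_diag_def by simp

lemma block_diag_mult_append_rows:
  assumes "A \<in> carrier_mat p n" "B \<in> carrier_mat q m" "X \<in> carrier_mat n k" "Y \<in> carrier_mat m k"
  shows "block_diag A B * (X @\<^sub>r Y) = (A * X) @\<^sub>r (B * Y)"
proof -
  have "block_diag A B = four_block_mat A (0\<^sub>m p m) (0\<^sub>m q n) B" using assms by (simp add: block_diag_def)
  then have "block_diag A B * (X @\<^sub>r Y) = (A * X + 0\<^sub>m p m * Y) @\<^sub>r (0\<^sub>m q n * X + B * Y)"
    using four_block_mult_append_rows[OF assms(1) zero_carrier_mat zero_carrier_mat assms(2-4)] by simp
  then show ?thesis using assms by simp
qed

lemma block_diag_mult:
  assumes "A \<in> carrier_mat p n" "B \<in> carrier_mat q m" "C \<in> carrier_mat n k" "D \<in> carrier_mat m l"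
  shows "block_diag A B * block_diag C D = block_diag (A * C) (B * D)"
proof -
  have "four_block_mat A (0\<^sub>m p m) (0\<^sub>m q n) B * four_block_mat C (0\<^sub>m n l) (0\<^sub>m m k) D =
      four_block_mat (A * C) (0\<^sub>m p l) (0\<^sub>m q k) (B * D)"
    using assms
    by (subst mult_four_block_mat[OF assms(1) _ _ assms(2,3) _ _ assms(4)])
      (auto intro!: cong_four_block_mat)
  then show ?thesis using assms by (simp add: block_diag_def)
qed

lemma homology_rank_block_diag:
  fixes A :: "'k::field mat"
  assumes A: "A \<in> carrier_mat p n" "A' \<in> carrier_mat n q"
    and B: "B \<in> carrier_mat p' n'" "B' \<in> carrier_mat n' q'"
    and hr: "homology_rank A A' h" "homology_rank B B' l"
  shows "homology_rank (block_diag A B) (block_diag A' B') (h + l)"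
proof -
  from hr(1) A obtain W where W: "W \<in> carrier_mat n h" "A * W = 0\<^sub>m p h"
    and genW: "\<And>m X. X \<in> carrier_mat n m \<Longrightarrow> A * X = 0\<^sub>m p m \<Longrightarrow>
      \<exists>Y \<in> carrier_mat h m. \<exists>Z \<in> carrier_mat q m. X = W * Y + A' * Z"
    and indW: "\<And>m Y Z. Y \<in> carrier_mat h m \<Longrightarrow> Z \<in> carrier_mat q m \<Longrightarrow>
      W * Y + A' * Z = 0\<^sub>m n m \<Longrightarrow> Y = 0\<^sub>m h m" by (rule homology_rankE) blast
  from hr(2) B obtain U where U: "U \<in> carrier_mat n' l" "B * U = 0\<^sub>m p' l"
    and genU: "\<And>m X. X \<in> carrier_mat n' m \<Longrightarrow> B * X = 0\<^sub>m p' m \<Longrightarrow>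
      \<exists>Y \<in> carrier_mat l m. \<exists>Z \<in> carrier_mat q' m. X = U * Y + B' * Z"
    and indU: "\<And>m Y Z. Y \<in> carrier_mat l m \<Longrightarrow> Z \<in> carrier_mat q' m \<Longrightarrow>
      U * Y + B' * Z = 0\<^sub>m n' m \<Longrightarrow> Y = 0\<^sub>m l m" by (rule homology_rankE) blast
  have comb: "block_diag W U * (Y @\<^sub>r Y') + block_diag A' B' * (Z @\<^sub>r Z') =
      (W * Y + A' * Z) @\<^sub>r (U * Y' + B' * Z')"
    if "Y \<in> carrier_mat h m" "Y' \<in> carrier_mat l m" "Z \<in> carrier_mat q m" "Z' \<in> carrier_mat q' m" for Y Y' Z Z' m
    unfolding block_diag_mult_append_rows[OF W(1) U(1) that(1,2)]
      block_diag_mult_append_rows[OF A(2) B(2) that(3,4)]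
    by (rule append_rows_add[of _ n m _ n']) (use W U A B that in auto)
  show ?thesis
  proof (rule homology_rankI[OF block_diag_carrier[OF A(1) B(1)] block_diag_carrier[OF A(2) B(2)]
        block_diag_carrier[OF W(1) U(1)]])
    show "block_diag A B * block_diag W U = 0\<^sub>m (p + p') (h + l)"
      unfolding block_diag_mult[OF A(1) B(1) W(1) U(1)] W(2) U(2) by (simp add: block_diag_def)
  next
    fix m X assume "X \<in> carrier_mat (n + n') m" and X0: "block_diag A B * X = 0\<^sub>m (p + p') m"
    then obtain X1 X2 where X: "X1 \<in> carrier_mat n m" "X2 \<in> carrier_mat n' m" "X = X1 @\<^sub>r X2"
      using append_rows_cases by blast
    have "(A * X1) @\<^sub>r (B * X2) = 0\<^sub>m p m @\<^sub>r 0\<^sub>m p' m"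
      using X0 unfolding X(3) block_diag_mult_append_rows[OF A(1) B(1) X(1,2)] zero_append_rows .
    then have "A * X1 = 0\<^sub>m p m" "B * X2 = 0\<^sub>m p' m"
      using append_rows_eq_iff[of "A * X1" p m "B * X2" p' "0\<^sub>m p m" "0\<^sub>m p' m"] A B X by auto
    then obtain Y Z Y' Z' where
      "Y \<in> carrier_mat h m" "Z \<in> carrier_mat q m" "X1 = W * Y + A' * Z"
      "Y' \<in> carrier_mat l m" "Z' \<in> carrier_mat q' m" "X2 = U * Y' + B' * Z'"
      using genW[OF X(1)] genU[OF X(2)] by metis
    then show "\<exists>Y \<in> carrier_mat (h + l) m. \<exists>Z \<in> carrier_mat (q + q') m.
        X = block_diag W U * Y + block_diag A' B' * Z"
      using comb X(3) by (intro bexI[of _ "Y @\<^sub>r Y'"] bexI[of _ "Z @\<^sub>r Z'"]) auto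
  next
    fix m Y Z assume "Y \<in> carrier_mat (h + l) m" and "Z \<in> carrier_mat (q + q') m"
      and eq: "block_diag W U * Y + block_diag A' B' * Z = 0\<^sub>m (n + n') m"
    then obtain Y1 Y2 Z1 Z2 where Y: "Y1 \<in> carrier_mat h m" "Y2 \<in> carrier_mat l m" "Y = Y1 @\<^sub>r Y2"
      and Z: "Z1 \<in> carrier_mat q m" "Z2 \<in> carrier_mat q' m" "Z = Z1 @\<^sub>r Z2"
      using append_rows_cases by metis
    have "(W * Y1 + A' * Z1) @\<^sub>r (U * Y2 + B' * Z2) = 0\<^sub>m n m @\<^sub>r 0\<^sub>m n' m"
      using eq unfolding Y(3) Z(3) comb[OF Y(1,2) Z(1,2)] zero_append_rows .
    then have "W * Y1 + A' * Z1 = 0\<^sub>m n m" "U * Y2 + B' * Z2 = 0\<^sub>m n' m"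
      using append_rows_eq_iff[of "W * Y1 + A' * Z1" n m "U * Y2 + B' * Z2" n' "0\<^sub>m n m" "0\<^sub>m n' m"]
        A(2) B(2) Z(1,2) W(1) U(1) Y(1,2) by auto
    then show "Y = 0\<^sub>m (h + l) m"
      using indW[OF Y(1) Z(1)] indU[OF Y(2) Z(2)] by (simp add: Y(3) zero_append_rows)
  qed
qed

lemma mat_columnwise:
  assumes A: "A \<in> carrier_mat n m" and M: "M \<in> carrier_mat n k"
    and cols: "\<And>j. j < m \<Longrightarrow> \<exists>x \<in> carrier_vec k. P x \<and> col A j = M *\<^sub>v x"
  shows "\<exists>X \<in> carrier_mat k m. (\<forall>j<m. P (col X j)) \<and> A = M * X"
proof -
  from cols obtain f where f: "\<And>j. j < m \<Longrightarrow> f j \<in> carrier_vec k \<and> P (f j) \<and> col A j = M *\<^sub>v f j"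
    by metis
  let ?X = "mat_of_cols k (map f [0..<m])"
  have X: "?X \<in> carrier_mat k m" using mat_of_cols_carrier(1)[of k "map f [0..<m]"] by simp
  have col: "col ?X j = f j" if "j < m" for j using f[OF that] that by simp
  have "A = M * ?X"
  proof (rule eq_matI)
    fix i j assume "i < dim_row (M * ?X)" "j < dim_col (M * ?X)"
    then have ij: "i < n" "j < m" using M X by auto
    then have "A $$ (i,j) = col A j $ i" using A by simp
    also have "\<dots> = (M *\<^sub>v f j) $ i" using f[OF ij(2)] by simp
    also have "\<dots> = (M * ?X) $$ (i,j)" using ij M X col by simp
    finally show "A $$ (i,j) = (M * ?X) $$ (i,j)" .
  qed (use A M X in auto)
  then show ?thesis using X col f by (intro bexI[of _ ?X]) auto
qed

lemma injective_mat_cancel: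
  fixes N :: "'k::field mat"
  assumes N: "N \<in> carrier_mat n k" and inj: "\<And>v. v \<in> carrier_vec k \<Longrightarrow> N *\<^sub>v v = 0\<^sub>v n \<Longrightarrow> v = 0\<^sub>v k"
    and Y: "Y \<in> carrier_mat k m" and 0: "N * Y = 0\<^sub>m n m"
  shows "Y = 0\<^sub>m k m"
proof (rule eq_matI)
  fix i j assume ij: "i < dim_row (0\<^sub>m k m)" "j < dim_col (0\<^sub>m k m)"
  have "N *\<^sub>v col Y j = col (N * Y) j" using ij by (intro col_mult2[symmetric, OF N Y]) simp
  also have "\<dots> = 0\<^sub>v n" unfolding 0 using ij by simp
  finally have "col Y j = 0\<^sub>v k" using inj[of "col Y j"] Y by auto
  then have "col Y j $ i = 0" using ij by simp
  then show "Y $$ (i,j) = 0\<^sub>m k m $$ (i,j)" using Y ij by simp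
qed (use Y in auto)

lemma mat_of_cols_append:
  assumes "set xs \<subseteq> carrier_vec n" "set ys \<subseteq> carrier_vec n"
  shows "mat_of_cols n (xs @ ys) = append_cols (mat_of_cols n xs) (mat_of_cols n ys)"
  by (rule eq_matI) (auto simp: append_cols_def mat_of_cols_def nth_append)

text \<open>A basis of the image extends to a basis of the kernel, and the additional vectors represent a
  basis of the homology.\<close>

lemma homology_rank_kernel_dim:
  fixes A :: "'k::field mat"
  assumes A: "A \<in> carrier_mat p n" and A': "A' \<in> carrier_mat n q" and AA': "A * A' = 0\<^sub>m p q"
  shows "homology_rank A A' (kernel_dim A - vec_space.rank n A')"
proof -
  interpret kernel p n A by unfold_locales (rule A)
  have colsA': "set (cols A') \<subseteq> carrier_vec n" using A' cols_dim by blast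
  have ker: "set (cols A') \<subseteq> mat_kernel A"
  proof
    fix c assume "c \<in> set (cols A')"
    then obtain j where j: "j < q" "c = col A' j" using A' by (auto simp: cols_def)
    have "A *\<^sub>v c = col (A * A') j" by (simp only: j(2) col_mult2[OF A A' j(1)])
    then show "c \<in> mat_kernel A" using j A A' AA' by (intro mat_kernelI[OF A]) auto
  qed
  have kc: "mat_kernel A \<subseteq> carrier_vec n" by (rule mat_kernel_carrier[OF A])
  have bound: "finite T \<and> card T \<le> n" if "T \<subseteq> carrier_vec n" "NC.lin_indpt T" for T
    using NC.li_le_dim[OF NC.fin_dim] that NC.dim_is_n by simp
  have empty: "NC.lin_indpt {}" by (simp add: NC.lin_dep_def)
  \<comment> \<open>A basis of the image is chosen among the columns of \<open>A'\<close>, so that its size is the rank.\<close>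
  obtain S where S: "finite S" "maximal S (\<lambda>T. T \<subseteq> set (cols A') \<and> NC.lin_indpt T)"
  proof -
    have "\<exists>S. finite S \<and> maximal S (\<lambda>T. T \<subseteq> set (cols A') \<and> NC.lin_indpt T)"
      by (rule maximal_exists[of _ n "{}"]) (use bound colsA' empty in auto)
    then show ?thesis using that by blast
  qed
  have S': "S \<subseteq> set (cols A')" "NC.lin_indpt S" using S(2) by (auto simp: maximal_def)
  have rank: "NC.rank A' = card S" by (rule NC.rank_card_indpt[OF A' S(2)])
  obtain U where U: "finite U" "maximal U (\<lambda>T. S \<subseteq> T \<and> T \<subseteq> mat_kernel A \<and> NC.lin_indpt T)"
  proof -
    have "\<exists>U. finite U \<and> maximal U (\<lambda>T. S \<subseteq> T \<and> T \<subseteq> mat_kernel A \<and> NC.lin_indpt T)"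
      by (rule maximal_exists[of _ n S]) (use bound kc S' ker in auto)
    then show ?thesis using that by blast
  qed
  have U': "S \<subseteq> U" "U \<subseteq> mat_kernel A" "NC.lin_indpt U" using U(2) by (auto simp: maximal_def)
  have "maximal U (\<lambda>T. T \<subseteq> mat_kernel A \<and> Ker.lin_indpt T)"
    unfolding maximal_def
  proof (intro conjI allI impI)
    show "U \<subseteq> mat_kernel A" "Ker.lin_indpt U" using U' lindep_same by auto
    fix T assume "U \<subseteq> T \<and> T \<subseteq> mat_kernel A \<and> Ker.lin_indpt T"
    then show "T = U" using U(2) U' lindep_same[of T] unfolding maximal_def by blast
  qed
  then have basis: "Ker.basis U" by (rule Ker.max_li_is_basis)
  have dim: "kernel_dim A = card U" using Ker.dim_basis[OF U(1) basis] by simp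
  have spanU: "NC.span U = mat_kernel A"
    using basis span_same[OF U'(2)] by (simp add: Ker.basis_def)
  have spanS: "set (cols A') \<subseteq> NC.span S"
  proof
    fix c assume c: "c \<in> set (cols A')"
    show "c \<in> NC.span S"
    proof (cases "c \<in> S")
      case True then show ?thesis using NC.span_mem S'(1) colsA' by auto
    next
      case False
      have "NC.lin_dep (S \<union> {c})"
      proof (rule ccontr)
        assume "\<not> NC.lin_dep (S \<union> {c})"
        then have "S \<union> {c} = S" using S(2) c S'(1) unfolding maximal_def by blast
        then show False using False by blast
      qed
      then show ?thesis using NC.lin_dep_iff_in_span[of S c] S' colsA' c False by auto
    qed
  qed
  obtain ss where ss: "set ss = S" "distinct ss" using S(1) finite_distinct_list by blast
  obtain ts where ts: "set ts = U - S" "distinct ts" using U(1) finite_distinct_list[of "U - S"] by auto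
  have lens: "length ts = kernel_dim A - NC.rank A'"
    using distinct_card[OF ts(2)] ts(1) dim rank card_Diff_subset[OF S(1) U'(1)] by simp
  have sc: "set ss \<subseteq> carrier_vec n" "set ts \<subseteq> carrier_vec n" using ss ts U' kc by auto
  define W where "W = mat_of_cols n ts"
  define Sm where "Sm = mat_of_cols n ss"
  define N where "N = mat_of_cols n (ts @ ss)"
  have W: "W \<in> carrier_mat n (length ts)" and Sm: "Sm \<in> carrier_mat n (length ss)"
    and N: "N \<in> carrier_mat n (length ts + length ss)"
    unfolding W_def Sm_def N_def using mat_of_cols_carrier(1)[of n "ts @ ss"] by auto
  have NWS: "N = append_cols W Sm" unfolding N_def W_def Sm_def by (rule mat_of_cols_append[OF sc(2,1)])
  have colsN: "cols N = ts @ ss" unfolding N_def using sc by (intro cols_mat_of_cols) auto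
  have colsS: "cols Sm = ss" unfolding Sm_def using sc by (intro cols_mat_of_cols) auto
  have colsW: "cols W = ts" unfolding W_def using sc by (intro cols_mat_of_cols) auto
  have setN: "set (cols N) = U" using colsN ss ts U' by auto
  have injN: "v = 0\<^sub>v (length ts + length ss)"
    if "v \<in> carrier_vec (length ts + length ss)" "N *\<^sub>v v = 0\<^sub>v n" for v
    using NC.lin_depI[OF N that(1) _ that(2)] U'(3) colsN setN ss ts by auto
  have factor: "\<exists>X \<in> carrier_mat k m. B = M * X"
    if "M \<in> carrier_mat n k" "B \<in> carrier_mat n m" "\<And>j. j < m \<Longrightarrow> col B j \<in> NC.span (set (cols M))"
    for M B :: "'k mat" and k m
  proof -
    have "\<exists>X \<in> carrier_mat k m. (\<forall>j<m. True) \<and> B = M * X"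
    proof (rule mat_columnwise[OF that(2,1)])
      fix j assume "j < m"
      then have "col B j \<in> {y \<in> carrier_vec n. \<exists>x \<in> carrier_vec k. M *\<^sub>v x = y}"
        using that(3) NC.col_space_eq[OF that(1)] that(1) by (simp add: NC.col_space_def)
      then obtain x where "x \<in> carrier_vec k" "M *\<^sub>v x = col B j" by blast
      then show "\<exists>x \<in> carrier_vec k. True \<and> col B j = M *\<^sub>v x" by (intro bexI[of _ x]) simp_all
    qed
    then show ?thesis by blast
  qed
  obtain R where R: "R \<in> carrier_mat q (length ss)" "Sm = A' * R"
  proof -
    have "\<exists>X \<in> carrier_mat q (length ss). Sm = A' * X"
    proof (rule factor[OF A' Sm])
      fix j assume "j < length ss"
      then have "col Sm j = ss ! j" using colsS Sm by (metis carrier_matD(2) cols_nth)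
      then show "col Sm j \<in> NC.span (set (cols A'))"
        using \<open>j < length ss\<close> ss S' NC.span_mem[OF colsA'] by (metis nth_mem subsetD)
    qed
    then show ?thesis using that by blast
  qed
  obtain R' where R': "R' \<in> carrier_mat (length ss) q" "A' = Sm * R'"
  proof -
    have "\<exists>X \<in> carrier_mat (length ss) q. A' = Sm * X"
    proof (rule factor[OF Sm A'])
      fix j assume "j < q"
      then have "col A' j \<in> set (cols A')" using A' by (auto simp: cols_def)
      then show "col A' j \<in> NC.span (set (cols Sm))" using spanS colsS ss by auto
    qed
    then show ?thesis using that by blast
  qed
  show ?thesis unfolding lens[symmetric]
  proof (rule homology_rankI[OF A A' W])
    show "A * W = 0\<^sub>m p (length ts)"
    proof (rule eq_matI)
      fix i j assume ij: "i < dim_row (0\<^sub>m p (length ts))" "j < dim_col (0\<^sub>m p (length ts))"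
      then have "col W j \<in> mat_kernel A" using colsW W ts U' by (metis DiffD1 carrier_matD(2) cols_nth index_zero_mat(3) nth_mem subsetD)
      then have "A *\<^sub>v col W j = 0\<^sub>v p" using mat_kernelD(2)[OF A] by blast
      then have "col (A * W) j = 0\<^sub>v p"
        using ij by (subst col_mult2[OF A W]) simp_all
      then have "col (A * W) j $ i = 0" using ij by simp
      then show "(A * W) $$ (i,j) = 0\<^sub>m p (length ts) $$ (i,j)" using ij A W by simp
    qed (use A W in auto)
  next
    fix m X assume X: "X \<in> carrier_mat n m" "A * X = 0\<^sub>m p m"
    have "\<exists>Z \<in> carrier_mat (length ts + length ss) m. X = N * Z"
    proof (rule factor[OF N X(1)])
      fix j assume j: "j < m"
      have "A *\<^sub>v col X j = col (A * X) j" by (rule col_mult2[symmetric, OF A X(1) j])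
      then have "col X j \<in> mat_kernel A" using j X A by (intro mat_kernelI[OF A]) auto
      then show "col X j \<in> NC.span (set (cols N))" using spanU setN by simp
    qed
    then obtain Z where "Z \<in> carrier_mat (length ts + length ss) m" and XZ: "X = N * Z" by blast
    then obtain Z1 Z2 where Z: "Z1 \<in> carrier_mat (length ts) m" "Z2 \<in> carrier_mat (length ss) m" "Z = Z1 @\<^sub>r Z2"
      using append_rows_cases by blast
    have "X = W * Z1 + Sm * Z2"
      unfolding XZ Z(3) NWS by (rule append_cols_mult[OF W Sm Z(1,2)])
    also have "Sm * Z2 = A' * (R * Z2)" unfolding R(2) by (rule assoc_mult_mat[OF A' R(1) Z(2)])
    finally show "\<exists>Y \<in> carrier_mat (length ts) m. \<exists>Z \<in> carrier_mat q m. X = W * Y + A' * Z"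
      using Z(1) mult_carrier_mat[OF R(1) Z(2)] by blast
  next
    fix m Y Z assume Y: "Y \<in> carrier_mat (length ts) m" and Z: "Z \<in> carrier_mat q m"
      and eq: "W * Y + A' * Z = 0\<^sub>m n m"
    have "A' * Z = Sm * (R' * Z)"
      by (subst R'(2)) (rule assoc_mult_mat[OF Sm R'(1) Z])
    then have "N * (Y @\<^sub>r (R' * Z)) = 0\<^sub>m n m"
      unfolding NWS append_cols_mult[OF W Sm Y mult_carrier_mat[OF R'(1) Z]] using eq by simp
    then have "Y @\<^sub>r (R' * Z) = 0\<^sub>m (length ts + length ss) m"
      by (intro injective_mat_cancel[OF N _ carrier_append_rows[OF Y mult_carrier_mat[OF R'(1) Z]]] injN)
    then show "Y = 0\<^sub>m (length ts) m"
      unfolding zero_append_rows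
      using append_rows_eq_iff[OF Y mult_carrier_mat[OF R'(1) Z] zero_carrier_mat zero_carrier_mat] by blast
  qed
qed

section \<open>Total Betti numbers from any resolution\<close>

text \<open>A sum of two exponent vectors is zero only if both are, so taking constant coefficients is a ring
  homomorphism.\<close>

lemma const_coeff_mult:
  "const_coeff (p * q) = const_coeff p * (const_coeff q :: 'k::comm_ring_1)"
proof -
  have split: "(0 = l + q) \<longleftrightarrow> (q = 0 \<and> l = 0)" for l q :: "'v \<Rightarrow>\<^sub>0 nat"
    by (auto simp: poly_mapping_eq_iff fun_eq_iff lookup_add)
  have "lookup (p * q) 0 =
      (\<Sum>l. lookup p l * (\<Sum>k. lookup q k when k = 0 when l = 0))"
    by (simp add: lookup_mult split when_when conj_commute)
  also have "\<dots> = (\<Sum>l. lookup p l * lookup q 0 when l = 0)"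
    by (intro Sum_any.cong) (auto simp: when_def)
  finally show ?thesis by (simp add: const_coeff_def)
qed

lemma const_coeff_semiring_hom: "semiring_hom (const_coeff :: ('v, 'k::comm_ring_1) mpoly \<Rightarrow> 'k)"
  by unfold_locales (auto simp: const_coeff_mult, auto simp: const_coeff_def lookup_add lookup_one)

abbreviation const_mat :: "('v, 'k::comm_ring_1) mpoly mat \<Rightarrow> 'k mat" where
  "const_mat \<equiv> map_mat const_coeff"

lemma const_mat_mult:
  "A \<in> carrier_mat n m \<Longrightarrow> B \<in> carrier_mat m k \<Longrightarrow> const_mat (A * B) = const_mat A * const_mat B"
  by (rule semiring_hom.mat_hom_mult[OF const_coeff_semiring_hom])

lemma const_mat_add:
  "A \<in> carrier_mat n m \<Longrightarrow> B \<in> carrier_mat n m \<Longrightarrow> const_mat (A + B) = const_mat A + const_mat B"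
  by (rule eq_matI) (auto simp: const_coeff_def lookup_add)

lemma const_mat_diff:
  "A \<in> carrier_mat n m \<Longrightarrow> B \<in> carrier_mat n m \<Longrightarrow> const_mat (A - B) = const_mat A - const_mat B"
  by (rule eq_matI) (auto simp: const_coeff_def lookup_minus)

lemma const_mat_zero: "const_mat (0\<^sub>m n m) = 0\<^sub>m n m"
  and const_mat_one: "const_mat (1\<^sub>m n) = 1\<^sub>m n"
  by (auto simp: const_coeff_def lookup_one)

text \<open>The rows with entries in \<open>M\<close> are exactly those that factor through the augmentation, which says
  that its image is the ideal \<open>M\<close>.\<close>

definition resolves ::
    "'v set \<Rightarrow> ('v, 'k::comm_ring_1) mpoly set \<Rightarrow> (nat \<Rightarrow> nat) \<Rightarrow> (nat \<Rightarrow> ('v, 'k) mpoly mat) \<Rightarrow> bool" where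
  "resolves V M B D \<longleftrightarrow> B 0 = 1 \<and> exact_complex V B D \<and> M \<subseteq> poly_ring V \<and>
     (\<forall>m. \<forall>X \<in> mats V 1 m. (\<forall>j<m. X $$ (0,j) \<in> M) \<longleftrightarrow> (\<exists>Y \<in> mats V (B 1) m. X = D 0 * Y))"

lemma resolvesD:
  assumes "resolves V M B D"
  shows "B 0 = 1" "exact_complex V B D" "M \<subseteq> poly_ring V" "D 0 \<in> mats V 1 (B 1)"
  using assms exact_mats[of V B D 0] by (auto simp: resolves_def)

lemma resolves_lift:
  assumes "resolves V M B D" "X \<in> mats V 1 m" "\<And>j. j < m \<Longrightarrow> X $$ (0,j) \<in> M"
  obtains Y where "Y \<in> mats V (B 1) m" "X = D 0 * Y"
  using assms unfolding resolves_def by metis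

lemma resolves_entry:
  assumes "resolves V M B D" "Y \<in> mats V (B 1) m" "j < m"
  shows "(D 0 * Y) $$ (0,j) \<in> M"
  using assms mats_mult[OF resolvesD(4)[OF assms(1)] assms(2)] unfolding resolves_def by metis

lemma resolution_map_exists:
  assumes D: "resolves V M B D" and D': "resolves V M' B' D'" and sub: "M \<subseteq> M'"
  obtains \<phi> where "chain_map V B D B' D' \<phi>" "\<phi> 0 = 1\<^sub>m 1"
proof -
  have "D 0 $$ (0,j) \<in> M'" if "j < B 1" for j
  proof -
    have "D 0 * 1\<^sub>m (B 1) = D 0" using matsD[OF resolvesD(4)[OF D]] by simp
    then show ?thesis using resolves_entry[OF D mats_1 that] sub by auto
  qed
  then obtain \<phi>1 where \<phi>1: "\<phi>1 \<in> mats V (B' 1) (B 1)" "D 0 = D' 0 * \<phi>1"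
    using resolves_lift[OF D' resolvesD(4)[OF D]] by blast
  have "1\<^sub>m 1 * D 0 = D' 0 * \<phi>1" using \<phi>1(2) left_mult_one_mat[OF matsD[OF resolvesD(4)[OF D]]] by metis
  moreover have "1\<^sub>m 1 \<in> mats V (B' 0) (B 0)"
    using resolvesD(1)[OF D] resolvesD(1)[OF D'] mats_1 by simp
  ultimately show thesis
    using chain_map_exists[OF resolvesD(2)[OF D] resolvesD(2)[OF D'] _ \<phi>1(1)] that by blast
qed

text \<open>Composition with \<open>Suc\<close> removes the augmentation before tensoring with \<open>K\<close>.\<close>

abbreviation tor_diff :: "(nat \<Rightarrow> nat) \<Rightarrow> (nat \<Rightarrow> ('v, 'k::comm_ring_1) mpoly mat) \<Rightarrow> nat \<Rightarrow> 'k mat" where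
  "tor_diff B D i \<equiv> tensor_diff (B \<circ> Suc) (D \<circ> Suc) i"

definition tor_rank :: "(nat \<Rightarrow> nat) \<Rightarrow> (nat \<Rightarrow> ('v, 'k::field) mpoly mat) \<Rightarrow> nat \<Rightarrow> nat \<Rightarrow> bool" where
  "tor_rank B D i h \<longleftrightarrow>
     homology_rank (tor_diff B D i) (tor_diff B D (Suc i)) h"

lemma tensor_diff_simps:
  "tor_diff B D 0 = 0\<^sub>m 0 (B 1)"
  "tor_diff B D (Suc i) = const_mat (D (Suc i))"
  by (simp_all add: tensor_diff_def)

text \<open>The differential leaving degree \<open>0\<close> maps to the zero space instead of the free module of rank
  \<open>B 0\<close>, because the augmentation is not part of the tensored complex.\<close>

definition tor_target :: "(nat \<Rightarrow> nat) \<Rightarrow> nat \<Rightarrow> nat" where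
  "tor_target B i = (if i = 0 then 0 else B i)"

lemma tensor_diff_carrier:
  assumes "exact_complex V B D"
  shows "tor_diff B D i \<in> carrier_mat (tor_target B i) (B (Suc i))"
  using exact_carrier[OF assms, of i] by (cases i) (simp_all add: tensor_diff_simps tor_target_def)

lemma tensor_diff_carrier_Suc:
  assumes "exact_complex V B D"
  shows "tor_diff B D (Suc i) \<in> carrier_mat (B (Suc i)) (B (Suc (Suc i)))"
  using tensor_diff_carrier[OF assms, of "Suc i"] by (simp add: tor_target_def)

lemma tor_rank_tor_dim:
  assumes D: "exact_complex V B D"
  shows "tor_rank B D i (tor_dim (B \<circ> Suc) (D \<circ> Suc) i)"
proof -
  have "tor_diff B D i * tor_diff B D (Suc i) =
      0\<^sub>m (tor_target B i) (B (Suc (Suc i)))"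
  proof (cases i)
    case 0
    then show ?thesis
      using exact_carrier[OF D, of "Suc 0"] by (simp add: tensor_diff_simps tor_target_def)
  next
    case (Suc j)
    then show ?thesis
      using exact_square[OF D, of i]
        const_mat_mult[OF exact_carrier[OF D, of i] exact_carrier[OF D, of "Suc i"], symmetric]
      by (simp add: tensor_diff_simps tor_target_def const_mat_zero)
  qed
  from homology_rank_kernel_dim[OF tensor_diff_carrier[OF D] tensor_diff_carrier_Suc[OF D] this]
  show ?thesis by (simp add: tor_rank_def tor_dim_def)
qed

lemma tor_rank_unique:
  assumes "exact_complex V B D" "tor_rank B D i h" "tor_rank B D i l"
  shows "h = l"
  using homology_rank_unique[OF tensor_diff_carrier[OF assms(1)] tensor_diff_carrier_Suc[OF assms(1)]] assms(2,3)
  unfolding tor_rank_def by blast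

text \<open>Both resolutions start with the same ring and the same ideal. Lifting the identity in both
  directions gives chain maps whose composites differ from the identity by homotopies that vanish
  on the augmentation term, and this survives the passage to constant coefficients.\<close>

lemma tor_rank_independent:
  assumes D: "resolves V M B D" and D': "resolves V M B' D'" and h: "tor_rank B D i h"
  shows "tor_rank B' D' i h"
proof -
  note eD = resolvesD(2)[OF D] and eD' = resolvesD(2)[OF D']
  note b = resolvesD(1)[OF D] resolvesD(1)[OF D']
  obtain \<phi> where \<phi>: "chain_map V B D B' D' \<phi>" "\<phi> 0 = 1\<^sub>m 1" by (rule resolution_map_exists[OF D D' order_refl])
  obtain \<psi> where \<psi>: "chain_map V B' D' B D \<psi>" "\<psi> 0 = 1\<^sub>m 1" by (rule resolution_map_exists[OF D' D order_refl])
  note \<phi>c = chain_mapD(2)[OF \<phi>(1)] and \<psi>c = chain_mapD(2)[OF \<psi>(1)]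
    and c = exact_carrier[OF eD] and c' = exact_carrier[OF eD']
  have "\<psi> 0 * \<phi> 0 - 1\<^sub>m (B 0) = 0\<^sub>m (B 0) (B 0)" "\<phi> 0 * \<psi> 0 - 1\<^sub>m (B' 0) = 0\<^sub>m (B' 0) (B' 0)"
    using b \<phi>(2) \<psi>(2) by auto
  note hom = chain_map_homotopy[OF eD eD chain_map_minus_id[OF eD chain_map_comp[OF eD eD' eD \<phi>(1) \<psi>(1)]] this(1)]
    chain_map_homotopy[OF eD' eD' chain_map_minus_id[OF eD' chain_map_comp[OF eD' eD eD' \<psi>(1) \<phi>(1)]] this(2)]
  obtain s where s: "\<And>i. s i \<in> mats V (B (Suc i)) (B i)" "s 0 = 0\<^sub>m (B 1) (B 0)"
    "\<And>i. \<psi> (Suc i) * \<phi> (Suc i) - 1\<^sub>m (B (Suc i)) = D (Suc i) * s (Suc i) + s i * D i"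
    by (rule hom(1)) blast
  obtain s' where s': "\<And>i. s' i \<in> mats V (B' (Suc i)) (B' i)" "s' 0 = 0\<^sub>m (B' 1) (B' 0)"
    "\<And>i. \<phi> (Suc i) * \<psi> (Suc i) - 1\<^sub>m (B' (Suc i)) = D' (Suc i) * s' (Suc i) + s' i * D' i"
    by (rule hom(2)) blast
  \<comment> \<open>In degree \<open>0\<close> the target of the differential is the zero space, hence the empty matrix.\<close>
  have comm: "tor_diff B2 D2 i * const_mat (f (Suc i)) =
      (if i = 0 then 0\<^sub>m 0 0 else const_mat (f i)) * tor_diff B1 D1 i"
    if "chain_map V B1 D1 B2 D2 f" "exact_complex V B1 D1" "exact_complex V B2 D2"
    for B1 D1 B2 D2 and f :: "nat \<Rightarrow> ('a, 'b) mpoly mat" and i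
  proof (cases i)
    case 0
    then show ?thesis using chain_mapD(2)[OF that(1), of 1] by (simp add: tensor_diff_simps)
  next
    case (Suc j)
    then show ?thesis
      using const_mat_mult[OF exact_carrier[OF that(3)] chain_mapD(2)[OF that(1)], of i]
        const_mat_mult[OF chain_mapD(2)[OF that(1)] exact_carrier[OF that(2)], of i]
        chain_mapD(3)[OF that(1), of i]
      by (simp add: tensor_diff_simps)
  qed
  have homot: "const_mat (g (Suc i)) * const_mat (f (Suc i)) - 1\<^sub>m (B1 (Suc i)) =
      tor_diff B1 D1 (Suc i) * const_mat (t (Suc i)) +
      (if i = 0 then 0\<^sub>m (B1 1) 0 else const_mat (t i)) * tor_diff B1 D1 i"
    if g: "g (Suc i) \<in> carrier_mat (B1 (Suc i)) (B2 (Suc i))" and f: "f (Suc i) \<in> carrier_mat (B2 (Suc i)) (B1 (Suc i))"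
      and D1: "exact_complex V B1 D1" and t: "\<And>i. t i \<in> carrier_mat (B1 (Suc i)) (B1 i)" "t 0 = 0\<^sub>m (B1 1) (B1 0)"
      and eq: "\<And>i. g (Suc i) * f (Suc i) - 1\<^sub>m (B1 (Suc i)) = D1 (Suc i) * t (Suc i) + t i * D1 i"
    for B1 B2 :: "nat \<Rightarrow> nat" and f g D1 t :: "nat \<Rightarrow> ('a, 'b) mpoly mat" and i
  proof -
    note c1 = exact_carrier[OF D1]
    have "const_mat (g (Suc i)) * const_mat (f (Suc i)) - 1\<^sub>m (B1 (Suc i)) =
        const_mat (g (Suc i) * f (Suc i) - 1\<^sub>m (B1 (Suc i)))"
      by (simp only: const_mat_diff[OF mult_carrier_mat[OF g f] one_carrier_mat] const_mat_mult[OF g f] const_mat_one)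
    also have "\<dots> = const_mat (D1 (Suc i)) * const_mat (t (Suc i)) + const_mat (t i) * const_mat (D1 i)"
      by (simp only: eq const_mat_add[OF mult_carrier_mat[OF c1 t(1)] mult_carrier_mat[OF t(1) c1]]
          const_mat_mult[OF c1 t(1)] const_mat_mult[OF t(1) c1])
    finally show ?thesis
      using c1[of 0] by (cases i) (simp_all add: tensor_diff_simps t(2) const_mat_zero)
  qed
  have homot\<phi>: "const_mat (\<psi> (Suc i)) * const_mat (\<phi> (Suc i)) - 1\<^sub>m (B (Suc i)) =
      tor_diff B D (Suc i) * const_mat (s (Suc i)) +
      (if i = 0 then 0\<^sub>m (B 1) 0 else const_mat (s i)) * tor_diff B D i"
    by (rule homot[where ?B2.0=B', OF \<psi>c \<phi>c eD matsD[OF s(1)] s(2) s(3)])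
  have homot\<psi>: "const_mat (\<phi> (Suc i)) * const_mat (\<psi> (Suc i)) - 1\<^sub>m (B' (Suc i)) =
      tor_diff B' D' (Suc i) * const_mat (s' (Suc i)) +
      (if i = 0 then 0\<^sub>m (B' 1) 0 else const_mat (s' i)) * tor_diff B' D' i"
    by (rule homot[where ?B2.0=B, OF \<phi>c \<psi>c eD' matsD[OF s'(1)] s'(2) s'(3)])
  show ?thesis
    unfolding tor_rank_def
  proof (rule homology_rank_transfer[OF tensor_diff_carrier[OF eD] tensor_diff_carrier_Suc[OF eD]
        tensor_diff_carrier[OF eD'] tensor_diff_carrier_Suc[OF eD'] _ _
        _ comm[OF \<phi>(1) eD eD'] _ comm[OF \<psi>(1) eD' eD] _ _ _ _ _ _ homot\<phi> _ _ homot\<psi>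
        h[unfolded tor_rank_def]])
    show "const_mat (\<phi> (Suc i)) \<in> carrier_mat (B' (Suc i)) (B (Suc i))"
      "const_mat (\<psi> (Suc i)) \<in> carrier_mat (B (Suc i)) (B' (Suc i))"
      "const_mat (\<phi> (Suc (Suc i))) \<in> carrier_mat (B' (Suc (Suc i))) (B (Suc (Suc i)))"
      "const_mat (\<psi> (Suc (Suc i))) \<in> carrier_mat (B (Suc (Suc i))) (B' (Suc (Suc i)))"
      "const_mat (s (Suc i)) \<in> carrier_mat (B (Suc (Suc i))) (B (Suc i))"
      "const_mat (s' (Suc i)) \<in> carrier_mat (B' (Suc (Suc i))) (B' (Suc i))"
      using \<phi>c \<psi>c matsD[OF s(1)] matsD[OF s'(1)] by simp_all
    show "(if i = 0 then 0\<^sub>m 0 0 else const_mat (\<phi> i)) \<in> carrier_mat (tor_target B' i) (tor_target B i)"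
      "(if i = 0 then 0\<^sub>m 0 0 else const_mat (\<psi> i)) \<in> carrier_mat (tor_target B i) (tor_target B' i)"
      using \<phi>c[of i] \<psi>c[of i] by (auto simp: tor_target_def)
    show "(if i = 0 then 0\<^sub>m (B 1) 0 else const_mat (s i)) \<in> carrier_mat (B (Suc i)) (tor_target B i)"
      "(if i = 0 then 0\<^sub>m (B' 1) 0 else const_mat (s' i)) \<in> carrier_mat (B' (Suc i)) (tor_target B' i)"
      using matsD[OF s(1)[of i]] matsD[OF s'(1)[of i]] by (auto simp: tor_target_def)
    show "const_mat (\<phi> (Suc i)) * tor_diff B D (Suc i) =
        tor_diff B' D' (Suc i) * const_mat (\<phi> (Suc (Suc i)))"
      using comm[OF \<phi>(1) eD eD', of "Suc i"] by simp
    show "const_mat (\<psi> (Suc i)) * tor_diff B' D' (Suc i) =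
        tor_diff B D (Suc i) * const_mat (\<psi> (Suc (Suc i)))"
      using comm[OF \<psi>(1) eD' eD, of "Suc i"] by simp
  qed
qed

lemma all_nat_iff: "(\<forall>i. P i) \<longleftrightarrow> P 0 \<and> (\<forall>i. P (Suc i))"
  by (metis not0_implies_Suc)

lemma mats_elements:
  "A \<in> mats V n m \<longleftrightarrow> A \<in> carrier_mat n m \<and> elements_mat A \<subseteq> poly_ring V"
  unfolding mats_def by (fastforce simp: elements_mat_def)

lemma free_mod_col: "X \<in> mats V n m \<Longrightarrow> j < m \<Longrightarrow> col X j \<in> free_mod V n"
  by (auto simp: mats_def free_mod_def)

definition column :: "'a vec \<Rightarrow> 'a mat" where
  "column v = mat (dim_vec v) 1 (\<lambda>(i,j). v $ i)"

lemma column_mats: "v \<in> free_mod V n \<Longrightarrow> column v \<in> mats V n 1"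
  by (auto simp: column_def mats_def free_mod_def)

lemma col_column: "col (column v) 0 = v"
  by (rule eq_vecI) (auto simp: column_def)

lemma column_mult:
  "A \<in> carrier_mat n m \<Longrightarrow> v \<in> carrier_vec m \<Longrightarrow> A * column v = column (A *\<^sub>v v)"
  by (intro eq_matI) (auto simp: column_def scalar_prod_def)

lemma column_eq_zero: "column v = 0\<^sub>m n 1 \<longleftrightarrow> v = 0\<^sub>v n"
proof
  assume eq: "column v = 0\<^sub>m n 1"
  have "v = col (column v) 0" by (simp add: col_column)
  also have "\<dots> = 0\<^sub>v n" unfolding eq by simp
  finally show "v = 0\<^sub>v n" .
qed (auto simp: column_def)

lemma mats_columnwise:
  assumes A: "A \<in> mats V n m" and M: "M \<in> mats V n k"
    and cols: "\<And>j. j < m \<Longrightarrow> \<exists>x \<in> free_mod V k. col A j = M *\<^sub>v x"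
  shows "\<exists>X \<in> mats V k m. A = M * X"
proof -
  have "\<exists>X \<in> carrier_mat k m. (\<forall>j<m. col X j \<in> free_mod V k) \<and> A = M * X"
    by (rule mat_columnwise[OF matsD[OF A] matsD[OF M]])
      (use cols in \<open>fastforce simp: free_mod_def\<close>)
  then obtain X where X: "X \<in> carrier_mat k m" "\<And>j. j < m \<Longrightarrow> col X j \<in> free_mod V k" "A = M * X" by blast
  have "X $$ (i,j) \<in> poly_ring V" if "i < k" "j < m" for i j
  proof -
    have "col X j $ i \<in> poly_ring V" using X(2)[OF that(2)] that by (simp add: free_mod_def)
    then show ?thesis using X(1) that by simp
  qed
  then have "X \<in> mats V k m" using X(1) by (simp add: mats_def)
  then show ?thesis using X(3) by blast
qed

text \<open>A vector is a matrix with one column, and a matrix equation is solved column by column.\<close>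

lemma exact_vectors_iff_matrices:
  assumes A: "A \<in> mats V p n" and A': "A' \<in> mats V n q"
  shows "{v \<in> free_mod V n. A *\<^sub>v v = 0\<^sub>v p} = (\<lambda>v. A' *\<^sub>v v) ` free_mod V q \<longleftrightarrow>
    A * A' = 0\<^sub>m p q \<and>
    (\<forall>m. \<forall>X \<in> mats V n m. A * X = 0\<^sub>m p m \<longrightarrow> (\<exists>Y \<in> mats V q m. X = A' * Y))"
  (is "?K = ?I \<longleftrightarrow> ?R")
proof
  note Ac = matsD[OF A] and A'c = matsD[OF A']
  assume eq: "?K = ?I"
  show ?R
  proof (intro conjI allI ballI impI)
    show "A * A' = 0\<^sub>m p q"
    proof (rule eq_matI)
      fix i j assume ij: "i < dim_row (0\<^sub>m p q)" "j < dim_col (0\<^sub>m p q)"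
      then have j: "j < q" by simp
      have "A' *\<^sub>v unit_vec q j \<in> ?I" 
        by (rule imageI) (auto simp: free_mod_def unit_vec_def poly_ring_0 poly_ring_1)
      then have "A *\<^sub>v (A' *\<^sub>v unit_vec q j) = 0\<^sub>v p" using eq by blast
      also have "A' *\<^sub>v unit_vec q j = col A' j"
        using A'c j by (intro eq_vecI) (auto simp: scalar_prod_right_unit)
      finally have "col (A * A') j = 0\<^sub>v p" using col_mult2[OF Ac A'c j] by simp
      then have "col (A * A') j $ i = 0" using ij by simp
      then show "(A * A') $$ (i,j) = 0\<^sub>m p q $$ (i,j)" using ij Ac A'c by simp
    qed (use Ac A'c in auto)
  next
    fix m X assume X: "X \<in> mats V n m" "A * X = 0\<^sub>m p m"
    show "\<exists>Y \<in> mats V q m. X = A' * Y"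
    proof (rule mats_columnwise[OF X(1) A'])
      fix j assume j: "j < m"
      have "A *\<^sub>v col X j = col (A * X) j" by (rule col_mult2[symmetric, OF Ac matsD[OF X(1)] j])
      also have "\<dots> = 0\<^sub>v p" using X(2) j by simp
      finally have "col X j \<in> ?K" using free_mod_col[OF X(1) j] by simp
      then show "\<exists>x \<in> free_mod V q. col X j = A' *\<^sub>v x" unfolding eq by blast
    qed
  qed
next
  note Ac = matsD[OF A] and A'c = matsD[OF A']
  assume R: ?R
  show "?K = ?I"
  proof (intro subset_antisym subsetI)
    fix v assume v: "v \<in> ?K"
    then have "v \<in> carrier_vec n" by (simp add: free_mod_def)
    then have "A * column v = 0\<^sub>m p 1" using v by (simp only: column_mult[OF Ac] column_eq_zero) simp
    then obtain Y where Y: "Y \<in> mats V q 1" "column v = A' * Y"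
      using R column_mats[of v V n] v by blast
    have "v = col (A' * Y) 0" using Y(2) col_column by metis
    also have "\<dots> = A' *\<^sub>v col Y 0" by (rule col_mult2[OF A'c matsD[OF Y(1)]]) simp
    finally show "v \<in> ?I" using free_mod_col[OF Y(1), of 0] by simp
  next
    fix v assume "v \<in> ?I"
    then obtain w where w: "w \<in> free_mod V q" "v = A' *\<^sub>v w" by blast
    then have wc: "w \<in> carrier_vec q" by (simp add: free_mod_def)
    have "v \<in> free_mod V n"
    proof -
      have "column v \<in> mats V n 1"
        using mats_mult[OF A' column_mats[OF w(1)]] column_mult[OF A'c wc] w(2) by simp
      from free_mod_col[OF this, of 0] show ?thesis by (simp add: col_column)
    qed
    moreover have "A *\<^sub>v v = 0\<^sub>v p"
      unfolding w(2) assoc_mult_mat_vec[symmetric, OF Ac A'c wc] conjunct1[OF R]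
      using wc by (intro eq_vecI) auto
    ultimately show "v \<in> ?K" by simp
  qed
qed

lemma mat_of_row_mult_vec: "g \<in> carrier_vec n \<Longrightarrow> v \<in> carrier_vec n \<Longrightarrow> mat_of_row g *\<^sub>v v = vec 1 (\<lambda>_. g \<bullet> v)"
  by (intro eq_vecI) auto

lemma mat_of_row_mats: "mat_of_row g \<in> mats V 1 n \<longleftrightarrow> g \<in> free_mod V n"
proof -
  have "mat_of_row g \<in> carrier_mat 1 n \<longleftrightarrow> g \<in> carrier_vec n"
    by (metis carrier_matD(2) carrier_vecI mat_of_row_dim(2) mat_of_row_carrier(1))
  moreover have "mat_of_row g $$ (0,j) = g $ j" if "g \<in> carrier_vec n" "j < n" for j
    by (rule mat_of_row_index) (use that in simp)
  ultimately show ?thesis unfolding mats_def free_mod_def by force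
qed

text \<open>Prepending the augmentation to the differentials turns a free resolution into an exact
  complex that starts with the ring itself.\<close>

lemma free_resolution_iff_resolves:
  assumes B0: "B 0 = 1" and D0: "D 0 = mat_of_row g" and M: "M \<subseteq> poly_ring V"
  shows "free_resolution V M (B \<circ> Suc) g (D \<circ> Suc) \<longleftrightarrow> resolves V M B D"
proof -
  define img where "img = (\<lambda>v. g \<bullet> v) ` free_mod V (B 1)"
  have mats: "g \<in> free_mod V (B 1) \<and>
      (\<forall>i. D (Suc i) \<in> carrier_mat (B (Suc i)) (B (Suc (Suc i))) \<and> elements_mat (D (Suc i)) \<subseteq> poly_ring V) \<longleftrightarrow>
      (\<forall>i. D i \<in> mats V (B i) (B (Suc i)))" (is "?m \<longleftrightarrow> ?m'")
  proof -
    have "?m' \<longleftrightarrow> D 0 \<in> mats V (B 0) (B (Suc 0)) \<and> (\<forall>i. D (Suc i) \<in> mats V (B (Suc i)) (B (Suc (Suc i))))"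
      by (rule all_nat_iff)
    then show ?thesis using mat_of_row_mats[of g V "B 1"] by (simp add: B0 D0 mats_elements) blast
  qed
  have ker0: "{v \<in> free_mod V (B 1). g \<bullet> v = 0} = {v \<in> free_mod V (B 1). D 0 *\<^sub>v v = 0\<^sub>v (B 0)}"
    if "g \<in> free_mod V (B 1)"
  proof -
    have "D 0 *\<^sub>v v = 0\<^sub>v (B 0) \<longleftrightarrow> g \<bullet> v = 0" if "v \<in> free_mod V (B 1)" for v
    proof -
      have "D 0 *\<^sub>v v = vec 1 (\<lambda>_. g \<bullet> v)"
        unfolding D0 by (rule mat_of_row_mult_vec[of _ "B 1"]) (use that \<open>g \<in> free_mod V (B 1)\<close> in \<open>auto simp: free_mod_def\<close>)
      then show ?thesis by (auto simp: B0 vec_eq_iff)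
    qed
    then show ?thesis by blast
  qed
  have exact: "?m' \<Longrightarrow> ({v \<in> free_mod V (B 1). g \<bullet> v = 0} = (\<lambda>v. D 1 *\<^sub>v v) ` free_mod V (B 2) \<and>
     (\<forall>i. {v \<in> free_mod V (B (Suc (Suc i))). D (Suc i) *\<^sub>v v = 0\<^sub>v (B (Suc i))} =
          (\<lambda>v. D (Suc (Suc i)) *\<^sub>v v) ` free_mod V (B (Suc (Suc (Suc i)))))) \<longleftrightarrow> exact_complex V B D"
  proof -
    assume m: ?m'
    then have g: "g \<in> free_mod V (B 1)" using mats by blast
    have "exact_complex V B D \<longleftrightarrow>
      (\<forall>i. {v \<in> free_mod V (B (Suc i)). D i *\<^sub>v v = 0\<^sub>v (B i)} =
          (\<lambda>v. D (Suc i) *\<^sub>v v) ` free_mod V (B (Suc (Suc i))))" (is "_ \<longleftrightarrow> (\<forall>i. ?E i)")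
      unfolding exact_complex_def exact_vectors_iff_matrices[OF m[rule_format] m[rule_format]]
      using m by (simp only: simp_thms all_conj_distrib)
    also have "\<dots> \<longleftrightarrow> ?E 0 \<and> (\<forall>i. ?E (Suc i))" by (rule all_nat_iff)
    finally show ?thesis using ker0[OF g] by (simp add: numeral_2_eq_2)
  qed
  have image: "img = M \<longleftrightarrow>
      (\<forall>m. \<forall>X \<in> mats V 1 m. (\<forall>j<m. X $$ (0,j) \<in> M) \<longleftrightarrow> (\<exists>Y \<in> mats V (B 1) m. X = D 0 * Y))"
      (is "_ \<longleftrightarrow> ?r") if g: "g \<in> free_mod V (B 1)"
  proof
    have gc: "g \<in> carrier_vec (B 1)" using g by (simp add: free_mod_def)
    have D0m: "D 0 \<in> mats V 1 (B 1)" using g mat_of_row_mats unfolding D0 by blast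
    note D0c = matsD[OF D0m]
    have entry: "(D 0 * Y) $$ (0,j) = g \<bullet> col Y j" if "Y \<in> mats V (B 1) m" "j < m" for Y m j
      using D0c matsD[OF that(1)] that(2) by (simp add: D0)
    {
      assume img: "img = M"
      show ?r
      proof (intro allI ballI iffI impI)
        fix m and X :: "('a, 'b) mpoly mat" assume X: "X \<in> mats V 1 m" "\<forall>j<m. X $$ (0,j) \<in> M"
        show "\<exists>Y \<in> mats V (B 1) m. X = D 0 * Y"
        proof (rule mats_columnwise[OF X(1) D0m])
          fix j assume j: "j < m"
          then obtain v where v: "v \<in> free_mod V (B 1)" "X $$ (0,j) = g \<bullet> v" using X(2) img img_def by blast
          then have "D 0 *\<^sub>v v = vec 1 (\<lambda>_. X $$ (0,j))"
            unfolding D0 v(2) by (intro mat_of_row_mult_vec[OF gc]) (simp add: free_mod_def)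
          also have "\<dots> = col X j" using matsD[OF X(1)] j by (intro eq_vecI) auto
          finally show "\<exists>x \<in> free_mod V (B 1). col X j = D 0 *\<^sub>v x" using v(1) by metis
        qed
      next
        fix m j and X :: "('a, 'b) mpoly mat"
        assume "\<exists>Y \<in> mats V (B 1) m. X = D 0 * Y" and j: "j < m"
        then obtain Y where Y: "Y \<in> mats V (B 1) m" "X = D 0 * Y" by blast
        then show "X $$ (0,j) \<in> M"
          using entry[OF Y(1) j] free_mod_col[OF Y(1) j] unfolding img[symmetric] img_def by blast
      qed
    }
    {
      assume r: ?r
      show "img = M"
      proof (intro subset_antisym subsetI)
        fix x assume "x \<in> img"
        then obtain v where v: "v \<in> free_mod V (B 1)" "x = g \<bullet> v" by (auto simp: img_def)
        from entry[OF column_mats[OF v(1)], of 0] have "(D 0 * column v) $$ (0,0) = x" by (simp add: col_column v(2))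
        moreover have "(\<forall>j<1. (D 0 * column v) $$ (0,j) \<in> M) \<longleftrightarrow>
            (\<exists>Y \<in> mats V (B 1) 1. D 0 * column v = D 0 * Y)"
          by (rule r[rule_format, OF mats_mult[OF D0m column_mats[OF v(1)]]])
        then have "(D 0 * column v) $$ (0,0) \<in> M" using column_mats[OF v(1)] by blast
        ultimately show "x \<in> M" by simp
      next
        fix x assume x: "x \<in> M"
        let ?X = "mat 1 1 (\<lambda>_. x)"
        have "?X \<in> mats V 1 1" using x M by (auto simp: mats_def)
        moreover have "\<forall>j<1. ?X $$ (0,j) \<in> M" using x by simp
        ultimately obtain Y where Y: "Y \<in> mats V (B 1) 1" "?X = D 0 * Y" using r by blast
        have "x = ?X $$ (0,0)" by simp
        also have "\<dots> = (D 0 * Y) $$ (0,0)" by (simp only: Y(2))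
        also have "\<dots> = g \<bullet> col Y 0" by (rule entry[OF Y(1)]) simp
        finally show "x \<in> img" using free_mod_col[OF Y(1), of 0] by (auto simp: img_def)
      qed
    }
  qed
  have "free_resolution V M (B \<circ> Suc) g (D \<circ> Suc) \<longleftrightarrow>
      (g \<in> free_mod V (B 1) \<and>
        (\<forall>i. D (Suc i) \<in> carrier_mat (B (Suc i)) (B (Suc (Suc i))) \<and> elements_mat (D (Suc i)) \<subseteq> poly_ring V)) \<and>
      img = M \<and>
      {v \<in> free_mod V (B 1). g \<bullet> v = 0} = (\<lambda>v. D 1 *\<^sub>v v) ` free_mod V (B 2) \<and>
      (\<forall>i. {v \<in> free_mod V (B (Suc (Suc i))). D (Suc i) *\<^sub>v v = 0\<^sub>v (B (Suc i))} =
          (\<lambda>v. D (Suc (Suc i)) *\<^sub>v v) ` free_mod V (B (Suc (Suc (Suc i)))))"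
    unfolding free_resolution_def img_def by (simp only: o_def One_nat_def numeral_2_eq_2 conj_assoc)
  also have "\<dots> \<longleftrightarrow> resolves V M B D"
  proof (cases "\<forall>i. D i \<in> mats V (B i) (B (Suc i))")
    case True
    then have g: "g \<in> free_mod V (B 1)" using mats by blast
    show ?thesis
      unfolding mats exact[OF True] image[OF g] resolves_def by (simp only: True B0 M simp_thms conj_commute)
  next
    case False
    then show ?thesis unfolding mats resolves_def exact_complex_def by (simp only: simp_thms)
  qed
  finally show ?thesis .
qed

lemma free_resolution_subset_poly_ring:
  assumes "free_resolution V M b g d"
  shows "M \<subseteq> poly_ring V"
proof
  fix x assume "x \<in> M"
  then obtain v where "v \<in> free_mod V (b 0)" "x = g \<bullet> v" using assms unfolding free_resolution_def by blast
  then show "x \<in> poly_ring V"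
    using assms unfolding free_resolution_def free_mod_def scalar_prod_def
    by (auto intro!: poly_ring_sum poly_ring_mult)
qed

text \<open>The existence of one resolution guarantees that the choice in the definition of Betti numbers
  yields a resolution. It need not be the given one, but it has the same \<open>Tor\<close> ranks.\<close>

theorem betti_eqI:
  assumes D: "resolves V M B D" and h: "tor_rank B D i h"
  shows "betti V M (int i) = h"
proof -
  have "D 0 = mat_of_row (row (D 0) 0)"
    using matsD[OF resolvesD(4)[OF D]] by (intro eq_matI) (auto simp: mat_of_row_def)
  then have "free_resolution V M (B \<circ> Suc) (row (D 0) 0) (D \<circ> Suc)"
    using free_resolution_iff_resolves[of B D "row (D 0) 0" M V] D resolvesD(1,3)[OF D] by blast
  then have ex: "\<exists>x. case x of (b, g, d) \<Rightarrow> free_resolution V M b g d" by force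
  obtain b g d where bgd: "(SOME (b, g, d). free_resolution V M b g d) = (b, g, d)" by (metis prod_cases3)
  have r: "free_resolution V M b g d" using someI_ex[OF ex] bgd by simp
  define B' where "B' = case_nat 1 b"
  define D' where "D' = case_nat (mat_of_row g) d"
  have s: "B' \<circ> Suc = b" "D' \<circ> Suc = d" by (auto simp: B'_def D'_def)
  have D': "resolves V M B' D'"
    using free_resolution_iff_resolves[of B' D' g M V] r free_resolution_subset_poly_ring[OF r] s
    by (simp add: B'_def D'_def)
  have "tor_rank B' D' i (tor_dim b d i)"
    using tor_rank_tor_dim[OF resolvesD(2)[OF D'], of i] by (simp only: s)
  then have "tor_dim b d i = h"
    using tor_rank_unique[OF resolvesD(2)[OF D']] tor_rank_independent[OF D D' h] by blast
  then show ?thesis by (simp add: betti_def bgd)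
qed

section \<open>Direct sums and mapping cones\<close>

lemma mat_uminus_uminus: "- (- A) = (A :: 'a::ab_group_add mat)"
  by (rule eq_matI) auto

lemma mat_uminus_zero: "- 0\<^sub>m n m = (0\<^sub>m n m :: 'a::ab_group_add mat)"
  by (rule eq_matI) auto

lemma homology_rank_uminus:
  fixes A :: "'k::field mat"
  assumes A: "A \<in> carrier_mat p n" "A' \<in> carrier_mat n q" and h: "homology_rank A A' h"
  shows "homology_rank (- A) (- A') h"
proof -
  from h A obtain W where W: "W \<in> carrier_mat n h" "A * W = 0\<^sub>m p h"
    and gen: "\<And>m X. X \<in> carrier_mat n m \<Longrightarrow> A * X = 0\<^sub>m p m \<Longrightarrow>
      \<exists>Y \<in> carrier_mat h m. \<exists>Z \<in> carrier_mat q m. X = W * Y + A' * Z"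
    and ind: "\<And>m Y Z. Y \<in> carrier_mat h m \<Longrightarrow> Z \<in> carrier_mat q m \<Longrightarrow>
      W * Y + A' * Z = 0\<^sub>m n m \<Longrightarrow> Y = 0\<^sub>m h m" by (rule homology_rankE) blast
  have 0: "X = 0\<^sub>m p m" if "- X = 0\<^sub>m p m" for X :: "'k mat" and m
    using arg_cong[OF that, of uminus] by (simp add: mat_uminus_uminus mat_uminus_zero)
  show ?thesis
  proof (rule homology_rankI[of _ p n _ q W])
    fix m X assume X: "X \<in> carrier_mat n m" "- A * X = 0\<^sub>m p m"
    then have "A * X = 0\<^sub>m p m" using 0 A by simp
    from gen[OF X(1) this] obtain Y Z where "Y \<in> carrier_mat h m" "Z \<in> carrier_mat q m" "X = W * Y + A' * Z" by blast
    then show "\<exists>Y \<in> carrier_mat h m. \<exists>Z \<in> carrier_mat q m. X = W * Y + - A' * Z"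
      using A by (intro bexI[of _ Y] bexI[of _ "- Z"]) (auto simp: mat_uminus_uminus)
  next
    fix m Y Z assume Y: "Y \<in> carrier_mat h m" "Z \<in> carrier_mat q m" "W * Y + - A' * Z = 0\<^sub>m n m"
    then have "W * Y + A' * - Z = 0\<^sub>m n m" using A by simp
    from ind[OF Y(1) _ this] show "Y = 0\<^sub>m h m" using Y(2) by simp
  qed (use A W in auto)
qed

lemma exact_complexI:
  assumes "\<And>i. D i \<in> mats V (B i) (B (Suc i))"
    and "\<And>i m W. W \<in> mats V (B (Suc (Suc i))) m \<Longrightarrow> D i * (D (Suc i) * W) = 0\<^sub>m (B i) m"
    and "\<And>i m X. X \<in> mats V (B (Suc i)) m \<Longrightarrow> D i * X = 0\<^sub>m (B i) m \<Longrightarrow>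
      \<exists>Y \<in> mats V (B (Suc (Suc i))) m. X = D (Suc i) * Y"
  shows "exact_complex V B D"
  unfolding exact_complex_def
proof (intro conjI allI ballI impI assms)
  fix i
  have "D (Suc i) * 1\<^sub>m (B (Suc (Suc i))) = D (Suc i)"
    by (rule right_mult_one_mat[OF matsD[OF assms(1)]])
  then show "D i * D (Suc i) = 0\<^sub>m (B i) (B (Suc (Suc i)))"
    using assms(2)[OF mats_1, of i] by simp
qed

lemma exact_block_diag:
  assumes F: "exact_complex V BF DF" and G: "exact_complex V BG DG"
  shows "exact_complex V (\<lambda>i. BF i + BG i) (\<lambda>i. block_diag (DF i) (DG i))"
proof (rule exact_complexI)
  note Fc = exact_carrier[OF F] and Gc = exact_carrier[OF G]
    and Fm = exact_mats[OF F] and Gm = exact_mats[OF G]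
  fix i
  show "block_diag (DF i) (DG i) \<in> mats V (BF i + BG i) (BF (Suc i) + BG (Suc i))"
    using carrier_matD[OF Fc[of i]] carrier_matD[OF Gc[of i]] unfolding block_diag_def
    by (simp only:) (intro mats_four_block Fm Gm mats_0)
  fix m
  show "block_diag (DF i) (DG i) * (block_diag (DF (Suc i)) (DG (Suc i)) * W) = 0\<^sub>m (BF i + BG i) m"
    if W0: "W \<in> mats V (BF (Suc (Suc i)) + BG (Suc (Suc i))) m" for W
  proof -
    obtain X Y where X: "X \<in> mats V (BF (Suc (Suc i))) m" and Y: "Y \<in> mats V (BG (Suc (Suc i))) m"
      and W: "W = X @\<^sub>r Y" using W0 by (rule mats_append_rows_cases)
    note Xc = matsD[OF X] and Yc = matsD[OF Y]
    show ?thesis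
      unfolding W block_diag_mult_append_rows[OF Fc Gc Xc Yc]
        block_diag_mult_append_rows[OF Fc Gc mult_carrier_mat[OF Fc Xc] mult_carrier_mat[OF Gc Yc]]
        exact_square_mult[OF F Xc] exact_square_mult[OF G Yc] zero_append_rows ..
  qed
  show "\<exists>Y \<in> mats V (BF (Suc (Suc i)) + BG (Suc (Suc i))) m. W = block_diag (DF (Suc i)) (DG (Suc i)) * Y"
    if W0: "W \<in> mats V (BF (Suc i) + BG (Suc i)) m" and DW: "block_diag (DF i) (DG i) * W = 0\<^sub>m (BF i + BG i) m" for W
  proof -
    obtain X Y where X: "X \<in> mats V (BF (Suc i)) m" and Y: "Y \<in> mats V (BG (Suc i)) m"
      and W: "W = X @\<^sub>r Y" using W0 by (rule mats_append_rows_cases)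
    note Xc = matsD[OF X] and Yc = matsD[OF Y]
    have "DF i * X = 0\<^sub>m (BF i) m \<and> DG i * Y = 0\<^sub>m (BG i) m"
      using DW unfolding W block_diag_mult_append_rows[OF Fc Gc Xc Yc] zero_append_rows
        append_rows_eq_iff[OF mult_carrier_mat[OF Fc Xc] mult_carrier_mat[OF Gc Yc] zero_carrier_mat zero_carrier_mat] .
    then obtain X' Y' where X': "X' \<in> mats V (BF (Suc (Suc i))) m" "X = DF (Suc i) * X'"
      and Y': "Y' \<in> mats V (BG (Suc (Suc i))) m" "Y = DG (Suc i) * Y'"
      using exact_lift[OF F X] exact_lift[OF G Y] by metis
    have "W = block_diag (DF (Suc i)) (DG (Suc i)) * (X' @\<^sub>r Y')"
      unfolding W X'(2) Y'(2)
      by (rule block_diag_mult_append_rows[symmetric, OF Fc Gc matsD[OF X'(1)] matsD[OF Y'(1)]])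
    then show ?thesis using mats_append_rows[OF X'(1) Y'(1)] by blast
  qed
qed

lemma const_mat_block_diag: "const_mat (block_diag A B) = block_diag (const_mat A) (const_mat B)"
  by (rule eq_matI) (auto simp: block_diag_def const_coeff_def)

lemma block_diag_empty_rows: "block_diag (0\<^sub>m 0 n) (0\<^sub>m 0 m) = 0\<^sub>m 0 (n + m)"
  by (rule eq_matI) (auto simp: block_diag_def)

lemma tor_rank_block_diag:
  assumes F: "exact_complex V BF DF" and G: "exact_complex V BG DG"
    and h: "tor_rank BF DF i h" and l: "tor_rank BG DG i l"
  shows "tor_rank (\<lambda>i. BF i + BG i) (\<lambda>i. block_diag (DF i) (DG i)) i (h + l)"
proof -
  have "tor_diff (\<lambda>i. BF i + BG i) (\<lambda>i. block_diag (DF i) (DG i)) j =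
      block_diag (tor_diff BF DF j) (tor_diff BG DG j)" for j
    by (cases j) (simp_all only: tensor_diff_simps const_mat_block_diag block_diag_empty_rows)
  then show ?thesis
    using homology_rank_block_diag[OF tensor_diff_carrier[OF F] tensor_diff_carrier_Suc[OF F]
        tensor_diff_carrier[OF G] tensor_diff_carrier_Suc[OF G]] h l
    unfolding tor_rank_def by simp
qed

text \<open>The mapping cone of a chain map \<open>\<phi>\<close> from \<open>(B', D')\<close> to \<open>(B, D)\<close> covering an injective map of the
  resolved modules. The module resolved by the cone is the cokernel, embedded in a free module of
  rank \<open>c\<close>, and \<open>Z\<close> is its augmentation. The cone uses both complexes without their augmentations,
  which is why the term of index \<open>0\<close> of the primed complex is replaced by the zero module.\<close>

definition cone_rank :: "nat \<Rightarrow> (nat \<Rightarrow> nat) \<Rightarrow> (nat \<Rightarrow> nat) \<Rightarrow> nat \<Rightarrow> nat" where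
  "cone_rank c B B' i = (case i of 0 \<Rightarrow> c | Suc j \<Rightarrow> B (Suc j) + tor_target B' j)"

definition truncated_diff :: "(nat \<Rightarrow> nat) \<Rightarrow> (nat \<Rightarrow> 'a::comm_ring_1 mat) \<Rightarrow> nat \<Rightarrow> 'a mat" where
  "truncated_diff B' D' i = (if i = 0 then 0\<^sub>m 0 (B' 1) else D' i)"

definition cone_diff ::
    "'a::comm_ring_1 mat \<Rightarrow> (nat \<Rightarrow> nat) \<Rightarrow> (nat \<Rightarrow> 'a mat) \<Rightarrow> (nat \<Rightarrow> nat) \<Rightarrow> (nat \<Rightarrow> 'a mat) \<Rightarrow> (nat \<Rightarrow> 'a mat) \<Rightarrow>
      nat \<Rightarrow> 'a mat" where
  "cone_diff Z B D B' D' \<phi> i =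
     (case i of 0 \<Rightarrow> Z
      | Suc j \<Rightarrow> four_block_mat (D (Suc j)) (\<phi> (Suc j))
          (0\<^sub>m (tor_target B' j) (B (Suc (Suc j)))) (- truncated_diff B' D' j))"

lemma append_rows_empty: "A \<in> carrier_mat n m \<Longrightarrow> B \<in> carrier_mat 0 m \<Longrightarrow> A @\<^sub>r B = A"
  by (rule eq_matI) (auto simp: append_rows_def)

lemma mat_add_uminus_self:
  fixes A :: "'a::ab_group_add mat"
  shows "A \<in> carrier_mat n m \<Longrightarrow> A + - A = 0\<^sub>m n m"
  by auto

lemma mat_add_eq_zero_iff:
  fixes A :: "'a::ab_group_add mat"
  assumes "A \<in> carrier_mat n m" "B \<in> carrier_mat n m"
  shows "A + B = 0\<^sub>m n m \<longleftrightarrow> A = - B"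
proof
  assume "A + B = 0\<^sub>m n m"
  then have "A = 0\<^sub>m n m - B" using mat_add_eq_imp_diff[OF _ assms] by metis
  also have "\<dots> = - B" using assms by auto
  finally show "A = - B" .
qed (use assms in auto)

text \<open>The four conditions on the augmentations say that \<open>Z\<close> vanishes on the boundaries of the cone, that
  every element killed by \<open>Z\<close> is mapped by \<open>D 0\<close> into the image of \<open>\<phi> 0\<close>, and that \<open>\<phi> 0\<close> is
  injective on the image of \<open>D' 0\<close>. They express the exactness of
  \<open>0 \<rightarrow> im (D' 0) \<rightarrow> im (D 0) \<rightarrow> im Z \<rightarrow> 0\<close>. Exactness of the cone then follows by lifting first in
  the primed and then in the unprimed complex.\<close>

lemma exact_cone:
  fixes D :: "nat \<Rightarrow> ('v, 'k::comm_ring_1) mpoly mat"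
  assumes K: "exact_complex V B D" and H: "exact_complex V B' D'" and \<phi>: "chain_map V B' D' B D \<phi>"
    and Z: "Z \<in> mats V c (B 1)"
    and ZD: "\<And>m X. X \<in> mats V (B 2) m \<Longrightarrow> Z * (D 1 * X) = 0\<^sub>m c m"
    and Z\<phi>: "\<And>m Y. Y \<in> mats V (B' 1) m \<Longrightarrow> Z * (\<phi> 1 * Y) = 0\<^sub>m c m"
    and ker: "\<And>m X. X \<in> mats V (B 1) m \<Longrightarrow> Z * X = 0\<^sub>m c m \<Longrightarrow>
      \<exists>Y \<in> mats V (B' 1) m. D 0 * X = \<phi> 0 * (D' 0 * Y)"
    and inj: "\<And>m Y. Y \<in> mats V (B' 1) m \<Longrightarrow> \<phi> 0 * (D' 0 * Y) = 0\<^sub>m (B 0) m \<Longrightarrow> D' 0 * Y = 0\<^sub>m (B' 0) m"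
  shows "exact_complex V (cone_rank c B B') (cone_diff Z B D B' D' \<phi>)"
proof -
  let ?C = "cone_rank c B B'" and ?E = "cone_diff Z B D B' D' \<phi>" and ?t = "truncated_diff B' D'"
  note Kc = exact_carrier[OF K] and Km = exact_mats[OF K]
    and Hc = exact_carrier[OF H] and Hm = exact_mats[OF H]
    and \<phi>m = chain_mapD(1)[OF \<phi>] and \<phi>c = chain_mapD(2)[OF \<phi>]
    and Zc = matsD[OF Z]
  have C: "?C 0 = c" "\<And>i. ?C (Suc i) = B (Suc i) + tor_target B' i" by (simp_all add: cone_rank_def)
  have C1: "?C (Suc 0) = B 1" by (simp add: C tor_target_def)
  have C2: "?C (Suc (Suc i)) = B (Suc (Suc i)) + B' (Suc i)" for i by (simp add: C tor_target_def)
  have E0: "?E 0 = Z" by (simp add: cone_diff_def)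
  have t0: "?t 0 = 0\<^sub>m 0 (B' 1)" "?t (Suc i) = D' (Suc i)" for i by (simp_all add: truncated_diff_def)
  have tm: "?t i \<in> mats V (tor_target B' i) (B' (Suc i))" for i
    by (cases i) (simp_all add: t0 tor_target_def mats_0 Hm)
  note tc = matsD[OF tm]
  have E: "?E i \<in> mats V (?C i) (?C (Suc i))" for i
  proof (cases i)
    case 0 then show ?thesis using Z by (simp add: E0 C1 C(1))
  next
    case (Suc j)
    then show ?thesis
      unfolding Suc C2 C(2)[of j] by (simp add: cone_diff_def)
        (intro mats_four_block Km \<phi>m mats_0 mats_uminus tm)
  qed
  have act: "?E (Suc i) * (X @\<^sub>r Y) = (D (Suc i) * X + \<phi> (Suc i) * Y) @\<^sub>r (- (?t i * Y))"
    if X: "X \<in> carrier_mat (B (Suc (Suc i))) m" and Y: "Y \<in> carrier_mat (B' (Suc i)) m" for X Y i m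
  proof -
    have "?E (Suc i) * (X @\<^sub>r Y) = (D (Suc i) * X + \<phi> (Suc i) * Y) @\<^sub>r
        (0\<^sub>m (tor_target B' i) (B (Suc (Suc i))) * X + (- ?t i) * Y)"
      unfolding cone_diff_def nat.case
      by (rule four_block_mult_append_rows[OF Kc \<phi>c zero_carrier_mat uminus_carrier_mat[OF tc] X Y])
    then show ?thesis using X Y tc[of i] by simp
  qed
  have act0: "?E (Suc 0) * (X @\<^sub>r Y) = D 1 * X + \<phi> 1 * Y"
    if X: "X \<in> carrier_mat (B 2) m" and Y: "Y \<in> carrier_mat (B' 1) m" for X Y m
  proof -
    have "D 1 * X + \<phi> 1 * Y \<in> carrier_mat (B 1) m" using \<phi>c[of 1] Y by simp
    moreover have "- (?t 0 * Y) \<in> carrier_mat 0 m" using Y by (simp add: t0)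
    ultimately have "(D 1 * X + \<phi> 1 * Y) @\<^sub>r (- (?t 0 * Y)) = D 1 * X + \<phi> 1 * Y" by (rule append_rows_empty)
    then show ?thesis using act[of X 0 m Y] X Y by (simp add: numeral_2_eq_2)
  qed
  have comm: "\<phi> i * (D' i * Y) = D i * (\<phi> (Suc i) * Y)" if Y: "Y \<in> carrier_mat (B' (Suc i)) m" for i Y m
    using assoc_mult_mat[OF \<phi>c Hc Y] assoc_mult_mat[OF Kc \<phi>c Y] chain_mapD(3)[OF \<phi>, of i] by simp
  show ?thesis
  proof (rule exact_complexI)
    show "?E i \<in> mats V (?C i) (?C (Suc i))" for i by (rule E)
  next
    fix i m and W :: "('v, 'k) mpoly mat" assume W0: "W \<in> mats V (?C (Suc (Suc i))) m"
    then obtain X Y where X: "X \<in> mats V (B (Suc (Suc i))) m" and Y: "Y \<in> mats V (B' (Suc i)) m"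
      and W: "W = X @\<^sub>r Y" unfolding C2 by (rule mats_append_rows_cases)
    note Xc = matsD[OF X] and Yc = matsD[OF Y]
    show "?E i * (?E (Suc i) * W) = 0\<^sub>m (?C i) m"
    proof (cases i)
      case 0
      have X': "X \<in> mats V (B 2) m" and Y': "Y \<in> mats V (B' 1) m" using X Y 0 by (simp_all add: numeral_2_eq_2)
      note X'c = matsD[OF X'] and Y'c = matsD[OF Y']
      have "Z * (D 1 * X + \<phi> 1 * Y) = Z * (D 1 * X) + Z * (\<phi> 1 * Y)"
        using Kc[of 1] \<phi>c[of 1] X'c Y'c by (intro mult_add_distrib_mat[OF Zc]) (auto simp: numeral_2_eq_2)
      then show ?thesis
        unfolding 0 E0 C(1) W act0[OF X'c Y'c] using ZD[OF X'] Z\<phi>[OF Y'] by simp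
    next
      case (Suc j)
      have "D (Suc j) * (D (Suc i) * X + \<phi> (Suc i) * Y) + \<phi> (Suc j) * (- (D' i * Y)) = 0\<^sub>m (B (Suc j)) m"
      proof -
        have "D i * (D (Suc i) * X + \<phi> (Suc i) * Y) = D i * (D (Suc i) * X) + D i * (\<phi> (Suc i) * Y)"
          by (rule mult_add_distrib_mat[OF Kc mult_carrier_mat[OF Kc Xc] mult_carrier_mat[OF \<phi>c Yc]])
        also have "\<dots> = \<phi> i * (D' i * Y)"
          using exact_square_mult[OF K Xc] comm[OF Yc] mult_carrier_mat[OF Kc mult_carrier_mat[OF \<phi>c Yc]] by simp
        finally show ?thesis
          unfolding Suc[symmetric]
          using mat_add_uminus_self[OF mult_carrier_mat[OF \<phi>c mult_carrier_mat[OF Hc Yc]]]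
            \<phi>c[of i] Hc[of i] Yc by simp
      qed
      moreover have "?t j * (- (D' i * Y)) = 0\<^sub>m (tor_target B' j) m"
      proof (cases j)
        case 0 then show ?thesis using Yc by (auto simp: t0 tor_target_def)
      next
        case (Suc l)
        have "D' j * (D' i * Y) = 0\<^sub>m (B' j) m" using exact_square_mult[OF H, where Y=Y and i=j and m=m] Yc \<open>i = Suc j\<close> by simp
        then show ?thesis using Hc[of j] Hc[of i] Yc Suc \<open>i = Suc j\<close> by (simp add: t0 tor_target_def mat_uminus_zero)
      qed
      moreover have "?E (Suc i) * W = (D (Suc i) * X + \<phi> (Suc i) * Y) @\<^sub>r (- (D' i * Y))"
        using act[OF Xc Yc] by (simp add: W Suc t0)
      moreover have "D (Suc i) * X + \<phi> (Suc i) * Y \<in> carrier_mat (B (Suc (Suc j))) m"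
        "- (D' i * Y) \<in> carrier_mat (B' (Suc j)) m"
        using Kc[of "Suc i"] \<phi>c[of "Suc i"] Hc[of i] Xc Yc Suc by auto
      ultimately show ?thesis
        unfolding Suc by (simp add: act[where i=j] C(2) zero_append_rows mat_uminus_zero)
    qed
  next
    fix i m and W :: "('v, 'k) mpoly mat" assume W0: "W \<in> mats V (?C (Suc i)) m" and EW: "?E i * W = 0\<^sub>m (?C i) m"
    show "\<exists>Y \<in> mats V (?C (Suc (Suc i))) m. W = ?E (Suc i) * Y"
    proof (cases i)
      case 0
      have W: "W \<in> mats V (B 1) m" using W0 by (simp add: 0 C1)
      note Wc = matsD[OF W]
      have "Z * W = 0\<^sub>m c m" using EW by (simp add: 0 E0 C)
      then obtain Y where Y: "Y \<in> mats V (B' 1) m" "D 0 * W = \<phi> 0 * (D' 0 * Y)" using ker[OF W] by blast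
      have Y': "Y \<in> carrier_mat (B' (Suc 0)) m" using matsD[OF Y(1)] by simp
      have W': "W \<in> mats V (B (Suc 0)) m" using W by simp
      have dm: "W - \<phi> (Suc 0) * Y \<in> mats V (B (Suc 0)) m"
        by (rule mats_diff[OF W' mats_mult[OF \<phi>m]]) (use Y in simp)
      have eq: "D 0 * W = D 0 * (\<phi> (Suc 0) * Y)" using Y(2) comm[OF Y'] by simp
      have "D 0 * (W - \<phi> (Suc 0) * Y) = 0\<^sub>m (B 0) m"
        unfolding mult_minus_distrib_mat[OF Kc matsD[OF W'] mult_carrier_mat[OF \<phi>c Y']] eq
        by (rule mat_diff_self[OF mult_carrier_mat[OF Kc mult_carrier_mat[OF \<phi>c Y']]])
      then obtain U where U: "U \<in> mats V (B (Suc (Suc 0))) m" "W - \<phi> (Suc 0) * Y = D (Suc 0) * U"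
        using exact_lift[OF K dm] by blast
      have "W = D (Suc 0) * U + \<phi> (Suc 0) * Y"
        by (rule mat_diff_eq_imp_add[OF U(2) matsD[OF W'] mult_carrier_mat[OF \<phi>c Y']])
      then have "W = ?E (Suc 0) * (U @\<^sub>r Y)"
        using act0[of U m Y] matsD[OF U(1)] Y' by (simp add: numeral_2_eq_2)
      moreover have "U @\<^sub>r Y \<in> mats V (?C (Suc (Suc 0))) m"
        unfolding C2 by (rule mats_append_rows[OF U(1)]) (use Y in simp)
      ultimately show ?thesis unfolding 0 by blast
    next
      case (Suc j)
      from W0 obtain X Y where X: "X \<in> mats V (B (Suc (Suc j))) m" and Y: "Y \<in> mats V (B' (Suc j)) m"
        and W: "W = X @\<^sub>r Y" unfolding Suc C2 by (rule mats_append_rows_cases)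
      note Xc = matsD[OF X] and Yc = matsD[OF Y]
      have c1: "D (Suc j) * X + \<phi> (Suc j) * Y \<in> carrier_mat (B (Suc j)) m"
        by (rule add_carrier_mat[OF mult_carrier_mat[OF \<phi>c Yc]])
      have "(D (Suc j) * X + \<phi> (Suc j) * Y) @\<^sub>r (- (?t j * Y)) = 0\<^sub>m (B (Suc j)) m @\<^sub>r 0\<^sub>m (tor_target B' j) m"
        using EW unfolding Suc W act[OF Xc Yc] C(2) zero_append_rows .
      then have e: "D (Suc j) * X + \<phi> (Suc j) * Y = 0\<^sub>m (B (Suc j)) m" "- (?t j * Y) = 0\<^sub>m (tor_target B' j) m"
        using append_rows_eq_iff[OF c1 uminus_carrier_mat[OF mult_carrier_mat[OF tc Yc]] zero_carrier_mat zero_carrier_mat]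
        by blast+
      \<comment> \<open>The lower block gives this only for \<open>j > 0\<close>, since the cone does not contain the
        augmentation \<open>D' 0\<close>. For \<open>j = 0\<close> it follows from the injectivity of \<open>\<phi> 0\<close>.\<close>
      have "D' j * Y = 0\<^sub>m (B' j) m"
      proof (cases j)
        case 0
        have e': "D (Suc 0) * X = - (\<phi> (Suc 0) * Y)"
          using e(1) mat_add_eq_zero_iff[OF mult_carrier_mat[OF Kc Xc] mult_carrier_mat[OF \<phi>c Yc]] 0 by simp
        have Y0: "Y \<in> mats V (B' 1) m" using Y 0 by simp
        have "\<phi> 0 * (D' 0 * Y) = D 0 * (\<phi> (Suc 0) * Y)" by (rule comm) (use Yc 0 in simp)
        also have "\<phi> (Suc 0) * Y = - (D (Suc 0) * X)" unfolding e' by (simp add: mat_uminus_uminus)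
        also have "D 0 * - (D (Suc 0) * X) = 0\<^sub>m (B 0) m"
          using exact_square_mult[OF K, of X 0 m] Xc 0 Kc[of 0] Kc[of "Suc 0"] by (simp add: mat_uminus_zero)
        finally show ?thesis using inj[OF Y0] 0 by simp
      next
        case (Suc l)
        then have "- (D' j * Y) = 0\<^sub>m (B' j) m" using e(2) by (simp add: t0 tor_target_def)
        from arg_cong[OF this, of uminus] show ?thesis by (simp add: mat_uminus_uminus mat_uminus_zero)
      qed
      then obtain Y0 where Y0: "Y0 \<in> mats V (B' (Suc (Suc j))) m" "Y = D' (Suc j) * Y0"
        using exact_lift[OF H Y] by blast
      note Y0c = matsD[OF Y0(1)]
      have "\<phi> (Suc j) * Y = D (Suc j) * (\<phi> (Suc (Suc j)) * Y0)" unfolding Y0(2) by (rule comm[OF Y0c])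
      then have "D (Suc j) * (X + \<phi> (Suc (Suc j)) * Y0) = 0\<^sub>m (B (Suc j)) m"
        using e(1) mult_add_distrib_mat[OF Kc Xc mult_carrier_mat[OF \<phi>c Y0c]] by simp
      then obtain U where U: "U \<in> mats V (B (Suc (Suc (Suc j)))) m" "X + \<phi> (Suc (Suc j)) * Y0 = D (Suc (Suc j)) * U"
        using exact_lift[OF K mats_add[OF X mats_mult[OF \<phi>m Y0(1)]]] by blast
      have "X = D (Suc (Suc j)) * U - \<phi> (Suc (Suc j)) * Y0"
        by (rule mat_add_eq_imp_diff[OF U(2)[symmetric] Xc mult_carrier_mat[OF \<phi>c Y0c]])
      also have "\<dots> = D (Suc (Suc j)) * U + \<phi> (Suc (Suc j)) * - Y0"
        using Kc[of "Suc (Suc j)"] \<phi>c[of "Suc (Suc j)"] matsD[OF U(1)] Y0c by auto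
      finally have "X = D (Suc (Suc j)) * U + \<phi> (Suc (Suc j)) * - Y0" .
      moreover have "- (?t (Suc j) * - Y0) = Y"
        using Y0c Hc[of "Suc j"] by (simp add: t0 Y0(2) mat_uminus_uminus)
      ultimately have "W = ?E (Suc (Suc j)) * (U @\<^sub>r - Y0)"
        unfolding W using act[OF matsD[OF U(1)] uminus_carrier_mat[OF Y0c]] by simp
      moreover have "U @\<^sub>r - Y0 \<in> mats V (?C (Suc (Suc (Suc j)))) m"
        unfolding C2 by (rule mats_append_rows[OF U(1) mats_uminus[OF Y0(1)]])
      ultimately show ?thesis unfolding Suc by blast
    qed
  qed
qed

lemma index_smult_add_smult:
  fixes X :: "'a::comm_ring_1 mat"
  assumes "X \<in> carrier_mat n m" "Y \<in> carrier_mat n m" "i < n" "j < m"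
  shows "(a \<cdot>\<^sub>m X + b \<cdot>\<^sub>m Y) $$ (i,j) = a * X $$ (i,j) + b * Y $$ (i,j)"
  using assms by simp

lemma const_coeff_uminus: "const_coeff (- p) = - const_coeff p"
  by (simp add: const_coeff_def)

lemma const_mat_append_rows:
  "A \<in> carrier_mat a m \<Longrightarrow> B \<in> carrier_mat b m \<Longrightarrow> const_mat (A @\<^sub>r B) = const_mat A @\<^sub>r const_mat B"
  by (rule eq_matI) (auto simp: append_rows_def const_coeff_def)

lemma resolves_lift_row:
  assumes D: "resolves V M B D" and r: "\<And>j. j < m \<Longrightarrow> r j \<in> M"
  obtains Y where "Y \<in> mats V (B 1) m" "mat 1 m (\<lambda>(i,j). r j) = D 0 * Y"
proof -
  have "mat 1 m (\<lambda>(i,j). r j) \<in> mats V 1 m"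
    using r resolvesD(3)[OF D] by (auto simp: mats_def)
  then show thesis by (rule resolves_lift[OF D]) (use r that in auto)
qed

text \<open>If \<open>\<phi>\<close> has no constant coefficients, then the off-diagonal block of the cone disappears after
  tensoring with \<open>K\<close>. The complex becomes a direct sum, in which the second summand is shifted by
  one degree.\<close>

lemma tor_rank_cone:
  fixes D :: "nat \<Rightarrow> ('v, 'k::field) mpoly mat"
  assumes K: "exact_complex V B D" and H: "exact_complex V B' D'" and \<phi>: "chain_map V B' D' B D \<phi>"
    and const: "\<And>i. const_mat (\<phi> i) = 0\<^sub>m (B i) (B' i)"
    and h: "tor_rank B D i h" and l: "if i = 0 then l = 0 else tor_rank B' D' (i - 1) l"
  shows "tor_rank (cone_rank c B B') (cone_diff Z B D B' D' \<phi>) i (h + l)"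
proof -
  let ?TC = "tor_diff (cone_rank c B B') (cone_diff Z B D B' D' \<phi>)"
  let ?TK = "tor_diff B D" and ?TH = "tor_diff B' D'"
  have TC0: "?TC 0 = block_diag (?TK 0) (0\<^sub>m 0 0)"
    unfolding tensor_diff_simps block_diag_empty_rows by (simp add: cone_rank_def tor_target_def)
  have TCS: "?TC (Suc j) = block_diag (?TK (Suc j)) (- ?TH j)" for j
  proof -
    have t: "const_mat (truncated_diff B' D' j) = ?TH j"
      by (cases j) (simp_all add: truncated_diff_def tensor_diff_def const_mat_zero)
    have tc: "?TH j \<in> carrier_mat (tor_target B' j) (B' (Suc j))" by (rule tensor_diff_carrier[OF H])
    have tc': "truncated_diff B' D' j \<in> carrier_mat (tor_target B' j) (B' (Suc j))"
      using exact_carrier[OF H, of j] by (cases j) (simp_all add: truncated_diff_def tor_target_def)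
    have "?TC (Suc j) = const_mat (four_block_mat (D (Suc j)) (\<phi> (Suc j))
          (0\<^sub>m (tor_target B' j) (B (Suc (Suc j)))) (- truncated_diff B' D' j))"
      unfolding tensor_diff_simps by (simp add: cone_diff_def)
    also have "\<dots> = four_block_mat (const_mat (D (Suc j))) (const_mat (\<phi> (Suc j)))
          (0\<^sub>m (tor_target B' j) (B (Suc (Suc j)))) (const_mat (- truncated_diff B' D' j))"
      using exact_carrier[OF K, of "Suc j"] chain_mapD(2)[OF \<phi>, of "Suc j"] tc'
      by (intro eq_matI) (auto simp: four_block_mat_def Let_def const_coeff_def)
    also have "const_mat (- truncated_diff B' D' j) = - ?TH j"
      unfolding t[symmetric] by (rule eq_matI) (auto simp: const_coeff_def)
    finally have eq: "?TC (Suc j) = four_block_mat (const_mat (D (Suc j))) (const_mat (\<phi> (Suc j)))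
          (0\<^sub>m (tor_target B' j) (B (Suc (Suc j)))) (- ?TH j)" .
    show ?thesis
      unfolding eq using exact_carrier[OF K, of "Suc j"] tc
      by (simp add: block_diag_def const tensor_diff_simps del: o_apply)
  qed
  note TKc = tensor_diff_carrier[OF K] tensor_diff_carrier_Suc[OF K]
    and THc = tensor_diff_carrier[OF H] tensor_diff_carrier_Suc[OF H]
  show ?thesis
  proof (cases i)
    case 0
    \<comment> \<open>In degree \<open>0\<close> the shifted summand is the zero space, which keeps the two cases uniform.\<close>
    have e: "homology_rank (0\<^sub>m 0 0) (- ?TH 0) 0"
    proof (rule homology_rankI[of _ 0 0 _ "B' 1" "0\<^sub>m 0 0"])
      show "\<exists>Y \<in> carrier_mat 0 m. \<exists>Z \<in> carrier_mat (B' 1) m. X = 0\<^sub>m 0 0 * Y + - ?TH 0 * Z"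
        if "X \<in> carrier_mat 0 m" for m X
        using that by (intro bexI[of _ "0\<^sub>m 0 m"] bexI[of _ "0\<^sub>m (B' 1) m"] eq_matI) (auto simp: tensor_diff_def)
    qed (auto simp: tensor_diff_def)
    have "homology_rank (block_diag (?TK 0) (0\<^sub>m 0 0)) (block_diag (?TK (Suc 0)) (- ?TH 0)) (h + 0)"
      by (rule homology_rank_block_diag[OF TKc zero_carrier_mat _ _ e])
        (use h THc(1)[of 0] in \<open>auto simp: 0 tor_rank_def tor_target_def\<close>)
    then show ?thesis unfolding tor_rank_def 0 TC0 TCS using l 0 by simp
  next
    case (Suc j)
    have "homology_rank (- ?TH j) (- ?TH (Suc j)) l"
      by (rule homology_rank_uminus[OF THc]) (use l Suc in \<open>simp add: tor_rank_def\<close>)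
    from homology_rank_block_diag[OF TKc uminus_carrier_mat[OF THc(1)] uminus_carrier_mat[OF THc(2)] _ this, of "Suc j" h]
    show ?thesis unfolding tor_rank_def Suc TCS using h Suc by (simp add: tor_rank_def)
  qed
qed

text \<open>The cone for the map \<open>r \<mapsto> (b r, - a r)\<close> from \<open>M\<^sub>3\<close> to \<open>M\<^sub>1 \<oplus> M\<^sub>2\<close>, where \<open>M\<^sub>3\<close> is contained in both
  ideals and \<open>\<alpha>\<close> and \<open>\<beta>\<close> lift the two inclusions. It resolves \<open>a M\<^sub>1 + b M\<^sub>2\<close> if the elements of
  \<open>M\<^sub>3\<close> account for all relations \<open>a p + b q = 0\<close>.\<close>

definition sum_cone_rank :: "(nat \<Rightarrow> nat) \<Rightarrow> (nat \<Rightarrow> nat) \<Rightarrow> (nat \<Rightarrow> nat) \<Rightarrow> nat \<Rightarrow> nat" where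
  "sum_cone_rank BF BG BH = cone_rank 1 (\<lambda>i. BF i + BG i) BH"

definition sum_cone_map ::
    "'a::comm_ring_1 \<Rightarrow> 'a \<Rightarrow> (nat \<Rightarrow> 'a mat) \<Rightarrow> (nat \<Rightarrow> 'a mat) \<Rightarrow> nat \<Rightarrow> 'a mat" where
  "sum_cone_map a b \<alpha> \<beta> i = (b \<cdot>\<^sub>m \<alpha> i) @\<^sub>r (- a \<cdot>\<^sub>m \<beta> i)"

definition sum_cone_diff ::
    "'a::comm_ring_1 \<Rightarrow> 'a \<Rightarrow> (nat \<Rightarrow> nat) \<Rightarrow> (nat \<Rightarrow> 'a mat) \<Rightarrow> (nat \<Rightarrow> nat) \<Rightarrow> (nat \<Rightarrow> 'a mat) \<Rightarrow>
      (nat \<Rightarrow> nat) \<Rightarrow> (nat \<Rightarrow> 'a mat) \<Rightarrow> (nat \<Rightarrow> 'a mat) \<Rightarrow> (nat \<Rightarrow> 'a mat) \<Rightarrow> nat \<Rightarrow> 'a mat" where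
  "sum_cone_diff a b BF DF BG DG BH DH \<alpha> \<beta> =
     cone_diff (append_cols (a \<cdot>\<^sub>m DF 0) (b \<cdot>\<^sub>m DG 0)) (\<lambda>i. BF i + BG i) (\<lambda>i. block_diag (DF i) (DG i))
       BH DH (sum_cone_map a b \<alpha> \<beta>)"

lemma chain_map_sum_cone_map:
  assumes F: "exact_complex V BF DF" and G: "exact_complex V BG DG" and H: "exact_complex V BH DH"
    and \<alpha>: "chain_map V BH DH BF DF \<alpha>" and \<beta>: "chain_map V BH DH BG DG \<beta>"
    and ab: "a \<in> poly_ring V" "b \<in> poly_ring V"
  shows "chain_map V BH DH (\<lambda>i. BF i + BG i) (\<lambda>i. block_diag (DF i) (DG i)) (sum_cone_map a b \<alpha> \<beta>)"
  unfolding chain_map_def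
proof (intro conjI allI)
  fix i
  note Fc = exact_carrier[OF F] and Gc = exact_carrier[OF G] and Hc = exact_carrier[OF H]
    and \<alpha>c = chain_mapD(2)[OF \<alpha>] and \<beta>c = chain_mapD(2)[OF \<beta>]
  show "sum_cone_map a b \<alpha> \<beta> i \<in> mats V (BF i + BG i) (BH i)"
    unfolding sum_cone_map_def
    by (intro mats_append_rows mats_smult poly_ring_uminus ab chain_mapD(1)[OF \<alpha>] chain_mapD(1)[OF \<beta>])
  have "sum_cone_map a b \<alpha> \<beta> i * DH i = (b \<cdot>\<^sub>m (\<alpha> i * DH i)) @\<^sub>r (- a \<cdot>\<^sub>m (\<beta> i * DH i))"
    unfolding sum_cone_map_def append_rows_mult[OF smult_carrier_mat[OF \<alpha>c] smult_carrier_mat[OF \<beta>c] Hc]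
      mult_smult_assoc_mat[OF \<alpha>c Hc] mult_smult_assoc_mat[OF \<beta>c Hc] ..
  also have "\<dots> = block_diag (DF i) (DG i) * sum_cone_map a b \<alpha> \<beta> (Suc i)"
    unfolding sum_cone_map_def chain_mapD(3)[OF \<alpha>] chain_mapD(3)[OF \<beta>]
      block_diag_mult_append_rows[OF Fc Gc smult_carrier_mat[OF \<alpha>c] smult_carrier_mat[OF \<beta>c]]
      mult_smult_distrib[OF Fc \<alpha>c] mult_smult_distrib[OF Gc \<beta>c] ..
  finally show "sum_cone_map a b \<alpha> \<beta> i * DH i = block_diag (DF i) (DG i) * sum_cone_map a b \<alpha> \<beta> (Suc i)" .
qed

text \<open>The assumption \<open>syzygy\<close> identifies the kernel of \<open>(p, q) \<mapsto> a p + b q\<close> with \<open>M3\<close>, and \<open>regular\<close>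
  makes the map from \<open>M3\<close> to the direct sum injective. These are the conditions of \<open>exact_cone\<close>.\<close>

theorem resolves_sum_cone:
  fixes DF DG DH :: "nat \<Rightarrow> ('v, 'k::comm_ring_1) mpoly mat"
  assumes F: "resolves V M1 BF DF" and G: "resolves V M2 BG DG" and H: "resolves V M3 BH DH"
    and \<alpha>: "chain_map V BH DH BF DF \<alpha>" "\<alpha> 0 = 1\<^sub>m 1" and \<beta>: "chain_map V BH DH BG DG \<beta>" "\<beta> 0 = 1\<^sub>m 1"
    and ab: "a \<in> poly_ring V" "b \<in> poly_ring V"
    and syzygy: "\<And>p q. p \<in> M1 \<Longrightarrow> q \<in> M2 \<Longrightarrow> a * p + b * q = 0 \<Longrightarrow> \<exists>r \<in> M3. p = b * r \<and> q = - a * r"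
    and regular: "\<And>r. b * r = 0 \<Longrightarrow> r = 0"
  shows "resolves V {a * p + b * q | p q. p \<in> M1 \<and> q \<in> M2}
    (sum_cone_rank BF BG BH) (sum_cone_diff a b BF DF BG DG BH DH \<alpha> \<beta>)"
proof -
  note eF = resolvesD(2)[OF F] and eG = resolvesD(2)[OF G] and eH = resolvesD(2)[OF H]
  note Fc = exact_carrier[OF eF] and Gc = exact_carrier[OF eG] and Hc = exact_carrier[OF eH]
    and \<alpha>c = chain_mapD(2)[OF \<alpha>(1)] and \<beta>c = chain_mapD(2)[OF \<beta>(1)]
  note B0 = resolvesD(1)[OF F] resolvesD(1)[OF G] resolvesD(1)[OF H]
  let ?Z = "append_cols (a \<cdot>\<^sub>m DF 0) (b \<cdot>\<^sub>m DG 0)"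
  have F0: "DF 0 \<in> carrier_mat 1 (BF 1)" and G0: "DG 0 \<in> carrier_mat 1 (BG 1)" and H0: "DH 0 \<in> carrier_mat 1 (BH 1)"
    using Fc[of 0] Gc[of 0] Hc[of 0] B0 by simp_all
  have Zm: "?Z \<in> mats V 1 (BF 1 + BG 1)"
    by (intro mats_append_cols mats_smult ab resolvesD(4)[OF F] resolvesD(4)[OF G])
  have Zact: "?Z * (X @\<^sub>r Y) = a \<cdot>\<^sub>m (DF 0 * X) + b \<cdot>\<^sub>m (DG 0 * Y)"
    if "X \<in> carrier_mat (BF 1) m" "Y \<in> carrier_mat (BG 1) m" for X Y m
    unfolding append_cols_mult[OF smult_carrier_mat[OF F0] smult_carrier_mat[OF G0] that]
      mult_smult_assoc_mat[OF F0 that(1)] mult_smult_assoc_mat[OF G0 that(2)] ..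
  have ex: "exact_complex V (sum_cone_rank BF BG BH) (sum_cone_diff a b BF DF BG DG BH DH \<alpha> \<beta>)"
    unfolding sum_cone_rank_def sum_cone_diff_def
  proof (rule exact_cone[OF exact_block_diag[OF eF eG] eH chain_map_sum_cone_map[OF eF eG eH \<alpha>(1) \<beta>(1) ab] Zm])
    fix m and X :: "('v, 'k) mpoly mat" assume "X \<in> mats V (BF 2 + BG 2) m"
    then obtain X1 X2 where X: "X1 \<in> mats V (BF 2) m" "X2 \<in> mats V (BG 2) m" "X = X1 @\<^sub>r X2"
      by (rule mats_append_rows_cases)
    have c: "X1 \<in> carrier_mat (BF (Suc 1)) m" "X2 \<in> carrier_mat (BG (Suc 1)) m"
      using X(1,2)[THEN matsD] by (simp_all add: numeral_2_eq_2)
    have "DF 0 * (DF 1 * X1) = 0\<^sub>m 1 m" "DG 0 * (DG 1 * X2) = 0\<^sub>m 1 m"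
      using exact_square_mult[OF eF, of X1 0 m] exact_square_mult[OF eG, of X2 0 m] c B0 by simp_all
    then show "?Z * (block_diag (DF 1) (DG 1) * X) = 0\<^sub>m 1 m"
      unfolding X(3) block_diag_mult_append_rows[OF Fc Gc c]
        Zact[OF mult_carrier_mat[OF Fc c(1)] mult_carrier_mat[OF Gc c(2)]] by auto
  next
    fix m and Y :: "('v, 'k) mpoly mat" assume Y: "Y \<in> mats V (BH 1) m"
    note Yc = matsD[OF Y]
    have e: "DF 0 * (\<alpha> 1 * Y) = DH 0 * Y" "DG 0 * (\<beta> 1 * Y) = DH 0 * Y"
    proof -
      have "DF 0 * \<alpha> 1 = DH 0" "DG 0 * \<beta> 1 = DH 0"
        using chain_mapD(3)[OF \<alpha>(1), of 0] chain_mapD(3)[OF \<beta>(1), of 0] \<alpha>(2) \<beta>(2) left_mult_one_mat[OF H0] by simp_all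
      then show "DF 0 * (\<alpha> 1 * Y) = DH 0 * Y" "DG 0 * (\<beta> 1 * Y) = DH 0 * Y"
        using assoc_mult_mat[OF F0 \<alpha>c Yc] assoc_mult_mat[OF G0 \<beta>c Yc] by simp_all
    qed
    have "sum_cone_map a b \<alpha> \<beta> 1 * Y = (b \<cdot>\<^sub>m (\<alpha> 1 * Y)) @\<^sub>r (- a \<cdot>\<^sub>m (\<beta> 1 * Y))"
      unfolding sum_cone_map_def append_rows_mult[OF smult_carrier_mat[OF \<alpha>c] smult_carrier_mat[OF \<beta>c] Yc]
        mult_smult_assoc_mat[OF \<alpha>c Yc] mult_smult_assoc_mat[OF \<beta>c Yc] ..
    then have "?Z * (sum_cone_map a b \<alpha> \<beta> 1 * Y) = a \<cdot>\<^sub>m (b \<cdot>\<^sub>m (DH 0 * Y)) + b \<cdot>\<^sub>m (- a \<cdot>\<^sub>m (DH 0 * Y))"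
      by (simp only: Zact[OF smult_carrier_mat[OF mult_carrier_mat[OF \<alpha>c Yc]] smult_carrier_mat[OF mult_carrier_mat[OF \<beta>c Yc]]]
          mult_smult_distrib[OF F0 mult_carrier_mat[OF \<alpha>c Yc]] mult_smult_distrib[OF G0 mult_carrier_mat[OF \<beta>c Yc]] e)
    also have "\<dots> = 0\<^sub>m 1 m" using H0 Yc by (intro eq_matI) (auto simp del: index_mult_mat(1))
    finally show "?Z * (sum_cone_map a b \<alpha> \<beta> 1 * Y) = 0\<^sub>m 1 m" .
  next
    fix m and X :: "('v, 'k) mpoly mat" assume "X \<in> mats V (BF 1 + BG 1) m" and ZX: "?Z * X = 0\<^sub>m 1 m"
    then obtain X1 X2 where X: "X1 \<in> mats V (BF 1) m" "X2 \<in> mats V (BG 1) m" "X = X1 @\<^sub>r X2"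
      using mats_append_rows_cases by blast
    note Xc = X(1,2)[THEN matsD]
    let ?p = "\<lambda>j. (DF 0 * X1) $$ (0,j)" and ?q = "\<lambda>j. (DG 0 * X2) $$ (0,j)"
    have FXc: "DF 0 * X1 \<in> carrier_mat 1 m" "DG 0 * X2 \<in> carrier_mat 1 m" using F0 G0 Xc by auto
    have "\<exists>r \<in> M3. ?p j = b * r \<and> ?q j = - a * r" if j: "j < m" for j
    proof (rule syzygy)
      show "?p j \<in> M1" "?q j \<in> M2" by (rule resolves_entry[OF F X(1) j], rule resolves_entry[OF G X(2) j])
      have "(a \<cdot>\<^sub>m (DF 0 * X1) + b \<cdot>\<^sub>m (DG 0 * X2)) $$ (0,j) = 0"
        using ZX j unfolding X(3) Zact[OF Xc] by simp
      moreover have "(a \<cdot>\<^sub>m (DF 0 * X1) + b \<cdot>\<^sub>m (DG 0 * X2)) $$ (0,j) = a * ?p j + b * ?q j"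
        by (rule index_smult_add_smult[OF FXc _ j]) simp
      ultimately show "a * ?p j + b * ?q j = 0" by simp
    qed
    then obtain r where r: "\<And>j. j < m \<Longrightarrow> r j \<in> M3 \<and> ?p j = b * r j \<and> ?q j = - a * r j" by metis
    let ?R = "mat 1 m (\<lambda>(i,j). r j)"
    obtain Y where Y: "Y \<in> mats V (BH 1) m" "?R = DH 0 * Y"
      by (rule resolves_lift_row[OF H, of m r]) (use r in auto)
    have R: "DF 0 * X1 = b \<cdot>\<^sub>m ?R" "DG 0 * X2 = - a \<cdot>\<^sub>m ?R"
      using FXc r by (auto intro!: eq_matI simp del: index_mult_mat(1))
    have "block_diag (DF 0) (DG 0) * X = sum_cone_map a b \<alpha> \<beta> 0 * (DH 0 * Y)"
      unfolding X(3) block_diag_mult_append_rows[OF F0 G0 Xc] R sum_cone_map_def \<alpha>(2) \<beta>(2) Y(2)[symmetric]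
      by (subst append_rows_mult[of _ 1 1 _ 1 _ m]) (auto intro!: arg_cong2[where f=append_rows] eq_matI)
    then show "\<exists>Y \<in> mats V (BH 1) m. block_diag (DF 0) (DG 0) * X = sum_cone_map a b \<alpha> \<beta> 0 * (DH 0 * Y)"
      using Y(1) by blast
  next
    fix m and Y :: "('v, 'k) mpoly mat" assume Y: "Y \<in> mats V (BH 1) m"
      and 0: "sum_cone_map a b \<alpha> \<beta> 0 * (DH 0 * Y) = 0\<^sub>m (BF 0 + BG 0) m"
    have HY: "DH 0 * Y \<in> carrier_mat 1 m" using H0 matsD[OF Y] by auto
    have "sum_cone_map a b \<alpha> \<beta> 0 * (DH 0 * Y) = (b \<cdot>\<^sub>m (DH 0 * Y)) @\<^sub>r (- a \<cdot>\<^sub>m (DH 0 * Y))"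
      unfolding sum_cone_map_def \<alpha>(2) \<beta>(2)
      append_rows_mult[OF smult_carrier_mat[OF one_carrier_mat] smult_carrier_mat[OF one_carrier_mat] HY]
      mult_smult_assoc_mat[OF one_carrier_mat HY] left_mult_one_mat[OF HY] ..
    then have "(b \<cdot>\<^sub>m (DH 0 * Y)) @\<^sub>r (- a \<cdot>\<^sub>m (DH 0 * Y)) = 0\<^sub>m 1 m @\<^sub>r 0\<^sub>m 1 m"
      using 0 B0 by (simp only: zero_append_rows)
    then have "b \<cdot>\<^sub>m (DH 0 * Y) = 0\<^sub>m 1 m"
      using append_rows_eq_iff[OF smult_carrier_mat[OF HY] smult_carrier_mat[OF HY] zero_carrier_mat zero_carrier_mat] by blast
    then have "b * (DH 0 * Y) $$ (i,j) = 0" if "i < 1" "j < m" for i j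
      using arg_cong[of _ _ "\<lambda>M. M $$ (i,j)"] HY that by (metis carrier_matD index_smult_mat(1) index_zero_mat(1))
    then have "(DH 0 * Y) $$ (i,j) = 0" if "i < 1" "j < m" for i j using regular that by blast
    then show "DH 0 * Y = 0\<^sub>m (BH 0) m" using HY B0 by (intro eq_matI) (auto simp del: index_mult_mat(1))
  qed
  have D0: "sum_cone_diff a b BF DF BG DG BH DH \<alpha> \<beta> 0 = ?Z" by (simp add: sum_cone_diff_def cone_diff_def)
  have r: "sum_cone_rank BF BG BH 0 = 1" "sum_cone_rank BF BG BH 1 = BF 1 + BG 1"
    by (simp_all add: sum_cone_rank_def cone_rank_def tor_target_def)
  show ?thesis
    unfolding resolves_def r D0
  proof (intro conjI refl ex allI ballI iffI impI)
    show "{a * p + b * q | p q. p \<in> M1 \<and> q \<in> M2} \<subseteq> poly_ring V"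
      using ab resolvesD(3)[OF F] resolvesD(3)[OF G] by (auto intro!: poly_ring_add poly_ring_mult)
  next
    fix m and X :: "('v, 'k) mpoly mat" assume X: "X \<in> mats V 1 m"
      and M: "\<forall>j<m. X $$ (0,j) \<in> {a * p + b * q | p q. p \<in> M1 \<and> q \<in> M2}"
    then obtain p q where pq: "\<And>j. j < m \<Longrightarrow> p j \<in> M1 \<and> q j \<in> M2 \<and> X $$ (0,j) = a * p j + b * q j"
      by simp metis
    let ?P = "mat 1 m (\<lambda>(i,j). p j)" and ?Q = "mat 1 m (\<lambda>(i,j). q j)"
    obtain U where U: "U \<in> mats V (BF 1) m" "?P = DF 0 * U"
      by (rule resolves_lift_row[OF F, of m p]) (use pq in auto)
    obtain W where W: "W \<in> mats V (BG 1) m" "?Q = DG 0 * W"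
      by (rule resolves_lift_row[OF G, of m q]) (use pq in auto)
    have "X = ?Z * (U @\<^sub>r W)"
      unfolding Zact[OF matsD[OF U(1)] matsD[OF W(1)]] U(2)[symmetric] W(2)[symmetric]
      using matsD[OF X] pq by (intro eq_matI) auto
    then show "\<exists>Y \<in> mats V (BF 1 + BG 1) m. X = ?Z * Y"
      using mats_append_rows[OF U(1) W(1)] by blast
  next
    fix m j and X :: "('v, 'k) mpoly mat" assume X: "\<exists>Y \<in> mats V (BF 1 + BG 1) m. X = ?Z * Y" and j: "j < m"
      from X obtain Y where "Y \<in> mats V (BF 1 + BG 1) m" and XY: "X = ?Z * Y" by blast
      then obtain U W where UW: "U \<in> mats V (BF 1) m" "W \<in> mats V (BG 1) m" "Y = U @\<^sub>r W"
        using mats_append_rows_cases by blast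
      note c = UW(1,2)[THEN matsD]
      have FXc: "DF 0 * U \<in> carrier_mat 1 m" "DG 0 * W \<in> carrier_mat 1 m" using F0 G0 c by auto
      have "X $$ (0,j) = a * (DF 0 * U) $$ (0,j) + b * (DG 0 * W) $$ (0,j)"
        unfolding XY UW(3) Zact[OF c] by (rule index_smult_add_smult[OF FXc _ j]) simp
      then show "X $$ (0,j) \<in> {a * p + b * q | p q. p \<in> M1 \<and> q \<in> M2}"
        using resolves_entry[OF F UW(1) j] resolves_entry[OF G UW(2) j] by blast
  qed
qed

theorem tor_rank_sum_cone:
  fixes DF DG DH :: "nat \<Rightarrow> ('v, 'k::field) mpoly mat"
  assumes F: "exact_complex V BF DF" and G: "exact_complex V BG DG" and H: "exact_complex V BH DH"
    and \<alpha>: "chain_map V BH DH BF DF \<alpha>" and \<beta>: "chain_map V BH DH BG DG \<beta>"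
    and ab: "a \<in> poly_ring V" "b \<in> poly_ring V" "const_coeff a = 0" "const_coeff b = 0"
    and h: "tor_rank BF DF i h" and l: "tor_rank BG DG i l"
    and k: "if i = 0 then k = 0 else tor_rank BH DH (i - 1) k"
  shows "tor_rank (sum_cone_rank BF BG BH) (sum_cone_diff a b BF DF BG DG BH DH \<alpha> \<beta>) i (h + l + k)"
  unfolding sum_cone_rank_def sum_cone_diff_def
proof (rule tor_rank_cone[OF exact_block_diag[OF F G] H chain_map_sum_cone_map[OF F G H \<alpha> \<beta> ab(1,2)]
      _ tor_rank_block_diag[OF F G h l] k])
  fix j
  note c = chain_mapD(2)[OF \<alpha>, of j] chain_mapD(2)[OF \<beta>, of j]
  have 0: "const_coeff (b * p) = 0" "const_coeff (- a * p) = 0" for p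
    using ab(3,4) by (simp_all add: const_coeff_mult const_coeff_uminus)
  have "const_mat (b \<cdot>\<^sub>m \<alpha> j) = 0\<^sub>m (BF j) (BH j)" "const_mat (- a \<cdot>\<^sub>m \<beta> j) = 0\<^sub>m (BG j) (BH j)"
    using c by (auto intro!: eq_matI simp: 0[simplified])
  then show "const_mat (sum_cone_map a b \<alpha> \<beta> j) = 0\<^sub>m (BF j + BG j) (BH j)"
    by (simp only: sum_cone_map_def const_mat_append_rows[OF smult_carrier_mat[OF c(1)] smult_carrier_mat[OF c(2)]]
        zero_append_rows)
qed

section \<open>Monomial ideals\<close>

abbreviation monomial :: "('v \<Rightarrow>\<^sub>0 nat) \<Rightarrow> ('v, 'k::comm_ring_1) mpoly" where
  "monomial x \<equiv> single x 1"

lemma exponent_diff_add: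
  fixes x k :: "'v \<Rightarrow>\<^sub>0 nat"
  assumes "\<And>v. lookup x v \<le> lookup k v"
  shows "x + (k - x) = k"
  by (rule poly_mapping_eqI) (simp add: lookup_add lookup_minus assms)

lemma keys_exponent_add: "keys (x + k) = keys x \<union> keys (k :: 'v \<Rightarrow>\<^sub>0 nat)"
  by (auto simp: in_keys_iff lookup_add)

lemma lookup_monom_mult:
  "lookup (monomial x * p) (x + m) = lookup (p :: ('v, 'k::comm_ring_1) mpoly) m"
proof -
  have "lookup (monomial x * p) (x + m) =
      (\<Sum>l. (\<Sum>q. lookup p q when m = q) when x = l)"
    by (simp add: lookup_mult lookup_single when_mult cong: when_cong)
  then show ?thesis by simp
qed

lemma keys_monom_mult:
  "keys (monomial x * p) = (+) x ` keys (p :: ('v, 'k::comm_ring_1) mpoly)"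
proof
  show "keys (monomial x * p) \<subseteq> (+) x ` keys p"
    using keys_mult[of "monomial x :: ('v, 'k) mpoly" p] by auto
  show "(+) x ` keys p \<subseteq> keys (monomial x * p)"
    by (auto simp: in_keys_iff lookup_monom_mult)
qed

lemma monom_mult_eq_0: "monomial x * p = 0 \<Longrightarrow> (p :: ('v, 'k::comm_ring_1) mpoly) = 0"
  using keys_monom_mult[of x p] by (metis image_is_empty keys_eq_empty)

text \<open>The quotient is obtained by shifting all exponents, which is the map \<open>map_key\<close> for the injective
  function that adds \<open>x\<close>.\<close>

lemma monom_divides:
  fixes p :: "('v, 'k::comm_ring_1) mpoly"
  assumes "\<And>k. k \<in> keys p \<Longrightarrow> \<exists>m. k = x + m"
  obtains q where "p = monomial x * q"
proof
  let ?q = "Poly_Mapping.map_key ((+) x) p"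
  have q: "lookup ?q m = lookup p (x + m)" for m
    by (simp add: map_key.rep_eq)
  show "p = monomial x * ?q"
  proof (rule poly_mapping_eqI)
    fix k
    show "lookup p k = lookup (monomial x * ?q) k"
    proof (cases "\<exists>m. k = x + m")
      case True
      then show ?thesis by (auto simp: lookup_monom_mult q)
    next
      case False
      then have "k \<notin> keys p" "k \<notin> keys (monomial x * ?q)"
        using assms keys_monom_mult[of x ?q] by auto
      then show ?thesis by (simp add: in_keys_iff)
    qed
  qed
qed

lemma split_keys:
  fixes p :: "('v, 'k::comm_ring_1) mpoly"
  obtains q r where "p = q + r" "keys q \<subseteq> keys p \<inter> A" "keys r \<subseteq> keys p - A"
proof
  let ?q = "Poly_Mapping.mapp (\<lambda>k c. if k \<in> A then c else 0) p"
  let ?r = "Poly_Mapping.mapp (\<lambda>k c. if k \<in> A then 0 else c) p"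
  show "p = ?q + ?r" by (rule poly_mapping_eqI) (auto simp: lookup_add lookup_mapp when_def in_keys_iff)
  show "keys ?q \<subseteq> keys p \<inter> A" "keys ?r \<subseteq> keys p - A"
    by (auto simp: in_keys_iff lookup_mapp when_def split: if_splits)
qed

definition monom_span :: "'v set \<Rightarrow> ('v \<Rightarrow>\<^sub>0 nat) set \<Rightarrow> ('v, 'k::comm_ring_1) mpoly set" where
  "monom_span V T = {p \<in> poly_ring V. keys p \<subseteq> T}"

lemma monom_in_poly_ring: "keys x \<subseteq> V \<Longrightarrow> monomial x \<in> poly_ring V"
  by (auto simp: poly_ring_def)

lemma poly_ring_monom_multD: "monomial x * p \<in> poly_ring V \<Longrightarrow> p \<in> poly_ring V"
  by (force simp: poly_ring_def keys_monom_mult keys_exponent_add)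

text \<open>As \<open>x\<close> and \<open>y\<close> have disjoint supports, \<open>x + k = y + l\<close> forces \<open>y\<close> to divide \<open>k\<close>. Hence the monomial
  of \<open>y\<close> divides \<open>p\<close>, and cancelling it determines \<open>q\<close>. The assumptions on \<open>T1\<close> and \<open>T2\<close> put the
  quotient back into both ideals.\<close>

lemma monom_span_syzygy:
  fixes p q :: "('v, 'k::comm_ring_1) mpoly"
  assumes p: "p \<in> monom_span V T1" and q: "q \<in> monom_span V T2" and 0: "monomial x * p + monomial y * q = 0"
    and disj: "keys x \<inter> keys y = {}"
    and T1: "\<And>m. y + m \<in> T1 \<Longrightarrow> m \<in> T1" and T2: "\<And>m. x + m \<in> T2 \<Longrightarrow> m \<in> T2"
  shows "\<exists>r \<in> monom_span V (T1 \<inter> T2). p = monomial y * r \<and> q = - monomial x * r"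
proof -
  have "\<exists>m. k = y + m" if k: "k \<in> keys p" for k
  proof -
    have "monomial x * p = - (monomial y * q)" using 0 by (simp add: eq_neg_iff_add_eq_0)
    then have "keys (monomial x * p) = keys (monomial y * q)" by (simp add: keys_uminus)
    then obtain l where l: "x + k = y + l" using k by (auto simp: keys_monom_mult)
    have "lookup y v \<le> lookup k v" for v
    proof (cases "v \<in> keys y")
      case True
      then have "lookup x v = 0" using disj by (auto simp: in_keys_iff)
      then show ?thesis using arg_cong[OF l, of "\<lambda>m. lookup m v"] by (simp add: lookup_add)
    qed (simp add: in_keys_iff)
    then have "k = y + (k - y)" by (rule exponent_diff_add[symmetric])
    then show ?thesis by blast
  qed
  then obtain r where r: "p = monomial y * r" by (rule monom_divides)
  have "monomial y * (monomial x * r + q) = 0" using 0 by (simp add: r algebra_simps)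
  then have "monomial x * r + q = 0" by (rule monom_mult_eq_0)
  then have qr: "q = - monomial x * r" by (simp add: eq_neg_iff_add_eq_0 add.commute)
  have "r \<in> poly_ring V" using p r poly_ring_monom_multD[of y r V] by (simp add: monom_span_def)
  moreover have "keys r \<subseteq> T1"
    using p T1 by (auto simp: r monom_span_def keys_monom_mult)
  moreover have "keys r \<subseteq> T2"
    using q T2 by (auto simp: qr monom_span_def keys_monom_mult keys_uminus)
  ultimately show ?thesis using r qr by (intro bexI[of _ r]) (auto simp: monom_span_def)
qed

lemma monom_span_sum:
  assumes "keys x \<subseteq> V" "keys y \<subseteq> V"
  shows "{monomial x * p + monomial y * q | p q. p \<in> monom_span V T1 \<and> q \<in> monom_span V T2} =
    (monom_span V ((+) x ` T1 \<union> (+) y ` T2) :: ('v, 'k::comm_ring_1) mpoly set)" (is "?L = ?R")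
proof
  show "?L \<subseteq> ?R"
  proof clarify
    fix p q :: "('v, 'k) mpoly" assume pq: "p \<in> monom_span V T1" "q \<in> monom_span V T2"
    then have "monomial x * p + monomial y * q \<in> poly_ring V"
      using assms by (intro poly_ring_add poly_ring_mult monom_in_poly_ring) (auto simp: monom_span_def)
    moreover have "keys (monomial x * p + monomial y * q) \<subseteq> (+) x ` T1 \<union> (+) y ` T2"
    proof (rule order_trans[OF keys_add])
      show "keys (monomial x * p) \<union> keys (monomial y * q) \<subseteq> (+) x ` T1 \<union> (+) y ` T2"
        unfolding keys_monom_mult using pq by (intro Un_mono image_mono) (auto simp: monom_span_def)
    qed
    ultimately show "monomial x * p + monomial y * q \<in> ?R" by (simp add: monom_span_def)
  qed
  show "?R \<subseteq> ?L"
  proof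
    fix f :: "('v, 'k) mpoly" assume f: "f \<in> ?R"
    obtain g h where gh: "f = g + h" "keys g \<subseteq> keys f \<inter> (+) x ` T1"
      "keys h \<subseteq> keys f - (+) x ` T1" by (rule split_keys)
    have hy: "keys h \<subseteq> (+) y ` T2" using gh(3) f by (auto simp: monom_span_def)
    obtain p where p: "g = monomial x * p" by (rule monom_divides[of g x]) (use gh(2) in blast)
    obtain q where q: "h = monomial y * q" by (rule monom_divides[of h y]) (use hy in blast)
    have "g \<in> poly_ring V" "h \<in> poly_ring V" using f gh(2,3) by (auto simp: monom_span_def poly_ring_def)
    then have "p \<in> poly_ring V" "q \<in> poly_ring V" using poly_ring_monom_multD p q by blast+
    moreover have "keys p \<subseteq> T1" using gh(2) by (auto simp: p keys_monom_mult)
    moreover have "keys q \<subseteq> T2" using hy by (auto simp: q keys_monom_mult)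
    ultimately show "f \<in> ?L" using gh(1) p q by (auto simp: monom_span_def)
  qed
qed

text \<open>For \<open>x = y = 0\<close> this resolves the sum of two monomial ideals. For two new variables it resolves the
  ideal that arises from attaching one variable to each of the two ideals.\<close>

theorem resolves_monom_cone:
  fixes DF DG DH :: "nat \<Rightarrow> ('v, 'k::comm_ring_1) mpoly mat"
  assumes F: "resolves V (monom_span V T1) BF DF" and G: "resolves V (monom_span V T2) BG DG"
    and H: "resolves V (monom_span V (T1 \<inter> T2)) BH DH"
    and \<alpha>: "chain_map V BH DH BF DF \<alpha>" "\<alpha> 0 = 1\<^sub>m 1" and \<beta>: "chain_map V BH DH BG DG \<beta>" "\<beta> 0 = 1\<^sub>m 1"
    and xy: "keys x \<subseteq> V" "keys y \<subseteq> V" "keys x \<inter> keys y = {}"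
    and T: "\<And>m. y + m \<in> T1 \<Longrightarrow> m \<in> T1" "\<And>m. x + m \<in> T2 \<Longrightarrow> m \<in> T2"
  shows "resolves V (monom_span V ((+) x ` T1 \<union> (+) y ` T2))
    (sum_cone_rank BF BG BH) (sum_cone_diff (monomial x) (monomial y) BF DF BG DG BH DH \<alpha> \<beta>)"
  unfolding monom_span_sum[OF xy(1,2), symmetric]
  by (rule resolves_sum_cone[OF F G H \<alpha> \<beta> monom_in_poly_ring[OF xy(1)] monom_in_poly_ring[OF xy(2)]])
    (use monom_span_syzygy[OF _ _ _ xy(3) T] monom_mult_eq_0 in blast)+

definition multiples :: "('v \<Rightarrow>\<^sub>0 nat) set \<Rightarrow> ('v \<Rightarrow>\<^sub>0 nat) set" where
  "multiples G = {m. \<exists>g \<in> G. \<forall>v. lookup g v \<le> lookup m v}"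

lemma multiples_insert: "multiples (insert g G) = multiples G \<union> multiples {g}"
  by (auto simp: multiples_def)

lemma lookup_exponent_lcm:
  "lookup (g + (h - g)) v = max (lookup g v) (lookup h v :: nat)"
  by (simp add: lookup_add lookup_minus max_def)

text \<open>With truncated subtraction, \<open>g + (h - g)\<close> is the exponent of the least common multiple.\<close>

lemma multiples_Int:
  "multiples G \<inter> multiples H = multiples ((\<lambda>(g,h). g + (h - g)) ` (G \<times> H))"
  unfolding multiples_def by (auto simp: lookup_exponent_lcm)

lemma keys_exponent_lcm:
  "keys (g + (h - g)) = keys g \<union> keys (h :: 'v \<Rightarrow>\<^sub>0 nat)"
  by (auto simp: in_keys_iff lookup_add lookup_minus)

lemma resolves_zero_ideal:
  "resolves V (monom_span V {} :: ('v, 'k::comm_ring_1) mpoly set)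
    (\<lambda>i. if i = 0 then 1 else 0) (\<lambda>i. 0\<^sub>m (if i = 0 then 1 else 0) 0)"
proof -
  have e: "exact_complex V (\<lambda>i. if i = 0 then 1 else 0)
      (\<lambda>i. 0\<^sub>m (if i = 0 then 1 else 0) 0 :: ('v, 'k) mpoly mat)"
    unfolding exact_complex_def
  proof (intro conjI allI ballI impI)
    fix i m and X :: "('v, 'k) mpoly mat"
    assume "X \<in> mats V (if Suc i = 0 then 1 else 0) m"
    then have "X = 0\<^sub>m 0 0 * 0\<^sub>m 0 m" using matsD[of X V 0 m] by (intro eq_matI) auto
    then show "\<exists>Y \<in> mats V (if Suc (Suc i) = 0 then 1 else 0) m. X = 0\<^sub>m (if Suc i = 0 then 1 else 0) 0 * Y"
      by (intro bexI[of _ "0\<^sub>m 0 m"]) (simp_all add: mats_0)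
  qed (auto simp: mats_0)
  have M: "monom_span V {} = {0 :: ('v, 'k) mpoly}" by (auto simp: monom_span_def poly_ring_0)
  show ?thesis
    unfolding resolves_def M
  proof (intro conjI e allI ballI iffI impI)
    fix m and X :: "('v, 'k) mpoly mat" assume X: "X \<in> mats V 1 m" "\<forall>j<m. X $$ (0,j) \<in> {0}"
    then have "X = 0\<^sub>m 1 0 * 0\<^sub>m 0 m" using matsD[OF X(1)] by (intro eq_matI) auto
    then show "\<exists>Y \<in> mats V (if (1::nat) = 0 then 1 else 0) m. X = 0\<^sub>m (if (0::nat) = 0 then 1 else 0) 0 * Y"
      by (intro bexI[of _ "0\<^sub>m 0 m"]) (simp_all add: mats_0)
  next
    fix m j and X :: "('v, 'k) mpoly mat"
    assume "\<exists>Y \<in> mats V (if (1::nat) = 0 then 1 else 0) m. X = 0\<^sub>m (if (0::nat) = 0 then 1 else 0) 0 * Y" "j < m"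
    then obtain Y where "Y \<in> mats V 0 m" "X = 0\<^sub>m 1 0 * Y" by auto
    then show "X $$ (0,j) \<in> {0}" using matsD[of Y V 0 m] \<open>j < m\<close> by (simp add: scalar_prod_def)
  qed (auto simp: poly_ring_0)
qed

lemma resolves_principal:
  fixes g :: "'v \<Rightarrow>\<^sub>0 nat"
  assumes g: "keys g \<subseteq> V"
  shows "resolves V (monom_span V (multiples {g}) :: ('v, 'k::comm_ring_1) mpoly set)
    (\<lambda>i. if i \<le> 1 then 1 else 0)
    (\<lambda>i. if i = 0 then mat 1 1 (\<lambda>_. monomial g) else 0\<^sub>m (if i \<le> 1 then 1 else 0) 0)"
    (is "resolves V ?M ?B ?D")
proof -
  have act: "?D 0 * X = mat 1 m (\<lambda>(i,j). monomial g * X $$ (0,j))" if "X \<in> carrier_mat 1 m" for X m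
    using that by (intro eq_matI) (auto simp: scalar_prod_def)
  have e: "exact_complex V ?B ?D"
    unfolding exact_complex_def
  proof (intro conjI allI ballI impI)
    fix i
    show "?D i \<in> mats V (?B i) (?B (Suc i))"
      using monom_in_poly_ring[OF g] by (auto simp: mats_def)
    show "?D i * ?D (Suc i) = 0\<^sub>m (?B i) (?B (Suc (Suc i)))" by (intro eq_matI) auto
    fix m and X :: "('v, 'k) mpoly mat"
    assume X: "X \<in> mats V (?B (Suc i)) m" "?D i * X = 0\<^sub>m (?B i) m"
    have "X = ?D (Suc i) * 0\<^sub>m 0 m"
    proof (cases i)
      case 0
      then have Xc: "X \<in> carrier_mat 1 m" using matsD[OF X(1)] by simp
      have "monomial g * X $$ (0,j) = 0" if "j < m" for j
        using X(2) arg_cong[OF act[OF Xc], of "\<lambda>M. M $$ (0,j)"] that by (simp add: 0)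
      then have "X $$ (0,j) = 0" if "j < m" for j using that monom_mult_eq_0 by blast
      then show ?thesis using Xc 0 by (intro eq_matI) (auto simp: scalar_prod_def)
    qed (use matsD[OF X(1)] in \<open>auto intro!: eq_matI\<close>)
    then show "\<exists>Y \<in> mats V (?B (Suc (Suc i))) m. X = ?D (Suc i) * Y"
      by (intro bexI[of _ "0\<^sub>m 0 m"]) (simp_all add: mats_0)
  qed
  have M: "?M = {monomial g * p | p. p \<in> poly_ring V}"
  proof (intro subset_antisym subsetI)
    fix f :: "('v, 'k) mpoly" assume f: "f \<in> ?M"
    have "\<exists>m. k = g + m" if "k \<in> keys f" for k
    proof -
      have "\<And>v. lookup g v \<le> lookup k v"
        using f that by (auto simp: monom_span_def multiples_def)
      then show ?thesis using exponent_diff_add[of g k] by metis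
    qed
    then obtain q where "f = monomial g * q" by (rule monom_divides)
    then show "f \<in> {monomial g * p | p. p \<in> poly_ring V}"
      using f poly_ring_monom_multD[of g q V] by (auto simp: monom_span_def)
  next
    fix f :: "('v, 'k) mpoly" assume "f \<in> {monomial g * p | p. p \<in> poly_ring V}"
    then show "f \<in> ?M"
      using poly_ring_mult[OF monom_in_poly_ring[OF g]]
      by (auto simp: monom_span_def multiples_def keys_monom_mult lookup_add)
  qed
  show ?thesis
    unfolding resolves_def
  proof (intro conjI e allI ballI iffI impI)
    show "?M \<subseteq> poly_ring V" by (auto simp: monom_span_def)
  next
    fix m and X :: "('v, 'k) mpoly mat" assume X: "X \<in> mats V 1 m" "\<forall>j<m. X $$ (0,j) \<in> ?M"
    then obtain p where p: "\<And>j. j < m \<Longrightarrow> X $$ (0,j) = monomial g * p j \<and> p j \<in> poly_ring V"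
      unfolding M by simp metis
    let ?Y = "mat 1 m (\<lambda>(i,j). p j)"
    have "?Y \<in> mats V (?B 1) m" using p by (auto simp: mats_def)
    moreover have "X = ?D 0 * ?Y"
      unfolding act[OF mat_carrier] using p matsD[OF X(1)] by (intro eq_matI) auto
    ultimately show "\<exists>Y \<in> mats V (?B 1) m. X = ?D 0 * Y" by blast
  next
    fix m j and X :: "('v, 'k) mpoly mat"
    assume "\<exists>Y \<in> mats V (?B 1) m. X = ?D 0 * Y" and j: "j < m"
    then obtain Y where Y: "Y \<in> mats V 1 m" "X = ?D 0 * Y" by auto
    then have "X $$ (0,j) = monomial g * Y $$ (0,j)" using act[OF matsD[OF Y(1)]] j by simp
    then show "X $$ (0,j) \<in> ?M" unfolding M using Y(1) j by (auto simp: mats_def)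
  qed simp
qed

text \<open>One complex that resolves the extension of the ideal to every polynomial ring containing the
  variables in \<open>V0\<close>. This takes the place of flat base change.\<close>

definition universal_resolution ::
    "'v set \<Rightarrow> ('v \<Rightarrow>\<^sub>0 nat) set \<Rightarrow> (nat \<Rightarrow> nat) \<Rightarrow> (nat \<Rightarrow> ('v, 'k::comm_ring_1) mpoly mat) \<Rightarrow> bool" where
  "universal_resolution V0 T B D \<longleftrightarrow> (\<forall>V. V0 \<subseteq> V \<longrightarrow> resolves V (monom_span V T) B D)"

lemma universal_resolutionD:
  "universal_resolution V0 T B D \<Longrightarrow> V0 \<subseteq> V \<Longrightarrow> resolves V (monom_span V T) B D"
  by (simp add: universal_resolution_def)

lemma chain_map_mono: "chain_map V B D B' D' \<phi> \<Longrightarrow> V \<subseteq> W \<Longrightarrow> chain_map W B D B' D' \<phi>"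
  by (auto simp: chain_map_def intro: mats_mono)

lemma universal_map_exists:
  assumes "universal_resolution V0 T B D" "universal_resolution V0 T' B' D'" "T \<subseteq> T'"
  obtains \<phi> where "\<And>V. V0 \<subseteq> V \<Longrightarrow> chain_map V B D B' D' \<phi>" "\<phi> 0 = 1\<^sub>m 1"
proof -
  obtain \<phi> where "chain_map V0 B D B' D' \<phi>" "\<phi> 0 = 1\<^sub>m 1"
    by (rule resolution_map_exists[OF universal_resolutionD[OF assms(1) order_refl] universal_resolutionD[OF assms(2) order_refl]])
      (use assms(3) in \<open>auto simp: monom_span_def\<close>)
  then show thesis using that chain_map_mono by blast
qed

text \<open>Induction on the number of generators. For \<open>G = insert g G'\<close>, the ideal is the sum of the ideals of
  \<open>G'\<close> and of \<open>g\<close>, and their intersection is generated by the least common multiples of \<open>g\<close> with the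
  elements of \<open>G'\<close>. These are at most \<open>card G'\<close> many, so the induction hypothesis applies to the
  intersection as well.\<close>

theorem monomial_ideal_resolution:
  fixes G :: "('v \<Rightarrow>\<^sub>0 nat) set"
  assumes "finite G" "\<And>g. g \<in> G \<Longrightarrow> keys g \<subseteq> V0"
  shows "\<exists>B D. universal_resolution V0 (multiples G) B (D :: nat \<Rightarrow> ('v, 'k::comm_ring_1) mpoly mat)"
  using assms
proof (induction "card G" arbitrary: G rule: less_induct)
  case less
  show ?case
  proof (cases "G = {}")
    case True
    have "multiples {} = {}" by (simp add: multiples_def)
    then show ?thesis using resolves_zero_ideal unfolding universal_resolution_def True by metis
  next
    case False
    then obtain g G' where g: "G = insert g G'" "g \<notin> G'" by (metis Set.set_insert ex_in_conv)
    let ?L = "(\<lambda>(h,g). h + (g - h)) ` (G' \<times> {g})"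
    have fin: "finite G'" using less.prems(1) g by simp
    have lt: "card G' < card G" using g fin by simp
    have "card ?L < card G"
      using card_image_le[of "G' \<times> {g}" "\<lambda>(h,g). h + (g - h)"] fin lt by (simp add: card_cartesian_product_singleton)
    moreover have "keys h \<subseteq> V0" if h: "h \<in> ?L" for h
    proof -
      obtain h' where "h' \<in> G'" "h = h' + (g - h')" using h by auto
      then show ?thesis
        using less.prems(2)[of h'] less.prems(2)[of g] g by (simp add: keys_exponent_lcm)
    qed
    ultimately obtain BH and DH :: "nat \<Rightarrow> ('v, 'k) mpoly mat"
      where H: "universal_resolution V0 (multiples ?L) BH DH"
      using less.hyps[of ?L] fin by (meson finite.emptyI finite_SigmaI finite_imageI finite_insert)
    obtain BF and DF :: "nat \<Rightarrow> ('v, 'k) mpoly mat" where F: "universal_resolution V0 (multiples G') BF DF"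
      using less.hyps[OF lt fin] less.prems(2) g by blast
    have gV: "keys g \<subseteq> V0" using less.prems(2) g by simp
    have "\<exists>B D. universal_resolution V0 (multiples {g}) B (D :: nat \<Rightarrow> ('v, 'k) mpoly mat)"
      unfolding universal_resolution_def
      by (intro exI allI impI, rule resolves_principal) (use gV in blast)
    then obtain BG and DG :: "nat \<Rightarrow> ('v, 'k) mpoly mat" where G: "universal_resolution V0 (multiples {g}) BG DG"
      by blast
    have H': "universal_resolution V0 (multiples G' \<inter> multiples {g}) BH DH"
      using H by (simp add: multiples_Int)
    obtain \<alpha> where \<alpha>: "\<And>V. V0 \<subseteq> V \<Longrightarrow> chain_map V BH DH BF DF \<alpha>" "\<alpha> 0 = 1\<^sub>m 1"
      by (rule universal_map_exists[OF H' F]) auto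
    obtain \<beta> where \<beta>: "\<And>V. V0 \<subseteq> V \<Longrightarrow> chain_map V BH DH BG DG \<beta>" "\<beta> 0 = 1\<^sub>m 1"
      by (rule universal_map_exists[OF H' G]) auto
    have "resolves V (monom_span V ((+) 0 ` multiples G' \<union> (+) 0 ` multiples {g}))
        (sum_cone_rank BF BG BH) (sum_cone_diff (monomial 0) (monomial 0) BF DF BG DG BH DH \<alpha> \<beta>)" if "V0 \<subseteq> V" for V
      by (rule resolves_monom_cone[OF universal_resolutionD[OF F that] universal_resolutionD[OF G that]
            universal_resolutionD[OF H' that] \<alpha>(1)[OF that] \<alpha>(2) \<beta>(1)[OF that] \<beta>(2)]) auto
    then show ?thesis
      unfolding universal_resolution_def g(1) multiples_insert[of g G'] by auto
  qed
qed

lemma prod_monomial: "(\<Prod>i\<in>I. monomial (x i)) = (monomial (\<Sum>i\<in>I. x i) :: ('v, 'k::comm_ring_1) mpoly)"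
  by (induction I rule: infinite_finite_induct) (simp_all add: mult_single single_one)

text \<open>For the inclusion from right to left, every exponent \<open>k\<close> of \<open>p\<close> is assigned one generator \<open>\<gamma> k\<close>
  dividing it, and the terms of \<open>p\<close> are collected by their generators.\<close>

lemma ideal_gen_monom:
  assumes G: "\<And>g. g \<in> G \<Longrightarrow> keys g \<subseteq> V"
  shows "ideal_gen V (monomial ` G) = (monom_span V (multiples G) :: ('v, 'k::comm_ring_1) mpoly set)"
proof (intro subset_antisym subsetI)
  fix p :: "('v, 'k) mpoly" assume "p \<in> ideal_gen V (monomial ` G)"
  then have "\<exists>F q. p = (\<Sum>f\<in>F. q f * f) \<and> finite F \<and> F \<subseteq> monomial ` G \<and> (\<forall>f\<in>F. q f \<in> poly_ring V)"
    unfolding ideal_gen_def mem_Collect_eq .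
  then obtain F q where p: "p = (\<Sum>f\<in>F. q f * f)" and F: "F \<subseteq> monomial ` G" and q: "\<forall>f\<in>F. q f \<in> poly_ring V"
    by (elim exE conjE) (rule that)
  have gens: "\<exists>g \<in> G. f = monomial g" if "f \<in> F" for f using that F by blast
  have "q f * f \<in> poly_ring V" if f: "f \<in> F" for f
  proof -
    obtain g where "g \<in> G" "f = monomial g" using gens[OF f] by blast
    then show ?thesis using poly_ring_mult[OF bspec[OF q f] monom_in_poly_ring[OF G]] by simp
  qed
  then have "p \<in> poly_ring V" unfolding p by (rule poly_ring_sum)
  moreover have "keys (q f * f) \<subseteq> multiples G" if f: "f \<in> F" for f
  proof -
    obtain g where "g \<in> G" "f = monomial g" using gens[OF f] by blast
    then have "keys (q f * f) = (+) g ` keys (q f)"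
      using keys_monom_mult[of g "q f"] by (simp only: mult.commute)
    then show ?thesis using \<open>g \<in> G\<close> by (auto simp: multiples_def lookup_add intro!: bexI[of _ g])
  qed
  then have "keys p \<subseteq> multiples G" unfolding p using keys_sum_subset[of "\<lambda>f. q f * f" F] by blast
  ultimately show "p \<in> monom_span V (multiples G)" by (simp add: monom_span_def)
next
  fix p :: "('v, 'k) mpoly" assume p: "p \<in> monom_span V (multiples G)"
  let ?K = "keys p" and ?c = "lookup p"
  have "\<exists>g \<in> G. g + (k - g) = k" if k: "k \<in> ?K" for k
  proof -
    obtain g where "g \<in> G" "\<And>v. lookup g v \<le> lookup k v"
      using p k unfolding monom_span_def multiples_def by blast
    then show ?thesis using exponent_diff_add by blast
  qed
  then obtain \<gamma> where \<gamma>: "\<And>k. k \<in> ?K \<Longrightarrow> \<gamma> k \<in> G \<and> \<gamma> k + (k - \<gamma> k) = k" by metis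
  let ?g = "\<lambda>k. monomial (\<gamma> k) :: ('v, 'k) mpoly"
  let ?q = "\<lambda>f. \<Sum>k\<in>{k \<in> ?K. ?g k = f}. single (k - \<gamma> k) (?c k)"
  have "(\<Sum>f\<in>?g ` ?K. ?q f * f) = (\<Sum>f\<in>?g ` ?K. \<Sum>k\<in>{k \<in> ?K. ?g k = f}. single k (?c k))"
  proof (rule sum.cong[OF refl])
    fix f assume "f \<in> ?g ` ?K"
    have "single (k - \<gamma> k) (?c k) * f = single k (?c k)" if "k \<in> ?K" "?g k = f" for k
      using \<gamma>[OF that(1)] that(2) by (auto simp: mult_single add.commute)
    then show "?q f * f = (\<Sum>k\<in>{k \<in> ?K. ?g k = f}. single k (?c k))"
      unfolding sum_distrib_right by (intro sum.cong) auto
  qed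
  also have "\<dots> = (\<Sum>k\<in>?K. single k (?c k))" by (rule sum.group) auto
  also have "\<dots> = p"
  proof (rule poly_mapping_eqI)
    fix k
    have "lookup (\<Sum>k\<in>?K. single k (?c k)) k = (\<Sum>l\<in>?K. if l = k then ?c k else 0)"
      unfolding lookup_sum by (intro sum.cong) (auto simp: lookup_single when_def)
    then show "lookup (\<Sum>k\<in>?K. single k (?c k)) k = ?c k"
      by (simp add: in_keys_iff)
  qed
  finally have p_eq: "p = (\<Sum>f\<in>?g ` ?K. ?q f * f)" ..
  have q: "?q f \<in> poly_ring V" for f
  proof (rule poly_ring_sum)
    fix k assume "k \<in> {k \<in> ?K. ?g k = f}"
    then have "keys (k - \<gamma> k) \<subseteq> V"
      using p \<gamma>[of k] keys_exponent_add[of "\<gamma> k" "k - \<gamma> k"] by (auto simp: monom_span_def poly_ring_def)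
    then show "single (k - \<gamma> k) (?c k) \<in> poly_ring V" by (auto simp: poly_ring_def)
  qed
  have sub: "?g ` ?K \<subseteq> monomial ` G" using \<gamma> by auto
  show "p \<in> ideal_gen V (monomial ` G)"
    unfolding ideal_gen_def mem_Collect_eq
    by (rule exI[of _ "?g ` ?K"], rule exI[of _ ?q])
      (intro conjI ballI p_eq sub q finite_imageI finite_keys)
qed

section \<open>Renaming variables\<close>

text \<open>An involution of the variables is its own inverse, so that one map serves for both directions of
  every transfer argument.\<close>

locale variable_involution =
  fixes \<sigma> :: "'v \<Rightarrow> 'v"
  assumes involution: "\<sigma> (\<sigma> v) = v"
begin

abbreviation \<tau> :: "('v \<Rightarrow>\<^sub>0 nat) \<Rightarrow> ('v \<Rightarrow>\<^sub>0 nat)" where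
  "\<tau> \<equiv> Poly_Mapping.map_key \<sigma>"

lemma inj_\<sigma>: "inj \<sigma>" by (rule inj_on_inverseI[of _ \<sigma>]) (rule involution)

lemma lookup_\<tau>: "lookup (\<tau> m) v = lookup m (\<sigma> v)"
  by (simp add: map_key.rep_eq[OF inj_\<sigma>])

lemma \<tau>_\<tau>: "\<tau> (\<tau> m) = m"
  by (rule poly_mapping_eqI) (simp add: lookup_\<tau> involution)

lemma \<tau>_add: "\<tau> (m + n) = \<tau> m + \<tau> n" by (rule map_key_plus[OF inj_\<sigma>])

lemma \<tau>_0: "\<tau> 0 = 0" by (rule map_key_zero[OF inj_\<sigma>])

lemma inj_\<tau>: "inj \<tau>" by (rule inj_on_inverseI[of _ \<tau>]) (rule \<tau>_\<tau>)

lemma bij_\<tau>: "bij \<tau>" by (rule o_bij[of \<tau>]) (auto simp: fun_eq_iff \<tau>_\<tau>)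

lemma lookup_rename: "lookup (rename_vars \<sigma> p) m = lookup p (\<tau> m)"
  by (simp add: rename_vars_def map_key.rep_eq[OF inj_\<tau>])

lemma keys_rename: "keys (rename_vars \<sigma> p) = \<tau> -` keys p"
  by (auto simp: in_keys_iff lookup_rename)

lemma rename_rename: "rename_vars \<sigma> (rename_vars \<sigma> p) = p"
  by (rule poly_mapping_eqI) (simp add: lookup_rename \<tau>_\<tau>)

lemma const_coeff_rename: "const_coeff (rename_vars \<sigma> p) = const_coeff p"
  by (simp add: const_coeff_def lookup_rename \<tau>_0)

lemma rename_add: "rename_vars \<sigma> (p + q) = rename_vars \<sigma> p + rename_vars \<sigma> q"
  by (rule poly_mapping_eqI) (simp add: lookup_rename lookup_add)

lemma rename_mult: "rename_vars \<sigma> (p * q) = rename_vars \<sigma> p * rename_vars \<sigma> q"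
proof (rule poly_mapping_eqI)
  fix k
  have inner: "(\<Sum>m. lookup q m when \<tau> k = \<tau> l + m) =
      (\<Sum>m. lookup q (\<tau> m) when k = l + m)" for l
  proof (rule Sum_any.reindex_cong[OF bij_\<tau>])
    show "(\<lambda>m. lookup q m when \<tau> k = \<tau> l + m) \<circ> \<tau> = (\<lambda>m. lookup q (\<tau> m) when k = l + m)"
      by (auto simp: fun_eq_iff \<tau>_add[symmetric] inj_eq[OF inj_\<tau>])
  qed
  have "lookup (p * q) (\<tau> k) =
      (\<Sum>l. lookup p (\<tau> l) * (\<Sum>m. lookup q m when \<tau> k = \<tau> l + m))"
    unfolding lookup_mult by (rule Sum_any.reindex_cong[OF bij_\<tau>]) (simp add: fun_eq_iff)
  then show "lookup (rename_vars \<sigma> (p * q)) k = lookup (rename_vars \<sigma> p * rename_vars \<sigma> q) k"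
    by (simp only: lookup_rename inner lookup_mult)
qed

lemma rename_semiring_hom: "semiring_hom (rename_vars \<sigma> :: ('v, 'k::comm_ring_1) mpoly \<Rightarrow> _)"
proof unfold_locales
  show "rename_vars \<sigma> 0 = (0 :: ('v, 'k) mpoly)" by (rule poly_mapping_eqI) (simp add: lookup_rename)
  have "\<tau> m = 0 \<longleftrightarrow> m = 0" for m using inj_eq[OF inj_\<tau>, of m 0] \<tau>_0 by simp
  then show "rename_vars \<sigma> 1 = (1 :: ('v, 'k) mpoly)"
    by (intro poly_mapping_eqI) (simp add: lookup_rename lookup_one)
qed (rule rename_add rename_mult)+

lemma rename_0: "rename_vars \<sigma> 0 = 0"
  by (rule poly_mapping_eqI) (simp add: lookup_rename)

lemma rename_poly_ring:
  assumes V: "\<And>v. v \<in> V \<Longrightarrow> \<sigma> v \<in> V" and p: "p \<in> poly_ring V"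
  shows "rename_vars \<sigma> p \<in> poly_ring V"
  unfolding poly_ring_def
proof (intro CollectI ballI subsetI)
  fix m v assume "m \<in> keys (rename_vars \<sigma> p)" "v \<in> keys m"
  then have "\<tau> m \<in> keys p" "\<sigma> v \<in> keys (\<tau> m)"
    by (auto simp: keys_rename in_keys_iff lookup_\<tau> involution)
  then have "\<sigma> v \<in> V" using p unfolding poly_ring_def by blast
  then show "v \<in> V" using V involution by metis
qed

lemma rename_monom_span:
  assumes V: "\<And>v. v \<in> V \<Longrightarrow> \<sigma> v \<in> V"
  shows "rename_vars \<sigma> ` monom_span V T = monom_span V (\<tau> -` T)"
proof -
  have sub: "rename_vars \<sigma> ` monom_span V T \<subseteq> monom_span V (\<tau> -` T)" for T
    using rename_poly_ring[OF V] by (auto simp: monom_span_def keys_rename)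
  have "\<tau> -` \<tau> -` T = T" by (auto simp: \<tau>_\<tau>)
  then have converse: "rename_vars \<sigma> ` monom_span V (\<tau> -` T) \<subseteq> monom_span V T" using sub[of "\<tau> -` T"] by simp
  show ?thesis
  proof (intro subset_antisym sub subsetI)
    fix p assume "p \<in> monom_span V (\<tau> -` T)"
    then have "rename_vars \<sigma> p \<in> monom_span V T" using converse by blast
    then have "rename_vars \<sigma> (rename_vars \<sigma> p) \<in> rename_vars \<sigma> ` monom_span V T" by (rule imageI)
    then show "p \<in> rename_vars \<sigma> ` monom_span V T" by (simp only: rename_rename)
  qed
qed

abbreviation rename_mat :: "('v, 'k::comm_ring_1) mpoly mat \<Rightarrow> ('v, 'k) mpoly mat" where
  "rename_mat \<equiv> map_mat (rename_vars \<sigma>)"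

lemma rename_mat_mult:
  "A \<in> carrier_mat n m \<Longrightarrow> B \<in> carrier_mat m k \<Longrightarrow> rename_mat (A * B) = rename_mat A * rename_mat B"
  by (rule semiring_hom.mat_hom_mult[OF rename_semiring_hom])

lemma rename_mat_rename_mat: "rename_mat (rename_mat A) = A"
  by (rule eq_matI) (auto simp: rename_rename)

lemma rename_mat_zero: "rename_mat (0\<^sub>m n m) = 0\<^sub>m n m"
  by (rule eq_matI) (auto simp: rename_0)

lemma rename_mat_mats:
  "(\<And>v. v \<in> V \<Longrightarrow> \<sigma> v \<in> V) \<Longrightarrow> A \<in> mats V n m \<Longrightarrow> rename_mat A \<in> mats V n m"
  unfolding mats_def by (auto intro!: rename_poly_ring)

lemma resolves_rename:
  assumes V: "\<And>v. v \<in> V \<Longrightarrow> \<sigma> v \<in> V" and D: "resolves V M B D"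
  shows "resolves V (rename_vars \<sigma> ` M) B (\<lambda>i. rename_mat (D i))"
proof -
  note e = resolvesD(2)[OF D] and mats = rename_mat_mats[OF V]
  have e': "exact_complex V B (\<lambda>i. rename_mat (D i))"
    unfolding exact_complex_def
  proof (intro conjI allI ballI impI)
    fix i
    show "rename_mat (D i) \<in> mats V (B i) (B (Suc i))" by (rule mats[OF _ exact_mats[OF e]])
    show "rename_mat (D i) * rename_mat (D (Suc i)) = 0\<^sub>m (B i) (B (Suc (Suc i)))"
      unfolding rename_mat_mult[OF exact_carrier[OF e] exact_carrier[OF e], symmetric]
        exact_square[OF e] rename_mat_zero ..
    fix m X assume X: "X \<in> mats V (B (Suc i)) m" "rename_mat (D i) * X = 0\<^sub>m (B i) m"
    have rX: "rename_mat X \<in> mats V (B (Suc i)) m" by (rule mats[OF _ X(1)])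
    have "D i * rename_mat X = rename_mat (rename_mat (D i) * X)"
      using rename_mat_mult[of "rename_mat (D i)" "B i" "B (Suc i)" X m] exact_carrier[OF e, of i]
        matsD[OF X(1)] by (simp add: rename_mat_rename_mat)
    then have "D i * rename_mat X = 0\<^sub>m (B i) m" using X(2) by (simp add: rename_mat_zero)
    then obtain Y where Y: "Y \<in> mats V (B (Suc (Suc i))) m" "rename_mat X = D (Suc i) * Y"
      using exact_lift[OF e rX] by blast
    have "X = rename_mat (D (Suc i)) * rename_mat Y"
      using rename_mat_mult[OF exact_carrier[OF e] matsD[OF Y(1)]] Y(2) rename_mat_rename_mat by metis
    then show "\<exists>Y \<in> mats V (B (Suc (Suc i))) m. X = rename_mat (D (Suc i)) * Y"
      using mats[OF _ Y(1)] by blast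
  qed
  note D0c = matsD[OF resolvesD(4)[OF D]]
  show ?thesis
    unfolding resolves_def
  proof (intro conjI e' resolvesD(1)[OF D] allI ballI iffI impI)
    show "rename_vars \<sigma> ` M \<subseteq> poly_ring V" using resolvesD(3)[OF D] rename_poly_ring[OF V] by blast
  next
    fix m X assume X: "X \<in> mats V 1 m" "\<forall>j<m. X $$ (0,j) \<in> rename_vars \<sigma> ` M"
    have "rename_mat X $$ (0,j) \<in> M" if j: "j < m" for j
    proof -
      obtain p where "p \<in> M" "X $$ (0,j) = rename_vars \<sigma> p" using X(2) j by blast
      then show ?thesis using matsD[OF X(1)] j by (simp add: rename_rename)
    qed
    then obtain Y where Y: "Y \<in> mats V (B 1) m" "rename_mat X = D 0 * Y"
      using resolves_lift[OF D mats[OF _ X(1)]] by blast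
    have "X = rename_mat (D 0) * rename_mat Y"
      using rename_mat_mult[OF D0c matsD[OF Y(1)]] Y(2) rename_mat_rename_mat by metis
    then show "\<exists>Y \<in> mats V (B 1) m. X = rename_mat (D 0) * Y" using mats[OF _ Y(1)] by blast
  next
    fix m j X assume X: "X \<in> mats V 1 m" "\<exists>Y \<in> mats V (B 1) m. X = rename_mat (D 0) * Y" "j < m"
    then obtain Y where Y: "Y \<in> mats V (B 1) m" "X = rename_mat (D 0) * Y" by blast
    have rY: "rename_mat Y \<in> mats V (B 1) m" by (rule mats[OF _ Y(1)])
    have "X = rename_mat (D 0 * rename_mat Y)"
      unfolding rename_mat_mult[OF D0c matsD[OF rY]] rename_mat_rename_mat by (rule Y(2))
    then have "X $$ (0,j) = rename_vars \<sigma> ((D 0 * rename_mat Y) $$ (0,j))"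
      using D0c matsD[OF rY] \<open>j < m\<close> by simp
    then show "X $$ (0,j) \<in> rename_vars \<sigma> ` M" using resolves_entry[OF D rY \<open>j < m\<close>] by blast
  qed
qed

lemma tor_rank_rename: "tor_rank B (\<lambda>i. rename_mat (D i)) i h \<longleftrightarrow> tor_rank B D i h"
proof -
  have "const_mat (rename_mat A) = const_mat A" for A
    by (rule eq_matI) (auto simp: const_coeff_rename)
  then have "tor_diff B (\<lambda>i. rename_mat (D i)) j = tor_diff B D j" for j
    by (cases j) (simp_all add: tensor_diff_def)
  then show ?thesis unfolding tor_rank_def by simp
qed

end

section \<open>Cut ideals of cycles\<close>

text \<open>The exponents of the monomials in the ideal generated by the products of one factor \<open>s\<^sub>i\<close> or \<open>t\<^sub>i\<close>
  for each \<open>i \<le> k\<close>, where \<open>J\<close> is the set of indices with factor \<open>s\<^sub>i\<close> and \<open>e\<close> decides between even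
  and odd size of \<open>J\<close>. Only the positions of nonzero exponents matter, as the generators are
  squarefree.\<close>

definition parity_exponents :: "nat \<Rightarrow> bool \<Rightarrow> (cut_var \<Rightarrow>\<^sub>0 nat) set" where
  "parity_exponents k e = {m. \<exists>J \<subseteq> {1..k}. even (card J) = e \<and>
     (\<forall>i \<in> J. lookup m (SVar i) > 0) \<and> (\<forall>i \<in> {1..k} - J. lookup m (TVar i) > 0)}"

lemma parity_exponentsI:
  assumes "J \<subseteq> {1..k}" "even (card J) = e"
    and "\<And>i. i \<in> J \<Longrightarrow> lookup m (SVar i) > 0"
    and "\<And>i. i \<in> {1..k} - J \<Longrightarrow> lookup m (TVar i) > 0"
  shows "m \<in> parity_exponents k e"
  unfolding parity_exponents_def by (intro CollectI exI[of _ J] conjI ballI assms)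

lemma parity_exponentsE:
  assumes "m \<in> parity_exponents k e"
  obtains J where "J \<subseteq> {1..k}" "even (card J) = e"
    "\<And>i. i \<in> J \<Longrightarrow> lookup m (SVar i) > 0"
    "\<And>i. i \<in> {1..k} - J \<Longrightarrow> lookup m (TVar i) > 0"
  using assms unfolding parity_exponents_def mem_Collect_eq by (elim exE conjE) (rule that, auto)

definition edge_exponent :: "nat \<Rightarrow> nat set \<Rightarrow> cut_var \<Rightarrow>\<^sub>0 nat" where
  "edge_exponent k J = (\<Sum>i=1..k. single (if i \<in> J then SVar i else TVar i) 1)"

definition parity_generators :: "nat \<Rightarrow> bool \<Rightarrow> (cut_var \<Rightarrow>\<^sub>0 nat) set" where
  "parity_generators k e = edge_exponent k ` {J. J \<subseteq> {1..k} \<and> even (card J) = e}"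

lemma lookup_edge_exponent:
  "lookup (edge_exponent k J) (SVar i) = (if i \<in> {1..k} \<inter> J then 1 else 0)"
  "lookup (edge_exponent k J) (TVar i) = (if i \<in> {1..k} - J then 1 else 0)"
proof -
  have "lookup (edge_exponent k J) (SVar i) = (\<Sum>j=1..k. if j = i then (if i \<in> J then 1 else 0) else 0)"
    unfolding edge_exponent_def lookup_sum by (intro sum.cong) (auto simp: lookup_single when_def)
  then show "lookup (edge_exponent k J) (SVar i) = (if i \<in> {1..k} \<inter> J then 1 else 0)"
    by simp
  have "lookup (edge_exponent k J) (TVar i) = (\<Sum>j=1..k. if j = i then (if i \<in> J then 0 else 1) else 0)"
    unfolding edge_exponent_def lookup_sum by (intro sum.cong) (auto simp: lookup_single when_def)
  then show "lookup (edge_exponent k J) (TVar i) = (if i \<in> {1..k} - J then 1 else 0)"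
    by simp
qed

lemma parity_exponents_multiples: "parity_exponents k e = multiples (parity_generators k e)"
proof -
  have iff: "(\<forall>v. lookup (edge_exponent k J) v \<le> lookup m v) \<longleftrightarrow>
      (\<forall>i \<in> J. lookup m (SVar i) > 0) \<and> (\<forall>i \<in> {1..k} - J. lookup m (TVar i) > 0)"
    if J: "J \<subseteq> {1..k}" for J m
  proof -
    have "(\<forall>v. lookup (edge_exponent k J) v \<le> lookup m v) \<longleftrightarrow>
        (\<forall>i. lookup (edge_exponent k J) (SVar i) \<le> lookup m (SVar i)) \<and>
        (\<forall>i. lookup (edge_exponent k J) (TVar i) \<le> lookup m (TVar i))"
      by (metis cut_var.exhaust)
    moreover have "(if i \<in> {1..k} \<inter> J then 1 else 0) \<le> x \<longleftrightarrow> (i \<in> J \<longrightarrow> 0 < x)"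
      "(if i \<in> {1..k} - J then 1 else 0) \<le> x \<longleftrightarrow> (i \<in> {1..k} - J \<longrightarrow> 0 < x)" for i and x :: nat
      using J by auto
    ultimately show ?thesis unfolding lookup_edge_exponent Ball_def by (simp only:)
  qed
  show ?thesis
  proof (intro subset_antisym subsetI)
    fix m assume "m \<in> parity_exponents k e"
    then obtain J where J: "J \<subseteq> {1..k}" "even (card J) = e"
      "\<And>i. i \<in> J \<Longrightarrow> lookup m (SVar i) > 0"
      "\<And>i. i \<in> {1..k} - J \<Longrightarrow> lookup m (TVar i) > 0"
      by (rule parity_exponentsE) blast
    then have "edge_exponent k J \<in> parity_generators k e" unfolding parity_generators_def by (intro imageI) simp
    moreover have "\<forall>v. lookup (edge_exponent k J) v \<le> lookup m v"
      unfolding iff[OF J(1)] using J(3,4) by (intro conjI ballI)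
    ultimately show "m \<in> multiples (parity_generators k e)" unfolding multiples_def by blast
  next
    fix m assume "m \<in> multiples (parity_generators k e)"
    then obtain J where J: "J \<subseteq> {1..k}" "even (card J) = e"
      and le: "\<forall>v. lookup (edge_exponent k J) v \<le> lookup m v"
      unfolding multiples_def parity_generators_def by auto
    show "m \<in> parity_exponents k e"
      by (rule parity_exponentsI[OF J]) (use le[unfolded iff[OF J(1)]] in simp_all)
  qed
qed

lemma finite_parity_generators: "finite (parity_generators k e)"
  unfolding parity_generators_def by (rule finite_imageI, rule finite_subset[of _ "Pow {1..k}"]) auto

lemma keys_parity_generators: "g \<in> parity_generators k e \<Longrightarrow> keys g \<subseteq> cut_vars k"
proof
  fix v assume "g \<in> parity_generators k e" "v \<in> keys g"
  then obtain J where "v \<in> keys (edge_exponent k J)" by (auto simp: parity_generators_def)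
  then show "v \<in> cut_vars k"
    by (cases v) (auto simp: in_keys_iff lookup_edge_exponent cut_vars_def split: if_splits)
qed

lemma parity_exponents_cong:
  assumes "\<And>i. i \<in> {1..k} \<Longrightarrow> lookup m (SVar i) = lookup m' (SVar i)"
    "\<And>i. i \<in> {1..k} \<Longrightarrow> lookup m (TVar i) = lookup m' (TVar i)"
  shows "m \<in> parity_exponents k e \<longleftrightarrow> m' \<in> parity_exponents k e"
proof -
  have "m' \<in> parity_exponents k e" if m: "m \<in> parity_exponents k e"
    and S: "\<And>i. i \<in> {1..k} \<Longrightarrow> lookup m (SVar i) = lookup m' (SVar i)"
    and T: "\<And>i. i \<in> {1..k} \<Longrightarrow> lookup m (TVar i) = lookup m' (TVar i)" for m m'
  proof -
    from m obtain J where J: "J \<subseteq> {1..k}" "even (card J) = e"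
      "\<And>i. i \<in> J \<Longrightarrow> lookup m (SVar i) > 0"
      "\<And>i. i \<in> {1..k} - J \<Longrightarrow> lookup m (TVar i) > 0"
      by (rule parity_exponentsE) blast
    show ?thesis
    proof (rule parity_exponentsI[OF J(1,2)])
      show "lookup m' (SVar i) > 0" if "i \<in> J" for i
        using J(3)[OF that] S[of i] J(1) that by auto
      show "lookup m' (TVar i) > 0" if "i \<in> {1..k} - J" for i
        using J(4)[OF that] T[of i] that by auto
    qed
  qed
  then show ?thesis using assms by metis
qed

text \<open>Case distinction whether the last edge belongs to \<open>J\<close>; removing it changes the parity.\<close>

lemma parity_exponents_Suc:
  "m \<in> parity_exponents (Suc k) e \<longleftrightarrow>
    (lookup m (TVar (Suc k)) > 0 \<and> m \<in> parity_exponents k e) \<or>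
    (lookup m (SVar (Suc k)) > 0 \<and> m \<in> parity_exponents k (\<not> e))" (is "_ \<longleftrightarrow> ?T \<or> ?S")
proof
  assume "m \<in> parity_exponents (Suc k) e"
  then obtain J where J: "J \<subseteq> {1..Suc k}" "even (card J) = e"
    and s: "\<And>i. i \<in> J \<Longrightarrow> lookup m (SVar i) > 0"
    and t: "\<And>i. i \<in> {1..Suc k} - J \<Longrightarrow> lookup m (TVar i) > 0"
    by (rule parity_exponentsE) blast
  show "?T \<or> ?S"
  proof (cases "Suc k \<in> J")
    case True
    have fin: "finite J" using J(1) finite_subset by blast
    have "m \<in> parity_exponents k (\<not> e)"
    proof (rule parity_exponentsI[of "J - {Suc k}"])
      show "even (card (J - {Suc k})) = (\<not> e)"
        using J(2) card_Suc_Diff1[OF fin True] by (metis even_Suc)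
      show "J - {Suc k} \<subseteq> {1..k}" using J(1) by (auto simp: le_Suc_eq)
    qed (auto intro: s t)
    then show ?thesis using s[OF True] by blast
  next
    case False
    have "m \<in> parity_exponents k e"
    proof (rule parity_exponentsI[OF _ J(2)])
      show "J \<subseteq> {1..k}" using J(1) False by (auto simp: le_Suc_eq)
    qed (auto intro: s t)
    then show ?thesis using t[of "Suc k"] False by simp
  qed
next
  assume "?T \<or> ?S"
  then show "m \<in> parity_exponents (Suc k) e"
  proof
    assume T: ?T
    from conjunct2[OF T] obtain J where J: "J \<subseteq> {1..k}" "even (card J) = e"
      "\<And>i. i \<in> J \<Longrightarrow> lookup m (SVar i) > 0"
      "\<And>i. i \<in> {1..k} - J \<Longrightarrow> lookup m (TVar i) > 0"
      by (rule parity_exponentsE) blast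
    show ?thesis
    proof (rule parity_exponentsI[OF _ J(2) J(3)])
      show "J \<subseteq> {1..Suc k}" using J(1) by auto
      fix i assume "i \<in> {1..Suc k} - J"
      then show "lookup m (TVar i) > 0" using T J(4)[of i] by (cases "i = Suc k") auto
    qed
  next
    assume S: ?S
    from conjunct2[OF S] obtain J where J: "J \<subseteq> {1..k}" "even (card J) = (\<not> e)"
      "\<And>i. i \<in> J \<Longrightarrow> lookup m (SVar i) > 0"
      "\<And>i. i \<in> {1..k} - J \<Longrightarrow> lookup m (TVar i) > 0"
      by (rule parity_exponentsE) blast
    have "Suc k \<notin> J" "finite J" using J(1) finite_subset by auto
    show ?thesis
    proof (rule parity_exponentsI[of "insert (Suc k) J"])
      show "even (card (insert (Suc k) J)) = e" using \<open>Suc k \<notin> J\<close> \<open>finite J\<close> J(2) by simp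
      show "insert (Suc k) J \<subseteq> {1..Suc k}" using J(1) by auto
      show "lookup m (SVar i) > 0" if "i \<in> insert (Suc k) J" for i
        using that J(3) S by auto
      show "lookup m (TVar i) > 0" if "i \<in> {1..Suc k} - insert (Suc k) J" for i
        using that J(4)[of i] by (auto simp: le_Suc_eq)
    qed
  qed
qed

lemma add_single_image:
  "(+) (single v (1::nat)) ` T =
    {m. lookup m v > 0 \<and> m - single v 1 \<in> T}"
proof (intro subset_antisym subsetI)
  fix m assume "m \<in> {m. lookup m v > 0 \<and> m - single v 1 \<in> T}"
  then have m: "lookup m v > 0" "m - single v 1 \<in> T" by auto
  have "single v 1 + (m - single v 1) = m"
    by (rule exponent_diff_add) (use m(1) in \<open>auto simp: lookup_single when_def\<close>)
  then show "m \<in> (+) (single v 1) ` T" using m(2) by (metis image_eqI)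
qed (auto simp: lookup_add)

text \<open>In terms of ideals this is \<open>E\<^sub>n = t\<^sub>n E\<^sub>k + s\<^sub>n O\<^sub>k\<close> and the corresponding equation for \<open>O\<^sub>n\<close>.\<close>

lemma parity_exponents_Suc_eq:
  "parity_exponents (Suc k) e =
    (+) (single (TVar (Suc k)) 1) ` parity_exponents k e \<union>
    (+) (single (SVar (Suc k)) 1) ` parity_exponents k (\<not> e)"
proof -
  have "m - single v 1 \<in> parity_exponents k e \<longleftrightarrow> m \<in> parity_exponents k e"
    if "v \<in> {TVar (Suc k), SVar (Suc k)}" for m v e
    by (rule parity_exponents_cong) (use that in \<open>auto simp: lookup_minus lookup_single when_def\<close>)
  then show ?thesis
    unfolding add_single_image by (auto simp: parity_exponents_Suc)
qed

lemma parity_exponents_add: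
  assumes "v \<in> {TVar (Suc k), SVar (Suc k)}" "single v 1 + m \<in> parity_exponents k e"
  shows "m \<in> parity_exponents k e"
  using parity_exponents_cong[of k "single v 1 + m" m e] assms
  by (auto simp: lookup_add lookup_single when_def)

lemma card_edge_Int:
  assumes "a \<noteq> b"
  shows "card ({a,b} \<inter> A) = 1 \<longleftrightarrow> (a \<in> A) \<noteq> (b \<in> A)"
proof -
  have "{a,b} \<inter> A = (if a \<in> A then {a} else {}) \<union> (if b \<in> A then {b} else {})" by auto
  then show ?thesis using assms by auto
qed

lemma cut_edge_iff:
  assumes "2 \<le> k" "i \<in> {1..k}"
  shows "card (cycle_edge k i \<inter> A) = 1 \<longleftrightarrow> (if i < k then (i \<in> A) \<noteq> (Suc i \<in> A) else (1 \<in> A) \<noteq> (k \<in> A))"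
  using assms card_edge_Int[of i "i + 1" A] card_edge_Int[of 1 k A] by (auto simp: cycle_edge_def)

text \<open>Along a path, each cut edge switches the side.\<close>

lemma even_path_cut:
  "even (card {i \<in> {1..<Suc j}. (i \<in> A) \<noteq> (Suc i \<in> A)}) \<longleftrightarrow> ((1::nat) \<in> A) = (Suc j \<in> A)"
proof (induction j)
  case (Suc j)
  have "{i \<in> {1..<Suc (Suc j)}. (i \<in> A) \<noteq> (Suc i \<in> A)} =
      {i \<in> {1..<Suc j}. (i \<in> A) \<noteq> (Suc i \<in> A)} \<union> (if (Suc j \<in> A) \<noteq> (Suc (Suc j) \<in> A) then {Suc j} else {})"
    by (auto simp: less_Suc_eq)
  then show ?case using Suc.IH by (auto simp: card_insert_if)
qed simp

text \<open>A walk around the cycle returns to the side where it started. The last edge closes the path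
  \<open>1, \<dots>, k\<close>.\<close>

lemma even_cut:
  assumes k: "2 \<le> k"
  shows "even (card {i \<in> {1..k}. card (cycle_edge k i \<inter> A) = 1})"
proof -
  obtain j where j: "k = Suc j" "1 \<le> j" using k by (cases k) auto
  have "{i \<in> {1..k}. card (cycle_edge k i \<inter> A) = 1} =
      {i \<in> {1..<Suc j}. (i \<in> A) \<noteq> (Suc i \<in> A)} \<union> (if (1 \<in> A) \<noteq> (k \<in> A) then {k} else {})"
  proof (rule Set.set_eqI)
    fix i
    consider "i \<in> {1..k}" "i < k" | "i = k" | "i \<notin> {1..k}" by fastforce
    then show "i \<in> {i \<in> {1..k}. card (cycle_edge k i \<inter> A) = 1} \<longleftrightarrow>
      i \<in> {i \<in> {1..<Suc j}. (i \<in> A) \<noteq> (Suc i \<in> A)} \<union> (if (1 \<in> A) \<noteq> (k \<in> A) then {k} else {})"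
    proof cases
      case 1
      then show ?thesis using cut_edge_iff[OF k 1(1), of A] j by auto
    next
      case 2
      then show ?thesis using cut_edge_iff[OF k, of k A] j by auto
    qed (use j in auto)
  qed
  then show ?thesis using even_path_cut[of j A] j by (auto simp: card_insert_if)
qed

text \<open>Walking along the path from vertex \<open>1\<close> and changing the side at every edge in \<open>J\<close> gives the vertex
  set \<open>A\<close>. It is consistent at the closing edge because \<open>J\<close> is even.\<close>

lemma even_set_is_cut:
  assumes k: "2 \<le> k" and J: "J \<subseteq> {1..k}" "even (card J)"
  shows "\<exists>A \<subseteq> {1..k}. {i \<in> {1..k}. card (cycle_edge k i \<inter> A) = 1} = J"
proof (intro exI conjI)
  let ?A = "{v \<in> {1..k}. odd (card (J \<inter> {1..<v}))}"
  have step: "odd (card (J \<inter> {1..<Suc i})) \<longleftrightarrow> odd (card (J \<inter> {1..<i})) \<noteq> (i \<in> J)" if "1 \<le> i" for i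
  proof -
    have "J \<inter> {1..<Suc i} = (if i \<in> J then insert i (J \<inter> {1..<i}) else J \<inter> {1..<i})"
      using that by (auto simp: less_Suc_eq)
    then show ?thesis by (auto simp: card_insert_if)
  qed
  have "J \<inter> {1..<Suc k} = J" using J(1) by auto
  then have last: "odd (card (J \<inter> {1..<k})) \<longleftrightarrow> k \<in> J" using step[of k] J(2) k by auto
  have "card (cycle_edge k i \<inter> ?A) = 1 \<longleftrightarrow> i \<in> J" if i: "i \<in> {1..k}" for i
  proof (cases "i < k")
    case True
    then show ?thesis using cut_edge_iff[OF k i, of ?A] step[of i] i by auto
  next
    case False
    then have "i = k" using i by simp
    then show ?thesis using cut_edge_iff[OF k i, of ?A] last k by auto
  qed
  then show "{i \<in> {1..k}. card (cycle_edge k i \<inter> ?A) = 1} = J" using J(1) by blast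
qed auto

lemma cut_monomial_eq:
  "cut_monomial k A = monomial (edge_exponent k {i \<in> {1..k}. card (cycle_edge k i \<inter> A) = 1})"
proof -
  have "cut_monomial k A = (\<Prod>i=1..k. monomial (single
      (if i \<in> {i \<in> {1..k}. card (cycle_edge k i \<inter> A) = 1} then SVar i else TVar i) 1))"
    unfolding cut_monomial_def by (intro prod.cong) (auto simp: mvar_def)
  then show ?thesis unfolding prod_monomial edge_exponent_def .
qed

lemma cut_ideal_eq:
  assumes k: "2 \<le> k"
  shows "cut_ideal k = monom_span (cut_vars k) (parity_exponents k True)"
proof -
  let ?J = "\<lambda>A. {i \<in> {1..k}. card (cycle_edge k i \<inter> A) = 1}"
  have J: "{?J A | A. A \<subseteq> {1..k}} = {J. J \<subseteq> {1..k} \<and> even (card J) = True}"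
  proof (intro subset_antisym subsetI)
    fix J assume "J \<in> {J. J \<subseteq> {1..k} \<and> even (card J) = True}"
    then obtain A where "A \<subseteq> {1..k}" "?J A = J" using even_set_is_cut[OF k, of J] by blast
    then show "J \<in> {?J A | A. A \<subseteq> {1..k}}" by blast
  next
    fix J assume "J \<in> {?J A | A. A \<subseteq> {1..k}}"
    then show "J \<in> {J. J \<subseteq> {1..k} \<and> even (card J) = True}" using even_cut[OF k] by auto
  qed
  have "{cut_monomial k A | A. A \<subseteq> {1..k}} = monomial ` edge_exponent k ` {?J A | A. A \<subseteq> {1..k}}"
    unfolding cut_monomial_eq setcompr_eq_image image_image ..
  also have "\<dots> = monomial ` parity_generators k True" unfolding J parity_generators_def ..
  finally have gens: "{cut_monomial k A | A. A \<subseteq> {1..k}} = monomial ` parity_generators k True" .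
  show ?thesis
    unfolding cut_ideal_def parity_exponents_multiples gens
    by (rule ideal_gen_monom[OF keys_parity_generators])
qed

lemma last_edge_involution: "variable_involution (transpose (SVar k) (TVar k))"
  by unfold_locales simp

lemma last_edge_swap_vars: "1 \<le> k \<Longrightarrow> v \<in> cut_vars k \<Longrightarrow> transpose (SVar k) (TVar k) v \<in> cut_vars k"
  by (auto simp: transpose_def cut_vars_def)

text \<open>Exchanging \<open>s\<^sub>k\<close> and \<open>t\<^sub>k\<close> moves the last edge into or out of \<open>J\<close>.\<close>

lemma last_edge_swap_parity:
  assumes "1 \<le> k"
  shows "Poly_Mapping.map_key (transpose (SVar k) (TVar k)) -` parity_exponents k e = parity_exponents k (\<not> e)"
proof -
  interpret variable_involution "transpose (SVar k) (TVar k)" by (rule last_edge_involution)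
  obtain j where j: "k = Suc j" using assms by (cases k) auto
  have "\<tau> m \<in> parity_exponents j e \<longleftrightarrow> m \<in> parity_exponents j e" for m e
    by (rule parity_exponents_cong, unfold lookup_\<tau>) (auto simp: transpose_def j)
  then show ?thesis
    by (intro Set.set_eqI, unfold vimage_eq j parity_exponents_Suc lookup_\<tau>[unfolded j]) (auto simp: j)
qed

lemma swapped_cut_ideal_eq:
  assumes k: "2 \<le> k"
  shows "swapped_cut_ideal k = monom_span (cut_vars k) (parity_exponents k False)"
proof -
  interpret variable_involution "transpose (SVar k) (TVar k)" by (rule last_edge_involution)
  have "1 \<le> k" using k by simp
  then show ?thesis
    unfolding swapped_cut_ideal_def cut_ideal_eq[OF k]
    by (simp add: rename_monom_span[OF last_edge_swap_vars] last_edge_swap_parity)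
qed

lemma cut_L_eq:
  assumes "2 \<le> k"
  shows "cut_L (Suc k) = monom_span (cut_vars k) (parity_exponents k True \<inter> parity_exponents k False)"
  using cut_ideal_eq[OF assms] swapped_cut_ideal_eq[OF assms] by (auto simp: cut_L_def monom_span_def)

theorem theorem5p7:
  fixes n :: nat and i :: int
  assumes "n \<ge> 4" and "i \<ge> 0"
  shows "beta TYPE('k::field) n i = 2 * beta TYPE('k) (n - 1) i + lambda TYPE('k) n (i - 1)"
proof -
  define k where "k = n - 1"
  have n: "n = Suc k" and k: "2 \<le> k" using assms(1) by (auto simp: k_def)
  obtain j where j: "i = int j" using assms(2) nonneg_int_cases by blast
  let ?V = "cut_vars k" and ?W = "cut_vars (Suc k)"
  let ?E = "parity_exponents k True" and ?O = "parity_exponents k False"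
  have VW: "?V \<subseteq> ?W" by (auto simp: cut_vars_def)
  have res: "\<exists>B D. universal_resolution ?V (parity_exponents k e) B (D :: nat \<Rightarrow> (cut_var, 'k) mpoly mat)" for e
    unfolding parity_exponents_multiples
    by (rule monomial_ideal_resolution[OF finite_parity_generators keys_parity_generators])
  obtain BF and DF :: "nat \<Rightarrow> (cut_var, 'k) mpoly mat" where F: "universal_resolution ?V ?E BF DF" using res by blast
  obtain BG and DG :: "nat \<Rightarrow> (cut_var, 'k) mpoly mat" where G: "universal_resolution ?V ?O BG DG" using res by blast
  obtain BH and DH :: "nat \<Rightarrow> (cut_var, 'k) mpoly mat" where H: "universal_resolution ?V (?E \<inter> ?O) BH DH"
  proof -
    have "\<exists>B D. universal_resolution ?V (?E \<inter> ?O) B (D :: nat \<Rightarrow> (cut_var, 'k) mpoly mat)"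
      unfolding parity_exponents_multiples multiples_Int
    proof (rule monomial_ideal_resolution)
      fix g assume "g \<in> (\<lambda>(g,h). g + (h - g)) ` (parity_generators k True \<times> parity_generators k False)"
      then obtain g1 g2 where "g1 \<in> parity_generators k True" "g2 \<in> parity_generators k False" "g = g1 + (g2 - g1)" by auto
      then show "keys g \<subseteq> ?V" using keys_parity_generators by (simp add: keys_exponent_lcm)
    qed (simp add: finite_parity_generators)
    then show ?thesis using that by blast
  qed
  note FV = universal_resolutionD[OF F order_refl] and FW = universal_resolutionD[OF F VW]
    and GV = universal_resolutionD[OF G order_refl] and GW = universal_resolutionD[OF G VW]
    and HV = universal_resolutionD[OF H order_refl] and HW = universal_resolutionD[OF H VW]
  define h where "h = tor_dim (BF \<circ> Suc) (DF \<circ> Suc) j"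
  have hF: "tor_rank BF DF j h" unfolding h_def by (rule tor_rank_tor_dim[OF resolvesD(2)[OF FV]])
  \<comment> \<open>The two summands have equal Betti numbers: the renamed resolution of \<open>E\<^sub>k\<close> resolves \<open>O\<^sub>k\<close>.\<close>
  have hG: "tor_rank BG DG j h"
  proof -
    interpret variable_involution "transpose (SVar k) (TVar k)" by (rule last_edge_involution)
    have k1: "1 \<le> k" using k by simp
    have "resolves ?V (monom_span ?V ?O) BF (\<lambda>i. rename_mat (DF i))"
      using resolves_rename[OF last_edge_swap_vars[OF k1] FV]
      by (simp add: rename_monom_span[OF last_edge_swap_vars[OF k1]] last_edge_swap_parity[OF k1])
    then show ?thesis using tor_rank_independent[OF _ GV] hF tor_rank_rename by blast
  qed
  define l where "l = (if j = 0 then 0 else tor_dim (BH \<circ> Suc) (DH \<circ> Suc) (j - 1))"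
  have lH: "if j = 0 then l = 0 else tor_rank BH DH (j - 1) l"
    unfolding l_def using tor_rank_tor_dim[OF resolvesD(2)[OF HV]] by simp
  let ?t = "single (TVar (Suc k)) (1::nat)" and ?s = "single (SVar (Suc k)) (1::nat)"
  obtain \<alpha> where \<alpha>: "\<And>V. ?V \<subseteq> V \<Longrightarrow> chain_map V BH DH BF DF \<alpha>" "\<alpha> 0 = 1\<^sub>m 1"
    by (rule universal_map_exists[OF H F]) auto
  obtain \<beta> where \<beta>: "\<And>V. ?V \<subseteq> V \<Longrightarrow> chain_map V BH DH BG DG \<beta>" "\<beta> 0 = 1\<^sub>m 1"
    by (rule universal_map_exists[OF H G]) auto
  let ?C = "sum_cone_rank BF BG BH" and ?D = "sum_cone_diff (monomial ?t) (monomial ?s) BF DF BG DG BH DH \<alpha> \<beta>"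
  have st: "keys ?t \<subseteq> ?W" "keys ?s \<subseteq> ?W" "keys ?t \<inter> keys ?s = {}"
    by (auto simp: cut_vars_def)
  have "resolves ?W (monom_span ?W ((+) ?t ` ?E \<union> (+) ?s ` ?O)) ?C ?D"
    by (rule resolves_monom_cone[OF FW GW HW \<alpha>(1)[OF VW] \<alpha>(2) \<beta>(1)[OF VW] \<beta>(2) st])
      (use parity_exponents_add in blast)+
  then have cone: "resolves ?W (cut_ideal n) ?C ?D"
    using k by (simp add: n cut_ideal_eq parity_exponents_Suc_eq)
  have c0: "const_coeff (monomial ?t :: (cut_var, 'k) mpoly) = 0" "const_coeff (monomial ?s :: (cut_var, 'k) mpoly) = 0"
  proof -
    have "single v (1::nat) \<noteq> 0" for v :: cut_var
      by (metis lookup_single_eq lookup_zero zero_neq_one)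
    then show "const_coeff (monomial ?t :: (cut_var, 'k) mpoly) = 0" "const_coeff (monomial ?s :: (cut_var, 'k) mpoly) = 0"
      by (simp_all add: const_coeff_def lookup_single when_def)
  qed
  \<comment> \<open>The maps in the cone are multiples of the two new variables, so they vanish over \<open>K\<close>.\<close>
  have "tor_rank ?C ?D j (h + h + l)"
    by (rule tor_rank_sum_cone[OF resolvesD(2)[OF FW] resolvesD(2)[OF GW] resolvesD(2)[OF HW] \<alpha>(1)[OF VW] \<beta>(1)[OF VW]
          monom_in_poly_ring[OF st(1)] monom_in_poly_ring[OF st(2)] c0 hF hG lH])
  then have "beta TYPE('k) n i = h + h + l"
    unfolding beta_def j using betti_eqI[OF cone] by (simp add: n)
  moreover have "beta TYPE('k) (n - 1) i = h"
    unfolding beta_def j using betti_eqI[OF FV hF] by (simp add: n cut_ideal_eq[OF k])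
  moreover have "lambda TYPE('k) n (i - 1) = l"
  proof (cases "j = 0")
    case True
    then show ?thesis unfolding lambda_def j betti_def using lH by simp
  next
    case False
    then have i1: "i - 1 = int (j - 1)" by (simp add: j)
    have "tor_rank BH DH (j - 1) l" using lH False by simp
    then have "betti ?V (cut_L n :: (cut_var, 'k) mpoly set) (int (j - 1)) = l"
      unfolding n cut_L_eq[OF k] by (rule betti_eqI[OF HV])
    then show ?thesis by (simp only: lambda_def i1 n diff_Suc_1)
  qed
  ultimately show ?thesis by simp
qed

end
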